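(* For each $n$ let parameters $k,q,s,M,M',x,x'$ (all allowed to depend on $n$) be given, where $q>0$, $s\ge 0$, $x\in[0,1]^M$, $x'\in[0,1]^{M'}$, $\sum_{\ell=1}^M x_\ell=\sum_{\ell=1}^{M'}x'_\ell=1$, and let $\mathbb{P}=\mathbb{P}_{\rm Binary}(n,k,q,s,M,x)$ and $\mathbb{Q}=\mathbb{P}_{\rm Binary}(n,k,q,s,M',x')$. Assume that $M\min_\ell x_\ell\ge C$ and $M'\min_\ell x'_\ell\ge C$ for some constant $C>0$, and that $q+s/(\min_\ell x_\ell)\le\tau_1$ for some constant $\tau_1<1$ (constants independent of $n$). Write $\widetilde M=|M-M'|$ and $\widehat M=\max\{M,M'\}$. Then, as $n\to\infty$: (1) If $D=D_n$ satisfies $D^5\widehat M^2\,\frac{s^2}{q}\left(\frac{k^2}{n}\vee 1\right)=o(1)$, then no degree-$D$ test weakly separates $\mathbb{P}$ and $\mathbb{Q}$. (2) If $\widetilde M^{2/3}\,\frac{s^2}{q}\,\frac{k^2}{n}=\omega(1)$, $\widehat M^{-1/3}sk=\omega(1)$ and $\widetilde M^2k/\widehat M^2=\omega(1)$, then there exists a degree-3 test that strongly separates $\mathbb{P}$ and $\mathbb{Q}$.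
   Context: Notation: $[n]=\{1,\dots,n\}$, $a\vee b=\max\{a,b\}$. Binary observation model. Given the number of vertices $n$, total community size $k$ (with $0<k\le n$), edge probability parameters $q,s\ge0$, number of communities $M\in\{1,2,\dots\}$ and community proportions $x$ with nonnegative entries, $\sum_{\ell=1}^M x_\ell=1$ (all $x_\ell>0$, and $q+s/x_\ell\le 1$ for all $\ell$ so that the model is defined), the distribution $\mathbb{P}_{\rm Binary}(n,k,q,s,M,x)$ of the observation $Y$ is defined as follows. Independently for each $i\in[n]$, a label $\sigma_i$ is sampled with $\sigma_i=\ell$ with probability $x_\ell k/n$ for each $\ell\in[M]$ and $\sigma_i=\star$ (no community) with probability $1-k/n$. Given the labels, independently for $i<j$, $Y_{ij}\sim\mathrm{Bernoulli}(q+s/x_\ell)$ if $\sigma_i=\sigma_j=\ell$ for some $\ell\in[M]$, and $Y_{ij}\sim\mathrm{Bernoulli}(q)$ otherwise; for $i>j$, $Y_{ij}=Y_{ji}$, and $Y_{ii}=0$. Both $\mathbb{P}$ and $\mathbb{Q}$ are assumed to be well-defined models of this kind. Tests and separation. For sequences of distributions $\mathbb{P}=\mathbb{P}_n$, $\mathbb{Q}=\mathbb{Q}_n$ on $\mathbb{R}^{N_n}$, a degree-$D$ test is a sequence of polynomials $f=f_n:\mathbb{R}^{N_n}\to\mathbb{R}$ of degree at most $D=D_n$. It strongly separates $\mathbb{P}$ and $\mathbb{Q}$ if, as $n\to\infty$, $\sqrt{\max\{\mathrm{Var}_{\mathbb{Q}}[f],\mathrm{Var}_{\mathbb{P}}[f]\}}=o\left(|\mathbb{E}_{\mathbb{P}}[f]-\mathbb{E}_{\mathbb{Q}}[f]|\right)$,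 and weakly separates them if the same holds with $O(\cdot)$ in place of $o(\cdot)$; in both cases it is understood that $\mathbb{E}_{\mathbb{P}}[f]\ne\mathbb{E}_{\mathbb{Q}}[f]$ for all sufficiently large $n$. *)

theory Defs
  imports "HOL-Probability.Probability" "HOL-Probability.Product_PMF" "HOL-Library.Landau_Symbols"
begin

text \<open>
  The vertices are \<open>{1..n}\<close>; the label \<open>None\<close> stands for ``no community'' (the label \<open>\<star>\<close>),
  \<open>Some l\<close> for community \<open>l \<in> {1..M}\<close>. The proportions \<open>x\<close> are a function on \<open>nat\<close> of which only
  the values on \<open>{1..M}\<close> matter. The total community size \<open>k\<close> enters only through \<open>k / n\<close> and may
  be any real number in \<open>(0, n]\<close>.
\<close>

definition binary_model_ok ::
    "nat \<Rightarrow> real \<Rightarrow> real \<Rightarrow> real \<Rightarrow> nat \<Rightarrow> (nat \<Rightarrow> real) \<Rightarrow> bool" where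
  "binary_model_ok n k q s M x \<longleftrightarrow>
     0 < k \<and> k \<le> real n \<and> 0 \<le> q \<and> 0 \<le> s \<and> 1 \<le> M \<and>
     (\<forall>l\<in>{1..M}. 0 < x l) \<and> (\<Sum>l=1..M. x l) = 1 \<and>
     (\<forall>l\<in>{1..M}. q + s / x l \<le> 1)"

definition label_prob :: "nat \<Rightarrow> real \<Rightarrow> nat \<Rightarrow> (nat \<Rightarrow> real) \<Rightarrow> nat option \<Rightarrow> real" where
  "label_prob n k M x c = (case c of
       None \<Rightarrow> 1 - k / real n
     | Some l \<Rightarrow> if l \<in> {1..M} then x l * k / real n else 0)"

definition label_pmf :: "nat \<Rightarrow> real \<Rightarrow> nat \<Rightarrow> (nat \<Rightarrow> real) \<Rightarrow> nat option pmf" where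
  "label_pmf n k M x = embed_pmf (label_prob n k M x)"

definition edge_prob ::
    "real \<Rightarrow> real \<Rightarrow> (nat \<Rightarrow> real) \<Rightarrow> nat option \<Rightarrow> nat option \<Rightarrow> real" where
  "edge_prob q s x a b = (case a of
       None \<Rightarrow> q
     | Some l \<Rightarrow> if b = Some l then q + s / x l else q)"

definition edges :: "nat \<Rightarrow> (nat \<times> nat) set" where
  "edges n = {(i, j). 1 \<le> i \<and> i < j \<and> j \<le> n}"

definition adj_matrix :: "(nat \<times> nat \<Rightarrow> bool) \<Rightarrow> nat \<times> nat \<Rightarrow> real" where
  "adj_matrix W = (\<lambda>(i, j).
     if i < j then of_bool (W (i, j)) else if j < i then of_bool (W (j, i)) else 0)"

text \<open>
  The law of the observed symmetric matrix \<open>Y\<close>. Its entries outside \<open>{1..n} \<times> {1..n}\<close> are \<open>0\<close>,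
  by the default value \<open>False\<close> of the product of Bernoulli laws over \<open>edges n\<close>.
\<close>

definition binary_model ::
    "nat \<Rightarrow> real \<Rightarrow> real \<Rightarrow> real \<Rightarrow> nat \<Rightarrow> (nat \<Rightarrow> real) \<Rightarrow> (nat \<times> nat \<Rightarrow> real) pmf" where
  "binary_model n k q s M x =
     bind_pmf (Pi_pmf {1..n} None (\<lambda>_. label_pmf n k M x)) (\<lambda>\<sigma>.
       map_pmf adj_matrix
         (Pi_pmf (edges n) False (\<lambda>(i, j). bernoulli_pmf (edge_prob q s x (\<sigma> i) (\<sigma> j)))))"

lemma pmf_label_pmf:
  assumes "binary_model_ok n k q s M x"
  shows "pmf (label_pmf n k M x) c = label_prob n k M x c"
  unfolding label_pmf_def
proof (rule pmf_embed_pmf)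
  have k: "0 < k" "k \<le> real n" and x: "\<forall>l\<in>{1..M}. 0 < x l" "(\<Sum>l=1..M. x l) = 1"
    using assms by (auto simp: binary_model_ok_def)
  show nonneg: "0 \<le> label_prob n k M x c" for c
    using k x by (auto simp: label_prob_def less_imp_le split: option.splits)
  let ?A = "insert None (Some ` {1..M})"
  have "(\<integral>\<^sup>+ c. ennreal (label_prob n k M x c) \<partial>count_space UNIV) =
        (\<Sum>c\<in>?A. ennreal (label_prob n k M x c))"
    by (rule nn_integral_count_space'[where A = ?A])
       (auto simp: label_prob_def split: option.splits)
  also have "\<dots> = ennreal (\<Sum>c\<in>?A. label_prob n k M x c)"
    using nonneg by (intro sum_ennreal) auto
  also have "(\<Sum>c\<in>?A. label_prob n k M x c) =
      (1 - k / real n) + (\<Sum>l\<in>{1..M}. x l * k / real n)"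
    by (subst sum.insert) (auto simp: label_prob_def sum.reindex)
  also have "(\<Sum>l\<in>{1..M}. x l * k / real n) = (\<Sum>l\<in>{1..M}. x l) * (k / real n)"
    by (simp add: sum_distrib_right sum_divide_distrib)
  also have "(1 - k / real n) + \<dots> = 1"
    using x by simp
  finally show "(\<integral>\<^sup>+ c. ennreal (label_prob n k M x c) \<partial>count_space UNIV) = 1"
    by simp
qed

text \<open>
  Real polynomial functions of total degree at most \<open>d\<close> in the variables \<open>Y v\<close>, \<open>v \<in> V\<close>, for a
  finite set \<open>V\<close>; a monomial is given by its exponents \<open>e\<close>.
\<close>

definition exponents :: "'v set \<Rightarrow> nat \<Rightarrow> ('v \<Rightarrow> nat) set" where
  "exponents V d = {e. (\<forall>v. v \<notin> V \<longrightarrow> e v = 0) \<and> (\<Sum>v\<in>V. e v) \<le> d}"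

definition polynomial_of_degree_le :: "'v set \<Rightarrow> nat \<Rightarrow> (('v \<Rightarrow> real) \<Rightarrow> real) \<Rightarrow> bool" where
  "polynomial_of_degree_le V d f \<longleftrightarrow>
     (\<exists>c. \<forall>Y. f Y = (\<Sum>e\<in>exponents V d. c e * (\<Prod>v\<in>V. Y v ^ e v)))"

lemma finite_exponents:
  assumes "finite V"
  shows "finite (exponents V d)"
proof (rule finite_subset)
  show "exponents V d \<subseteq> {e. \<forall>v. (v \<in> V \<longrightarrow> e v \<in> {..d}) \<and> (v \<notin> V \<longrightarrow> e v = 0)}"
  proof
    fix e assume e: "e \<in> exponents V d"
    have "e v \<le> d" if "v \<in> V" for v
    proof -
      have "e v \<le> (\<Sum>v\<in>V. e v)"
        by (rule member_le_sum) (use that assms in simp_all)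
      also have "\<dots> \<le> d"
        using e by (simp add: exponents_def)
      finally show ?thesis .
    qed
    then show "e \<in> {e. \<forall>v. (v \<in> V \<longrightarrow> e v \<in> {..d}) \<and> (v \<notin> V \<longrightarrow> e v = 0)}"
      using e by (simp add: exponents_def)
  qed
  show "finite {e. \<forall>v. (v \<in> V \<longrightarrow> e v \<in> {..d}) \<and> (v \<notin> V \<longrightarrow> e v = (0::nat))}"
    using assms by (intro finite_set_of_finite_funs) simp_all
qed

definition degree_test :: "(nat \<Rightarrow> nat) \<Rightarrow> (nat \<Rightarrow> (nat \<times> nat \<Rightarrow> real) \<Rightarrow> real) \<Rightarrow> bool" where
  "degree_test D f \<longleftrightarrow>
     (\<forall>n. polynomial_of_degree_le ({1..n} \<times> {1..n}) (D n) (f n))"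

definition test_std :: "'a pmf \<Rightarrow> 'a pmf \<Rightarrow> ('a \<Rightarrow> real) \<Rightarrow> real" where
  "test_std P Q f = sqrt (max (measure_pmf.variance Q f) (measure_pmf.variance P f))"

definition test_gap :: "'a pmf \<Rightarrow> 'a pmf \<Rightarrow> ('a \<Rightarrow> real) \<Rightarrow> real" where
  "test_gap P Q f = \<bar>measure_pmf.expectation P f - measure_pmf.expectation Q f\<bar>"

definition strongly_separates ::
    "(nat \<Rightarrow> 'a pmf) \<Rightarrow> (nat \<Rightarrow> 'a pmf) \<Rightarrow> (nat \<Rightarrow> 'a \<Rightarrow> real) \<Rightarrow> bool" where
  "strongly_separates P Q f \<longleftrightarrow>
     (\<lambda>n. test_std (P n) (Q n) (f n)) \<in> o(\<lambda>n. test_gap (P n) (Q n) (f n)) \<and>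
     (\<forall>\<^sub>F n in sequentially.
        measure_pmf.expectation (P n) (f n) \<noteq> measure_pmf.expectation (Q n) (f n))"

definition weakly_separates ::
    "(nat \<Rightarrow> 'a pmf) \<Rightarrow> (nat \<Rightarrow> 'a pmf) \<Rightarrow> (nat \<Rightarrow> 'a \<Rightarrow> real) \<Rightarrow> bool" where
  "weakly_separates P Q f \<longleftrightarrow>
     (\<lambda>n. test_std (P n) (Q n) (f n)) \<in> O(\<lambda>n. test_gap (P n) (Q n) (f n)) \<and>
     (\<forall>\<^sub>F n in sequentially.
        measure_pmf.expectation (P n) (f n) \<noteq> measure_pmf.expectation (Q n) (f n))"

end

theory Submission
  imports Defs
begin

text \<open>
  Write \<open>X\<close> for the edge probabilities minus \<open>q\<close>, given the labels, and \<open>m \<alpha> = E (\<Prod>e\<in>\<alpha>. X e)\<close>.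
  A connected edge set \<open>\<alpha>\<close> with vertex set \<open>V\<close> has
  \<open>m \<alpha> = (k / n) ^ |V| * s ^ |\<alpha>| * (\<Sum>l. x l ^ (|V| - |\<alpha>|))\<close>. This does not depend on the
  proportions when \<open>\<alpha>\<close> is a tree, and the sum equals \<open>M\<close> when \<open>|V| = |\<alpha>|\<close>, so the smallest edge
  set that distinguishes the models is the triangle.

  Lower bound: expand a polynomial in the products of \<open>Y e - q\<close>. Conditioning on the labels and
  Jensen's inequality bound its second moment under \<open>P\<close> from below by a sum of squares, and the
  difference of expectations is paired with these squares through the weights \<open>w\<close> that solve
  \<open>m' \<alpha> = (\<Sum>\<beta>\<subseteq>\<alpha>. w \<beta> * m (\<alpha> - \<beta>))\<close>. The weight of \<open>\<beta>\<close> vanishes whenever some component of \<open>\<beta>\<close> is a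
  tree, hence whenever \<open>\<beta>\<close> has more vertices than edges, and counting the remaining edge sets with
  Cauchy-Schwarz gives the bound.

  Upper bound: the signed triangle count has mean proportional to \<open>(s k)\<^sup>3 M\<close>; its variance is
  bounded by grouping pairs of triangles according to the size of their union.
\<close>

section \<open>Finite expectations\<close>

text \<open>The labels make the edges dependent, so neither law has a usable orthogonal basis, and
  comparing each model with independent edges is too lossy: a single edge then contributes about
  (s^2/q) (k^2/n)^2, which need not be small. The weights compare the models directly. They are a
  quotient of the two moment functions under convolution over subsets, hence multiplicative over
  components like the moments themselves; the difference of moments is not, and would retain a tree
  next to a cycle. A remaining set with u vertices and e edges has u <= e, so n^u (k/n)^(2u) is at
  most max(k^2/n, 1)^e, one factor per edge. D^5 is made of D^2 from the squared weights, D^2 from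
  choosing each edge among pairs of at most D vertices, and D from the choice of u; Mhat^2 comes
  from the bound s Mhat / C on the signal. In the upper bound the three conditions control three
  kinds of noise: the edge noise (q n)^3, the fluctuation of single planted triangles, and
  overlapping triangles, whose joint moments involve 1/x_l.\<close>

lemma expectation_pair_pmf_mult:
  fixes f :: "'a \<Rightarrow> real" and g :: "'b \<Rightarrow> real"
  assumes "finite (set_pmf p)" "finite (set_pmf r)"
  shows "measure_pmf.expectation (pair_pmf p r) (\<lambda>z. f (fst z) * g (snd z)) =
    measure_pmf.expectation p f * measure_pmf.expectation r g"
proof -
  have "measure_pmf.expectation (pair_pmf p r) (\<lambda>z. f (fst z) * g (snd z)) =
      (\<Sum>z\<in>set_pmf p \<times> set_pmf r. f (fst z) * g (snd z) * pmf (pair_pmf p r) z)"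
    using assms by (intro integral_measure_pmf_real) auto
  also have "\<dots> = (\<Sum>a\<in>set_pmf p. \<Sum>b\<in>set_pmf r. (f a * pmf p a) * (g b * pmf r b))"
    by (subst sum.cartesian_product) (auto intro!: sum.cong simp: pmf_pair)
  also have "\<dots> = (\<Sum>a\<in>set_pmf p. f a * pmf p a) * (\<Sum>b\<in>set_pmf r. g b * pmf r b)"
    by (simp add: sum_product)
  also have "(\<Sum>a\<in>set_pmf p. f a * pmf p a) = measure_pmf.expectation p f"
    using assms by (intro integral_measure_pmf_real[symmetric]) auto
  also have "(\<Sum>b\<in>set_pmf r. g b * pmf r b) = measure_pmf.expectation r g"
    using assms by (intro integral_measure_pmf_real[symmetric]) auto
  finally show ?thesis .
qed

lemma finite_set_Pi_pmf:
  assumes "finite A" "\<And>a. a \<in> A \<Longrightarrow> finite (set_pmf (p a))"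
  shows "finite (set_pmf (Pi_pmf A dflt p))"
  using assms by (simp add: set_Pi_pmf finite_PiE_dflt)

lemma expectation_Pi_pmf_prod_finite:
  fixes f :: "'a \<Rightarrow> 'b \<Rightarrow> real"
  assumes "finite A" "\<And>a. a \<in> A \<Longrightarrow> finite (set_pmf (p a))"
  shows "measure_pmf.expectation (Pi_pmf A dflt p) (\<lambda>y. \<Prod>a\<in>A. f a (y a)) =
    (\<Prod>a\<in>A. measure_pmf.expectation (p a) (f a))"
  using assms
proof (induction rule: finite_induct)
  case empty
  then show ?case by simp
next
  case (insert a A)
  have fin: "finite (set_pmf (Pi_pmf A dflt p))"
    using insert by (intro finite_set_Pi_pmf) auto
  have "measure_pmf.expectation (Pi_pmf (insert a A) dflt p) (\<lambda>y. \<Prod>a\<in>insert a A. f a (y a)) =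
     measure_pmf.expectation (pair_pmf (p a) (Pi_pmf A dflt p))
       (\<lambda>z. \<Prod>b\<in>insert a A. f b (((snd z)(a := fst z)) b))"
    using insert.hyps by (simp add: Pi_pmf_insert case_prod_unfold)
  also have "(\<lambda>z. \<Prod>b\<in>insert a A. f b (((snd z)(a := fst z)) b)) =
      (\<lambda>z. f a (fst z) * (\<Prod>b\<in>A. f b (snd z b)))"
    using insert.hyps by (auto intro!: ext prod.cong)
  also have "measure_pmf.expectation (pair_pmf (p a) (Pi_pmf A dflt p)) \<dots> =
      measure_pmf.expectation (p a) (f a) *
      measure_pmf.expectation (Pi_pmf A dflt p) (\<lambda>y. \<Prod>b\<in>A. f b (y b))"
    using insert.prems fin by (intro expectation_pair_pmf_mult) auto
  finally show ?case
    using insert by simp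
qed

text \<open>\<open>V\<close> lies inside \<open>A - U\<close>, so the product law splits into
  independent laws on \<open>U\<close> and \<open>A - U\<close>, and each function sees only one of
  the two factors.\<close>

lemma expectation_Pi_pmf_indep:
  fixes f g :: "('a \<Rightarrow> 'b) \<Rightarrow> real"
  assumes "finite A" "\<And>a. a \<in> A \<Longrightarrow> finite (set_pmf (p a))"
    and "U \<subseteq> A" "V \<subseteq> A" "U \<inter> V = {}"
    and f: "\<And>y z. (\<And>a. a \<in> U \<Longrightarrow> y a = z a) \<Longrightarrow> f y = f z"
    and g: "\<And>y z. (\<And>a. a \<in> V \<Longrightarrow> y a = z a) \<Longrightarrow> g y = g z"
  shows "measure_pmf.expectation (Pi_pmf A dflt p) (\<lambda>y. f y * g y) =
    measure_pmf.expectation (Pi_pmf A dflt p) f * measure_pmf.expectation (Pi_pmf A dflt p) g"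
proof -
  define PU PV where "PU = Pi_pmf U dflt p" and "PV = Pi_pmf (A - U) dflt p"
  have fin: "finite U" "finite (A - U)"
    using assms by (auto dest: finite_subset)
  have finP: "finite (set_pmf PU)" "finite (set_pmf PV)"
    unfolding PU_def PV_def using assms fin by (auto intro!: finite_set_Pi_pmf)
  define h where "h = (\<lambda>z x. if x \<in> U then (fst z :: 'a \<Rightarrow> 'b) x else snd z x)"
  have "Pi_pmf A dflt p = Pi_pmf (U \<union> (A - U)) dflt p"
    using assms(3) by (simp add: Un_absorb1)
  also have "\<dots> = map_pmf h (pair_pmf PU PV)"
    unfolding PU_def PV_def h_def case_prod_unfold[symmetric]
    using Pi_pmf_union[of U "A - U" dflt p] fin by (simp add: case_prod_unfold)
  finally have P: "Pi_pmf A dflt p = map_pmf h (pair_pmf PU PV)" .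
  have fh: "f (h z) = f (fst z)" for z
    by (rule f) (simp add: h_def)
  have gh: "g (h z) = g (snd z)" for z
    by (rule g) (use assms(5) in \<open>auto simp: h_def\<close>)
  show ?thesis
    unfolding P using finP by (simp add: fh gh expectation_pair_pmf_mult)
qed

lemma expectation_mono_finite:
  fixes f g :: "'a \<Rightarrow> real"
  assumes "finite (set_pmf p)" "\<And>y. y \<in> set_pmf p \<Longrightarrow> f y \<le> g y"
  shows "measure_pmf.expectation p f \<le> measure_pmf.expectation p g"
  using assms by (intro integral_mono_AE integrable_measure_pmf_finite) (auto simp: AE_measure_pmf_iff)

lemma expectation_cong_pmf:
  fixes f g :: "'a \<Rightarrow> real"
  assumes "\<And>y. y \<in> set_pmf p \<Longrightarrow> f y = g y"
  shows "measure_pmf.expectation p f = measure_pmf.expectation p g"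
  using assms by (intro integral_cong_AE) (auto simp: AE_measure_pmf_iff)

lemma expectation_sum_finite:
  fixes f :: "'i \<Rightarrow> 'a \<Rightarrow> real"
  assumes "finite (set_pmf p)"
  shows "measure_pmf.expectation p (\<lambda>y. \<Sum>i\<in>I. f i y) = (\<Sum>i\<in>I. measure_pmf.expectation p (f i))"
  using assms by (intro Bochner_Integration.integral_sum integrable_measure_pmf_finite)

lemma expectation_square_ge:
  fixes f :: "'a \<Rightarrow> real"
  assumes "finite (set_pmf p)"
  shows "(measure_pmf.expectation p f)\<^sup>2 \<le> measure_pmf.expectation p (\<lambda>y. (f y)\<^sup>2)"
proof -
  have "0 \<le> measure_pmf.variance p f"
    by simp
  also have "\<dots> = measure_pmf.expectation p (\<lambda>y. (f y)\<^sup>2) - (measure_pmf.expectation p f)\<^sup>2"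
    using assms by (intro measure_pmf.variance_eq integrable_measure_pmf_finite)
  finally show ?thesis by simp
qed

lemma expectation_bind_pmf_finite:
  fixes f :: "'b \<Rightarrow> real"
  assumes "finite (set_pmf p)" "\<And>y. y \<in> set_pmf p \<Longrightarrow> finite (set_pmf (r y))"
  shows "measure_pmf.expectation (bind_pmf p r) f =
    measure_pmf.expectation p (\<lambda>y. measure_pmf.expectation (r y) f)"
proof -
  have "finite (set_pmf (bind_pmf p r))"
    using assms by simp
  then have "measure_pmf.expectation (bind_pmf p r) f =
      (\<Sum>z\<in>set_pmf (bind_pmf p r). f z * pmf (bind_pmf p r) z)"
    by (intro integral_measure_pmf_real) auto
  also have "\<dots> = (\<Sum>z\<in>set_pmf (bind_pmf p r). \<Sum>y\<in>set_pmf p. f z * (pmf (r y) z * pmf p y))"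
    using assms by (simp add: pmf_bind integral_measure_pmf_real[of "set_pmf p"] sum_distrib_left)
  also have "\<dots> = (\<Sum>y\<in>set_pmf p. \<Sum>z\<in>set_pmf (bind_pmf p r). f z * pmf (r y) z * pmf p y)"
    by (subst sum.swap) (simp add: mult_ac)
  also have "\<dots> = (\<Sum>y\<in>set_pmf p. measure_pmf.expectation (r y) f * pmf p y)"
  proof (rule sum.cong[OF refl])
    fix y assume "y \<in> set_pmf p"
    then have "measure_pmf.expectation (r y) f =
        (\<Sum>z\<in>set_pmf (bind_pmf p r). f z * pmf (r y) z)"
      using assms by (intro integral_measure_pmf_real) auto
    then show "(\<Sum>z\<in>set_pmf (bind_pmf p r). f z * pmf (r y) z * pmf p y) =
        measure_pmf.expectation (r y) f * pmf p y"
      by (simp add: sum_distrib_right)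
  qed
  also have "\<dots> = measure_pmf.expectation p (\<lambda>y. measure_pmf.expectation (r y) f)"
    using assms by (intro integral_measure_pmf_real[symmetric]) auto
  finally show ?thesis .
qed

section \<open>Edge sets and deconvolution\<close>

definition verts :: "('a \<times> 'a) set \<Rightarrow> 'a set" where
  "verts \<alpha> = fst ` \<alpha> \<union> snd ` \<alpha>"

text \<open>Connectivity is stated by cuts instead of paths: a vertex set that no edge crosses
  contains all endpoints or none. Cuts are what the arguments below supply, namely the vertices
  already reached or the vertices that carry a given label. The empty edge set is connected.\<close>

definition conn :: "('a \<times> 'a) set \<Rightarrow> bool" where
  "conn \<alpha> \<longleftrightarrow> (\<forall>S. (\<forall>(i, j)\<in>\<alpha>. i \<in> S \<longleftrightarrow> j \<in> S) \<longrightarrow> verts \<alpha> \<subseteq> S \<or> verts \<alpha> \<inter> S = {})"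

lemma verts_empty [simp]: "verts {} = {}"
  by (simp add: verts_def)

lemma verts_insert: "verts (insert e \<alpha>) = insert (fst e) (insert (snd e) (verts \<alpha>))"
  by (auto simp: verts_def)

lemma verts_Un: "verts (\<alpha> \<union> \<beta>) = verts \<alpha> \<union> verts \<beta>"
  by (auto simp: verts_def)

lemma verts_mono: "\<alpha> \<subseteq> \<beta> \<Longrightarrow> verts \<alpha> \<subseteq> verts \<beta>"
  by (auto simp: verts_def)

lemma finite_verts [simp]: "finite \<alpha> \<Longrightarrow> finite (verts \<alpha>)"
  by (simp add: verts_def)

lemma subset_verts_Times: "\<alpha> \<subseteq> verts \<alpha> \<times> verts \<alpha>"
  by (force simp: verts_def)

lemma verts_eq_empty_iff [simp]: "verts \<alpha> = {} \<longleftrightarrow> \<alpha> = {}"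
  by (auto simp: verts_def)

lemma conn_excess_mono:
  assumes "conn \<alpha>" "finite \<alpha>" "\<beta> \<subseteq> \<alpha>" "\<beta> \<noteq> {}"
  shows "card (verts \<alpha>) + card \<beta> \<le> card (verts \<beta>) + card \<alpha>"
  using assms(3,4)
proof (induction "card (\<alpha> - \<beta>)" arbitrary: \<beta> rule: less_induct)
  case less
  have fin: "finite \<beta>"
    using less.prems assms(2) by (auto dest: finite_subset)
  show ?case
  proof (cases "\<beta> = \<alpha>")
    case False
    \<comment> \<open>If no missing edge touched \<open>verts \<beta>\<close>, then
      \<open>verts \<beta>\<close> would be an uncrossed cut, hence would contain all of
      \<open>verts \<alpha>\<close>, and every missing edge would touch it after all.\<close>
    obtain e where e: "e \<in> \<alpha>" "e \<notin> \<beta>" "fst e \<in> verts \<beta> \<or> snd e \<in> verts \<beta>"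
    proof (rule ccontr)
      assume "\<not> thesis"
      with that have no: "fst e \<notin> verts \<beta> \<and> snd e \<notin> verts \<beta>" if "e \<in> \<alpha>" "e \<notin> \<beta>" for e
        using that by blast
      have "\<forall>(i, j)\<in>\<alpha>. i \<in> verts \<beta> \<longleftrightarrow> j \<in> verts \<beta>"
      proof safe
        fix i j assume "(i, j) \<in> \<alpha>" "i \<in> verts \<beta>"
        then show "j \<in> verts \<beta>"
          using no[of "(i, j)"] by (force simp: verts_def)
      next
        fix i j assume "(i, j) \<in> \<alpha>" "j \<in> verts \<beta>"
        then show "i \<in> verts \<beta>"
          using no[of "(i, j)"] by (force simp: verts_def)
      qed
      then have "verts \<alpha> \<subseteq> verts \<beta> \<or> verts \<alpha> \<inter> verts \<beta> = {}"
        using assms(1) by (auto simp: conn_def)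
      moreover have "verts \<beta> \<noteq> {}" "verts \<beta> \<subseteq> verts \<alpha>"
        using less.prems by (auto dest: verts_mono)
      ultimately have "verts \<alpha> \<subseteq> verts \<beta>"
        by blast
      moreover obtain e where "e \<in> \<alpha>" "e \<notin> \<beta>"
        using False less.prems by blast
      ultimately show False
        using no[of e] by (auto simp: verts_def)
    qed
    have "\<alpha> - insert e \<beta> \<subset> \<alpha> - \<beta>"
      using e by blast
    then have "card (\<alpha> - insert e \<beta>) < card (\<alpha> - \<beta>)"
      using assms(2) by (intro psubset_card_mono) auto
    then have "card (verts \<alpha>) + card (insert e \<beta>) \<le> card (verts (insert e \<beta>)) + card \<alpha>"
      using less.prems e by (intro less.hyps) auto
    moreover have "card (verts (insert e \<beta>)) \<le> Suc (card (verts \<beta>))"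
      using e fin by (auto simp: verts_insert card_insert_if insert_absorb)
    ultimately show ?thesis
      using e fin by simp
  qed simp
qed

lemma conn_verts_le:
  assumes "conn \<alpha>" "finite \<alpha>"
  shows "card (verts \<alpha>) \<le> card \<alpha> + 1"
proof (cases "\<alpha> = {}")
  case False
  then obtain e where "e \<in> \<alpha>" by blast
  then have "card (verts \<alpha>) + card {e} \<le> card (verts {e}) + card \<alpha>"
    using assms by (intro conn_excess_mono) auto
  moreover have "card (verts {e}) \<le> 2"
    by (simp add: verts_insert card_insert_if)
  ultimately show ?thesis by simp
qed simp

lemma not_conn_split:
  assumes "\<not> conn \<alpha>"
  obtains \<beta> \<gamma> where "\<alpha> = \<beta> \<union> \<gamma>" "\<beta> \<noteq> {}" "\<gamma> \<noteq> {}" "verts \<beta> \<inter> verts \<gamma> = {}"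
proof -
  obtain S where S: "\<forall>(i, j)\<in>\<alpha>. i \<in> S \<longleftrightarrow> j \<in> S"
    and ns: "\<not> verts \<alpha> \<subseteq> S" "verts \<alpha> \<inter> S \<noteq> {}"
    using assms unfolding conn_def by blast
  define \<beta> where "\<beta> = {e\<in>\<alpha>. fst e \<in> S}"
  define \<gamma> where "\<gamma> = {e\<in>\<alpha>. fst e \<notin> S}"
  have \<beta>: "verts \<beta> \<subseteq> S" and \<gamma>: "verts \<gamma> \<inter> S = {}"
    using S by (fastforce simp: verts_def \<beta>_def \<gamma>_def)+
  have eq: "\<alpha> = \<beta> \<union> \<gamma>"
    by (auto simp: \<beta>_def \<gamma>_def)
  show thesis
  proof (rule that[OF eq])
    show "\<beta> \<noteq> {}" using ns(2) \<gamma> eq by auto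
    show "\<gamma> \<noteq> {}" using ns(1) \<beta> eq by auto
    show "verts \<beta> \<inter> verts \<gamma> = {}" using \<beta> \<gamma> by blast
  qed
qed

text \<open>Functions on finite sets form a ring under the convolution that sends f and g to the sum
  of f \<beta> g (\<alpha> - \<beta>) over \<beta> \<subseteq> \<alpha>. When
  \<open>m {} = 1\<close>, this is the quotient of \<open>m'\<close> by \<open>m\<close> in that
  ring; the recursion isolates the term \<beta> = \<alpha>. Infinite sets get the value 0, so that
  the cardinality decreases in every recursive call.\<close>

function deconv :: "('e set \<Rightarrow> real) \<Rightarrow> ('e set \<Rightarrow> real) \<Rightarrow> 'e set \<Rightarrow> real" where
  "deconv m' m \<alpha> =
     (if finite \<alpha> then m' \<alpha> - (\<Sum>\<beta>\<in>Pow \<alpha> - {\<alpha>}. deconv m' m \<beta> * m (\<alpha> - \<beta>)) else 0)"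
  by auto
termination
  by (relation "Wellfounded.measure (\<lambda>(_, _, \<alpha>). card \<alpha>)") (auto intro!: psubset_card_mono)

declare deconv.simps [simp del]

lemma sum_deconv:
  assumes "finite \<alpha>" "m {} = 1"
  shows "(\<Sum>\<beta>\<in>Pow \<alpha>. deconv m' m \<beta> * m (\<alpha> - \<beta>)) = m' \<alpha>"
proof -
  have "(\<Sum>\<beta>\<in>Pow \<alpha>. deconv m' m \<beta> * m (\<alpha> - \<beta>)) =
      deconv m' m \<alpha> * m (\<alpha> - \<alpha>) + (\<Sum>\<beta>\<in>Pow \<alpha> - {\<alpha>}. deconv m' m \<beta> * m (\<alpha> - \<beta>))"
    using assms(1) by (intro sum.remove) auto
  then show ?thesis
    using assms by (simp add: deconv.simps[of m' m \<alpha>])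
qed

lemma deconv_empty [simp]: "deconv m' m {} = m' {}"
  by (simp add: deconv.simps)

lemma sum_Pow_power_card:
  fixes t :: real
  assumes "finite \<alpha>"
  shows "(\<Sum>\<beta>\<in>Pow \<alpha>. t ^ card \<beta>) = (t + 1) ^ card \<alpha>"
  using prod_add[OF assms, of "\<lambda>_. t" "\<lambda>_. 1"] by simp

text \<open>The base 4D is what closes the induction for the size of the weights: (1 + 1/(4D))^e <=
  exp(1/4) <= 3/2 for e <= D, and the remaining half of (4D)^e absorbs the summand 1.\<close>

lemma power_succ_le:
  fixes D e :: nat
  assumes "1 \<le> e" "e \<le> D"
  shows "1 + (4 * real D + 1) ^ e \<le> 2 * (4 * real D) ^ e"
proof -
  have D: "1 \<le> real D"
    using assms by simp
  have "(1 + 1 / (4 * real D)) ^ e \<le> exp (1 / (4 * real D)) ^ e"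
    by (intro power_mono exp_ge_add_one_self) auto
  also have "\<dots> = exp (real e / (4 * real D))"
    by (simp add: exp_of_nat_mult[symmetric])
  also have "\<dots> \<le> exp (1 / 4)"
    using assms D by (simp add: field_simps)
  also have "\<dots> \<le> 1 + 1 / 4 + (1 / 4)\<^sup>2"
    by (rule exp_bound) auto
  also have "\<dots> \<le> 3 / 2"
    by (simp add: power2_eq_square)
  finally have "(4 * real D) ^ e * (1 + 1 / (4 * real D)) ^ e \<le> (4 * real D) ^ e * (3 / 2)"
    by (intro mult_left_mono) auto
  moreover have "4 * real D * (1 + 1 / (4 * real D)) = 4 * real D + 1"
    using D by (simp add: field_simps)
  then have "(4 * real D) ^ e * (1 + 1 / (4 * real D)) ^ e = (4 * real D + 1) ^ e"
    by (simp only: power_mult_distrib[symmetric])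
  ultimately have "(4 * real D + 1) ^ e \<le> (4 * real D) ^ e * (3 / 2)"
    by argo
  moreover have "2 \<le> (4 * real D) ^ e"
    using self_le_power[of "4 * real D" e] assms D by simp
  ultimately show ?thesis by linarith
qed

text \<open>With the inductive bound, the sum over proper subsets is at most (4D+1)^e - (4D)^e times
  the common bound \<open>B\<close>, and \<open>power_succ_le\<close> says that one more
  \<open>B\<close> still fits under (4D)^e. So deconvolution costs only a factor 4D per edge. The
  ground set \<open>\<alpha>\<^sub>0\<close> is where the bounds on both functions are
  known.\<close>

lemma abs_deconv_le:
  fixes a b :: real
  assumes a: "0 \<le> a" "a \<le> 1" and b: "0 \<le> b"
    and bound: "\<And>\<gamma>. finite \<gamma> \<Longrightarrow> \<gamma> \<subseteq> \<alpha>\<^sub>0 \<Longrightarrow> \<bar>m \<gamma>\<bar> \<le> a ^ card (verts \<gamma>) * b ^ card \<gamma>"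
      "\<And>\<gamma>. finite \<gamma> \<Longrightarrow> \<gamma> \<subseteq> \<alpha>\<^sub>0 \<Longrightarrow> \<bar>m' \<gamma>\<bar> \<le> a ^ card (verts \<gamma>) * b ^ card \<gamma>"
    and \<alpha>: "finite \<alpha>" "\<alpha> \<subseteq> \<alpha>\<^sub>0" "card \<alpha> \<le> D"
  shows "\<bar>deconv m' m \<alpha>\<bar> \<le> (4 * real D) ^ card \<alpha> * (a ^ card (verts \<alpha>) * b ^ card \<alpha>)"
  using \<alpha>
proof (induction "card \<alpha>" arbitrary: \<alpha> rule: less_induct)
  case less
  note fin = less.prems(1)
  define B where "B = a ^ card (verts \<alpha>) * b ^ card \<alpha>"
  have B: "0 \<le> B"
    using a b by (simp add: B_def)
  show ?case
  proof (cases "\<alpha> = {}")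
    case True
    then show ?thesis using bound(2)[of "{}"] by simp
  next
    case False
    then have e: "1 \<le> card \<alpha>"
      using fin by (simp add: Suc_le_eq card_gt_0_iff)
    have step: "\<bar>deconv m' m \<beta> * m (\<alpha> - \<beta>)\<bar> \<le> (4 * real D) ^ card \<beta> * B"
      if \<beta>: "\<beta> \<in> Pow \<alpha> - {\<alpha>}" for \<beta>
    proof -
      have fin\<beta>: "finite \<beta>" and lt: "card \<beta> < card \<alpha>"
        using \<beta> fin by (auto intro: psubset_card_mono finite_subset)
      have "\<bar>deconv m' m \<beta>\<bar> \<le> (4 * real D) ^ card \<beta> * (a ^ card (verts \<beta>) * b ^ card \<beta>)"
        using \<beta> less.prems lt fin\<beta> by (intro less.hyps) auto
      moreover have "\<bar>m (\<alpha> - \<beta>)\<bar> \<le> a ^ card (verts (\<alpha> - \<beta>)) * b ^ card (\<alpha> - \<beta>)"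
        using fin less.prems by (intro bound) auto
      ultimately have "\<bar>deconv m' m \<beta> * m (\<alpha> - \<beta>)\<bar> \<le>
          (4 * real D) ^ card \<beta> * (a ^ card (verts \<beta>) * b ^ card \<beta>) *
          (a ^ card (verts (\<alpha> - \<beta>)) * b ^ card (\<alpha> - \<beta>))"
        unfolding abs_mult using a b by (intro mult_mono) auto
      also have "\<dots> = (4 * real D) ^ card \<beta> *
          (a ^ (card (verts \<beta>) + card (verts (\<alpha> - \<beta>))) * b ^ (card \<beta> + card (\<alpha> - \<beta>)))"
        by (simp add: power_add mult_ac)
      also have "card \<beta> + card (\<alpha> - \<beta>) = card \<alpha>"
        using \<beta> fin fin\<beta> lt by (simp add: card_Diff_subset)
      \<comment> \<open>Vertices shared by \<beta> and \<alpha> - \<beta> are counted twice in the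
        exponent, which only lowers the power because \<open>a \<le> 1\<close>.\<close>
      also have "a ^ (card (verts \<beta>) + card (verts (\<alpha> - \<beta>))) \<le> a ^ card (verts \<alpha>)"
      proof (rule power_decreasing)
        have "\<alpha> = \<beta> \<union> (\<alpha> - \<beta>)"
          using \<beta> by blast
        then have "verts \<alpha> = verts \<beta> \<union> verts (\<alpha> - \<beta>)"
          by (metis verts_Un)
        then show "card (verts \<alpha>) \<le> card (verts \<beta>) + card (verts (\<alpha> - \<beta>))"
          by (simp add: card_Un_le)
      qed (use a in auto)
      finally show ?thesis
        using b by (simp add: B_def mult_left_mono mult_right_mono)
    qed
    have "\<bar>deconv m' m \<alpha>\<bar> \<le>
        \<bar>m' \<alpha>\<bar> + \<bar>\<Sum>\<beta>\<in>Pow \<alpha> - {\<alpha>}. deconv m' m \<beta> * m (\<alpha> - \<beta>)\<bar>"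
      using fin by (simp add: deconv.simps[of m' m \<alpha>])
    also have "\<dots> \<le> B + (\<Sum>\<beta>\<in>Pow \<alpha> - {\<alpha>}. (4 * real D) ^ card \<beta> * B)"
      unfolding B_def
      by (intro add_mono bound less.prems order_trans[OF sum_abs] sum_mono step[unfolded B_def])
    also have "(\<Sum>\<beta>\<in>Pow \<alpha> - {\<alpha>}. (4 * real D) ^ card \<beta> * B) =
        ((4 * real D + 1) ^ card \<alpha> - (4 * real D) ^ card \<alpha>) * B"
      using fin sum.remove[of "Pow \<alpha>" \<alpha> "\<lambda>\<beta>. (4 * real D) ^ card \<beta>"]
        sum_Pow_power_card[OF fin, of "4 * real D"]
      by (simp add: sum_distrib_right[symmetric])
    also have "B + ((4 * real D + 1) ^ card \<alpha> - (4 * real D) ^ card \<alpha>) * B =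
        (1 + (4 * real D + 1) ^ card \<alpha> - (4 * real D) ^ card \<alpha>) * B"
      by (simp add: algebra_simps)
    also have "\<dots> \<le> (4 * real D) ^ card \<alpha> * B"
      using power_succ_le[OF e less.prems(3)] by (intro mult_right_mono[OF _ B]) linarith
    finally show ?thesis by (simp add: B_def)
  qed
qed

lemma sum_Pow_Un_disjoint:
  fixes f :: "'e set \<Rightarrow> real"
  assumes "\<alpha> \<inter> \<beta> = {}"
  shows "(\<Sum>\<gamma>\<in>Pow (\<alpha> \<union> \<beta>). f \<gamma>) = (\<Sum>\<gamma>\<in>Pow \<alpha>. \<Sum>\<delta>\<in>Pow \<beta>. f (\<gamma> \<union> \<delta>))"
proof -
  have "(\<Sum>\<gamma>\<in>Pow (\<alpha> \<union> \<beta>). f \<gamma>) = (\<Sum>z\<in>Pow \<alpha> \<times> Pow \<beta>. f (fst z \<union> snd z))"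
    by (rule sum.reindex_bij_witness[where i = "\<lambda>z. fst z \<union> snd z"
          and j = "\<lambda>\<gamma>. (\<gamma> \<inter> \<alpha>, \<gamma> \<inter> \<beta>)"])
       (use assms in \<open>auto simp: Int_Un_distrib[symmetric] intro!: arg_cong[of _ _ f]\<close>)
  then show ?thesis
    by (simp add: sum.cartesian_product case_prod_unfold)
qed

text \<open>Uniqueness of the quotient: the weights of unions and the products of weights satisfy
  the same convolution identity over \<open>Pow \<alpha> \<times> Pow \<beta>\<close>. By induction
  all terms but the top one agree, and the top one has coefficient
  \<open>m {} * m {} = 1\<close>.\<close>

lemma deconv_mult:
  assumes "finite \<alpha>" "finite \<beta>" "\<alpha> \<inter> \<beta> = {}" "m {} = 1"
    and m: "\<And>\<gamma> \<delta>. \<gamma> \<subseteq> \<alpha> \<Longrightarrow> \<delta> \<subseteq> \<beta> \<Longrightarrow> m (\<gamma> \<union> \<delta>) = m \<gamma> * m \<delta>"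
    and m': "\<And>\<gamma> \<delta>. \<gamma> \<subseteq> \<alpha> \<Longrightarrow> \<delta> \<subseteq> \<beta> \<Longrightarrow> m' (\<gamma> \<union> \<delta>) = m' \<gamma> * m' \<delta>"
  shows "deconv m' m (\<alpha> \<union> \<beta>) = deconv m' m \<alpha> * deconv m' m \<beta>"
  using assms
proof (induction "card \<alpha> + card \<beta>" arbitrary: \<alpha> \<beta> rule: less_induct)
  case less
  note fin = less.prems(1,2)
  let ?w = "deconv m' m" and ?I = "Pow \<alpha> \<times> Pow \<beta>"
  have diff: "(\<alpha> \<union> \<beta>) - (\<gamma> \<union> \<delta>) = (\<alpha> - \<gamma>) \<union> (\<beta> - \<delta>)" if "\<gamma> \<subseteq> \<alpha>" "\<delta> \<subseteq> \<beta>" for \<gamma> \<delta>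
    using that less.prems(3) by auto
  have mm: "m (\<alpha> \<union> \<beta> - (\<gamma> \<union> \<delta>)) = m (\<alpha> - \<gamma>) * m (\<beta> - \<delta>)" if "\<gamma> \<subseteq> \<alpha>" "\<delta> \<subseteq> \<beta>" for \<gamma> \<delta>
    using that by (subst diff[OF that], intro less.prems(5)) auto
  have "m' (\<alpha> \<union> \<beta>) = (\<Sum>\<gamma>\<in>Pow (\<alpha> \<union> \<beta>). ?w \<gamma> * m (\<alpha> \<union> \<beta> - \<gamma>))"
    using fin less.prems by (intro sum_deconv[symmetric]) auto
  also have "\<dots> = (\<Sum>\<gamma>\<in>Pow \<alpha>. \<Sum>\<delta>\<in>Pow \<beta>. ?w (\<gamma> \<union> \<delta>) * m (\<alpha> \<union> \<beta> - (\<gamma> \<union> \<delta>)))"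
    by (rule sum_Pow_Un_disjoint[OF less.prems(3)])
  also have "\<dots> = (\<Sum>z\<in>?I. ?w (fst z \<union> snd z) * (m (\<alpha> - fst z) * m (\<beta> - snd z)))"
    by (subst sum.cartesian_product) (auto intro!: sum.cong simp: mm)
  finally have 1: "m' (\<alpha> \<union> \<beta>) = \<dots>" .
  have "m' (\<alpha> \<union> \<beta>) = m' \<alpha> * m' \<beta>"
    by (rule less.prems) auto
  also have "m' \<alpha> = (\<Sum>\<gamma>\<in>Pow \<alpha>. ?w \<gamma> * m (\<alpha> - \<gamma>))"
    using fin less.prems by (intro sum_deconv[symmetric]) auto
  also have "m' \<beta> = (\<Sum>\<gamma>\<in>Pow \<beta>. ?w \<gamma> * m (\<beta> - \<gamma>))"
    using fin less.prems by (intro sum_deconv[symmetric]) auto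
  also have "(\<Sum>\<gamma>\<in>Pow \<alpha>. ?w \<gamma> * m (\<alpha> - \<gamma>)) * (\<Sum>\<gamma>\<in>Pow \<beta>. ?w \<gamma> * m (\<beta> - \<gamma>)) =
      (\<Sum>z\<in>?I. ?w (fst z) * ?w (snd z) * (m (\<alpha> - fst z) * m (\<beta> - snd z)))"
    unfolding sum_product sum.cartesian_product by (auto intro!: sum.cong simp: mult_ac)
  finally have 2: "m' (\<alpha> \<union> \<beta>) = \<dots>" .
  have finI: "finite ?I" and mem: "(\<alpha>, \<beta>) \<in> ?I"
    using fin by auto
  have IH: "?w (fst z \<union> snd z) = ?w (fst z) * ?w (snd z)" if z: "z \<in> ?I - {(\<alpha>, \<beta>)}" for z
  proof (rule less.hyps)
    have "fst z \<subseteq> \<alpha>" "snd z \<subseteq> \<beta>" "fst z \<noteq> \<alpha> \<or> snd z \<noteq> \<beta>"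
      using z by (auto simp: prod_eq_iff)
    then show "card (fst z) + card (snd z) < card \<alpha> + card \<beta>"
      using fin by (metis add_le_less_mono add_less_le_mono card_mono psubsetI psubset_card_mono)
    have sub: "fst z \<subseteq> \<alpha>" "snd z \<subseteq> \<beta>"
      using z by auto
    then show "finite (fst z)" "finite (snd z)"
      using fin by (auto dest: finite_subset)
    show "fst z \<inter> snd z = {}"
      using sub less.prems(3) by blast
    show "m {} = 1" by fact
    show "m (\<gamma> \<union> \<delta>) = m \<gamma> * m \<delta>" "m' (\<gamma> \<union> \<delta>) = m' \<gamma> * m' \<delta>"
      if "\<gamma> \<subseteq> fst z" "\<delta> \<subseteq> snd z" for \<gamma> \<delta>
      using less.prems(5,6)[of \<gamma> \<delta>] that sub by auto
  qed
  have "(\<Sum>z\<in>?I - {(\<alpha>, \<beta>)}. ?w (fst z \<union> snd z) * (m (\<alpha> - fst z) * m (\<beta> - snd z))) =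
      (\<Sum>z\<in>?I - {(\<alpha>, \<beta>)}. ?w (fst z) * ?w (snd z) * (m (\<alpha> - fst z) * m (\<beta> - snd z)))"
    by (rule sum.cong) (simp_all add: IH)
  with 1 2 show ?case
    using sum.remove[OF finI mem, of "\<lambda>z. ?w (fst z \<union> snd z) * (m (\<alpha> - fst z) * m (\<beta> - snd z))"]
      sum.remove[OF finI mem, of "\<lambda>z. ?w (fst z) * ?w (snd z) * (m (\<alpha> - fst z) * m (\<beta> - snd z))"]
      less.prems(4) by simp
qed

text \<open>
  An edge set with more vertices than edges splits off a tree component, and the deconvolution
  vanishes on trees because there both functions agree.
\<close>

lemma deconv_eq_0:
  assumes "m {} = 1" "m' {} = 1"
    and m: "\<And>\<gamma> \<delta>. \<gamma> \<subseteq> \<alpha>\<^sub>0 \<Longrightarrow> \<delta> \<subseteq> \<alpha>\<^sub>0 \<Longrightarrow> verts \<gamma> \<inter> verts \<delta> = {} \<Longrightarrow> m (\<gamma> \<union> \<delta>) = m \<gamma> * m \<delta>"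
    and m': "\<And>\<gamma> \<delta>. \<gamma> \<subseteq> \<alpha>\<^sub>0 \<Longrightarrow> \<delta> \<subseteq> \<alpha>\<^sub>0 \<Longrightarrow> verts \<gamma> \<inter> verts \<delta> = {} \<Longrightarrow>
      m' (\<gamma> \<union> \<delta>) = m' \<gamma> * m' \<delta>"
    and tree: "\<And>\<gamma>. \<gamma> \<subseteq> \<alpha>\<^sub>0 \<Longrightarrow> \<gamma> \<noteq> {} \<Longrightarrow> conn \<gamma> \<Longrightarrow> card (verts \<gamma>) = card \<gamma> + 1 \<Longrightarrow> m' \<gamma> = m \<gamma>"
    and \<alpha>: "finite \<alpha>" "\<alpha> \<subseteq> \<alpha>\<^sub>0" "card \<alpha> < card (verts \<alpha>)"
  shows "deconv m' m \<alpha> = 0"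
  using \<alpha>
proof (induction "card \<alpha>" arbitrary: \<alpha> rule: less_induct)
  case less
  note fin = less.prems(1)
  have ne: "\<alpha> \<noteq> {}"
    using less.prems by auto
  show ?case
  proof (cases "conn \<alpha>")
    case True
    \<comment> \<open>A connected set with more vertices than edges has excess exactly 1, and each
      of its nonempty subsets has excess at least 1. By induction only \<beta> = {} survives in the
      recursion, which then reads m' \<alpha> - m \<alpha>.\<close>
    have eq: "card (verts \<alpha>) = card \<alpha> + 1"
      using conn_verts_le[OF True fin] less.prems by simp
    have zero: "deconv m' m \<beta> = 0" if \<beta>: "\<beta> \<in> Pow \<alpha> - {\<alpha>} - {{}}" for \<beta>
    proof (rule less.hyps)
      show "card \<beta> < card \<alpha>"
        using \<beta> fin by (auto intro: psubset_card_mono)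
      show "finite \<beta>" "\<beta> \<subseteq> \<alpha>\<^sub>0"
        using \<beta> fin less.prems by (auto dest: finite_subset)
      show "card \<beta> < card (verts \<beta>)"
        using conn_excess_mono[OF True fin, of \<beta>] \<beta> eq by auto
    qed
    have "(\<Sum>\<beta>\<in>Pow \<alpha> - {\<alpha>}. deconv m' m \<beta> * m (\<alpha> - \<beta>)) =
        m \<alpha> + (\<Sum>\<beta>\<in>Pow \<alpha> - {\<alpha>} - {{}}. deconv m' m \<beta> * m (\<alpha> - \<beta>))"
      using fin ne assms(2) by (subst sum.remove[of _ "{}"]) auto
    also have "\<dots> = m \<alpha>"
      using zero by simp
    finally show ?thesis
      using fin tree[OF less.prems(2) ne True eq] by (simp add: deconv.simps[of m' m \<alpha>])
  next
    case False
    then obtain \<beta> \<gamma> where s: "\<alpha> = \<beta> \<union> \<gamma>" "\<beta> \<noteq> {}" "\<gamma> \<noteq> {}" "verts \<beta> \<inter> verts \<gamma> = {}"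
      by (rule not_conn_split)
    have disj: "\<beta> \<inter> \<gamma> = {}"
      using s(4) by (auto simp: verts_def)
    have fins: "finite \<beta>" "finite \<gamma>"
      using fin s(1) by auto
    have "card \<alpha> = card \<beta> + card \<gamma>" "card (verts \<alpha>) = card (verts \<beta>) + card (verts \<gamma>)"
      using s fins disj by (simp_all add: card_Un_disjoint verts_Un)
    moreover have "0 < card \<beta>" "0 < card \<gamma>"
      using s fins by (simp_all add: card_gt_0_iff)
    \<comment> \<open>The excess is additive over vertex-disjoint parts, so one part has positive
      excess; both parts are smaller than \<alpha> because both are nonempty.\<close>
    ultimately have "(card \<beta> < card \<alpha> \<and> card \<beta> < card (verts \<beta>)) \<or>
        (card \<gamma> < card \<alpha> \<and> card \<gamma> < card (verts \<gamma>))"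
      using less.prems(3) by linarith
    then have "deconv m' m \<beta> = 0 \<or> deconv m' m \<gamma> = 0"
      using less.hyps[of \<beta>] less.hyps[of \<gamma>] fins s(1) less.prems(2) by auto
    moreover have "deconv m' m (\<beta> \<union> \<gamma>) = deconv m' m \<beta> * deconv m' m \<gamma>"
    proof (rule deconv_mult)
      fix \<gamma>' \<delta>' assume "\<gamma>' \<subseteq> \<beta>" "\<delta>' \<subseteq> \<gamma>"
      then have "\<gamma>' \<subseteq> \<alpha>\<^sub>0" "\<delta>' \<subseteq> \<alpha>\<^sub>0" "verts \<gamma>' \<inter> verts \<delta>' = {}"
        using s less.prems(2) verts_mono[of \<gamma>' \<beta>] verts_mono[of \<delta>' \<gamma>] by auto
      then show "m (\<gamma>' \<union> \<delta>') = m \<gamma>' * m \<delta>'" "m' (\<gamma>' \<union> \<delta>') = m' \<gamma>' * m' \<delta>'"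
        by (auto intro: m m')
    qed (use fins disj assms in auto)
    ultimately show ?thesis
      using s(1) by auto
  qed
qed

section \<open>Counting edge sets with at most as many vertices as edges\<close>

lemma binomial_le_power: "n choose r \<le> n ^ r"
  by (cases "r \<le> n") (auto simp: binomial_le_pow binomial_eq_0)

text \<open>Choose the vertex set first, in at most \<open>card A ^ u\<close> ways, then
  \<open>e\<close> of its \<open>u\<^sup>2\<close> ordered pairs.\<close>

lemma card_edge_sets_le:
  assumes "finite A" 
  shows "card {\<beta>. \<beta> \<subseteq> A \<times> A \<and> card \<beta> = e \<and> card (verts \<beta>) = u} \<le> card A ^ u * (u\<^sup>2) ^ e"
proof -
  let ?U = "{U. U \<subseteq> A \<and> card U = u}"
  let ?G = "\<lambda>U. {\<beta>. \<beta> \<subseteq> U \<times> U \<and> card \<beta> = e}"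
  have finU: "finite ?U"
    using assms by simp
  have sub: "{\<beta>. \<beta> \<subseteq> A \<times> A \<and> card \<beta> = e \<and> card (verts \<beta>) = u} \<subseteq> (\<Union>U\<in>?U. ?G U)"
  proof
    fix \<beta> assume "\<beta> \<in> {\<beta>. \<beta> \<subseteq> A \<times> A \<and> card \<beta> = e \<and> card (verts \<beta>) = u}"
    then have "verts \<beta> \<in> ?U" "\<beta> \<in> ?G (verts \<beta>)"
      using subset_verts_Times[of \<beta>] by (auto simp: verts_def)
    then show "\<beta> \<in> (\<Union>U\<in>?U. ?G U)" by blast
  qed
  have fin: "finite (?G U)" if "U \<in> ?U" for U
    using that assms by (auto intro!: finite_subset[of _ "Pow (A \<times> A)"])
  have "card {\<beta>. \<beta> \<subseteq> A \<times> A \<and> card \<beta> = e \<and> card (verts \<beta>) = u} \<le> card (\<Union>U\<in>?U. ?G U)"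
    using finU fin sub by (intro card_mono) auto
  also have "\<dots> \<le> (\<Sum>U\<in>?U. card (?G U))"
    by (rule card_UN_le[OF finU])
  also have "\<dots> \<le> (\<Sum>U\<in>?U. (u\<^sup>2) ^ e)"
  proof (rule sum_mono)
    fix U assume U: "U \<in> ?U"
    then have "finite U"
      using assms by (auto dest: finite_subset)
    then have "card (?G U) = (u * u) choose e"
      using U by (subst n_subsets) auto
    then show "card (?G U) \<le> (u\<^sup>2) ^ e"
      by (simp add: binomial_le_power power2_eq_square)
  qed
  also have "\<dots> = (card A choose u) * (u\<^sup>2) ^ e"
    using assms by (simp add: n_subsets)
  also have "\<dots> \<le> card A ^ u * (u\<^sup>2) ^ e"
    by (intro mult_right_mono binomial_le_power) auto
  finally show ?thesis .
qed

text \<open>The sets are grouped by their numbers e of edges and u of vertices. The constraint u <=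
  e together with \<open>1 \<le> K\<close> turns (|A| a^2)^u into K^e, so each edge pays for at most
  one vertex; the rest is a geometric series of ratio at most 1/2.\<close>

lemma sum_edge_sets_le:
  fixes y a K :: real and D :: nat
  assumes "finite A" and y: "0 \<le> y" and a: "0 \<le> a"
    and K: "real (card A) * a\<^sup>2 \<le> K" "1 \<le> K"
    and \<rho>: "y * K * real D ^ 3 \<le> 1 / 2"
  shows "(\<Sum>\<beta> | \<beta> \<subseteq> A \<times> A \<and> 1 \<le> card \<beta> \<and> card \<beta> \<le> D \<and> card (verts \<beta>) \<le> card \<beta>.
      y ^ card \<beta> * a ^ (2 * card (verts \<beta>))) \<le> 2 * (y * K * real D ^ 3)"
proof -
  define \<rho> where "\<rho> = y * K * real D ^ 3"
  have \<rho>0: "0 \<le> \<rho>" "\<rho> \<le> 1 / 2"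
    using y K \<rho> by (auto simp: \<rho>_def)
  let ?S = "{\<beta>. \<beta> \<subseteq> A \<times> A \<and> 1 \<le> card \<beta> \<and> card \<beta> \<le> D \<and> card (verts \<beta>) \<le> card \<beta>}"
  let ?I = "Sigma {1..D} (\<lambda>e. {1..e})"
  let ?G = "\<lambda>(e, u). {\<beta>. \<beta> \<subseteq> A \<times> A \<and> card \<beta> = e \<and> card (verts \<beta>) = u}"
  let ?t = "\<lambda>\<beta>. y ^ card \<beta> * a ^ (2 * card (verts \<beta>))"
  have finG: "finite (?G z)" for z
    using assms(1) by (auto intro!: finite_subset[of _ "Pow (A \<times> A)"] split: prod.split)
  have "1 \<le> card (verts \<beta>)" if "\<beta> \<in> ?S" for \<beta>
  proof -
    have "finite \<beta>" "\<beta> \<noteq> {}"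
      using that by (auto intro!: card_ge_0_finite)
    then show ?thesis
      by (simp add: Suc_le_eq card_gt_0_iff)
  qed
  then have "?S \<subseteq> (\<Union>z\<in>?I. ?G z)"
    by force
  then have "(\<Sum>\<beta>\<in>?S. ?t \<beta>) \<le> (\<Sum>\<beta>\<in>(\<Union>z\<in>?I. ?G z). ?t \<beta>)"
    using finG y a by (intro sum_mono2) auto
  also have "\<dots> = (\<Sum>z\<in>?I. \<Sum>\<beta>\<in>?G z. ?t \<beta>)"
    using finG by (intro sum.UNION_disjoint) auto
  also have "\<dots> \<le> (\<Sum>(e, u)\<in>?I. (y * K * real D ^ 2) ^ e)"
  proof (intro sum_mono)
    fix z assume z: "z \<in> ?I"
    obtain e u where eu: "z = (e, u)" by (cases z)
    have u: "1 \<le> u" "u \<le> e" "e \<le> D"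
      using z eu by auto
    have "(\<Sum>\<beta>\<in>?G z. ?t \<beta>) = real (card (?G z)) * (y ^ e * a ^ (2 * u))"
      by (simp add: eu)
    also have "\<dots> \<le> real (card A ^ u * (u\<^sup>2) ^ e) * (y ^ e * a ^ (2 * u))"
      using card_edge_sets_le[OF assms(1), of e u] y a
      by (intro mult_right_mono) (auto simp: eu simp del: of_nat_mult of_nat_power)
    also have "\<dots> = (real (card A) * a\<^sup>2) ^ u * (real u ^ 2) ^ e * y ^ e"
      by (subst power_mult) (simp only: of_nat_mult of_nat_power power_mult_distrib mult_ac)
    also have "\<dots> \<le> K ^ e * (real D ^ 2) ^ e * y ^ e"
    proof (intro mult_mono power_mono)
      have "(real (card A) * a\<^sup>2) ^ u \<le> K ^ u"
        using K by (intro power_mono) auto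
      also have "\<dots> \<le> K ^ e"
        using K u by (intro power_increasing) auto
      finally show "(real (card A) * a\<^sup>2) ^ u \<le> K ^ e" .
    qed (use K u y in auto)
    also have "\<dots> = (y * K * real D ^ 2) ^ e"
      by (simp add: power_mult_distrib mult_ac)
    finally show "(\<Sum>\<beta>\<in>?G z. ?t \<beta>) \<le> (case z of (e, u) \<Rightarrow> (y * K * real D ^ 2) ^ e)"
      by (simp add: eu)
  qed
  also have "\<dots> = (\<Sum>e\<in>{1..D}. real e * (y * K * real D ^ 2) ^ e)"
    by (subst sum.Sigma[symmetric]) auto
  \<comment> \<open>The number e of admissible values of u is absorbed by e <= D <= D^e, at the
    price of a third factor D per edge.\<close>
  also have "\<dots> \<le> (\<Sum>e\<in>{1..D}. \<rho> ^ e)"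
  proof (rule sum_mono)
    fix e assume e: "e \<in> {1..D}"
    have "real e \<le> real D"
      using e by simp
    also have "\<dots> \<le> real D ^ e"
      by (rule self_le_power) (use e in auto)
    finally have "real e * (y * K * real D ^ 2) ^ e \<le> real D ^ e * (y * K * real D ^ 2) ^ e"
      using y K by (intro mult_right_mono) auto
    also have "\<dots> = (real D * (y * K * real D ^ 2)) ^ e"
      by (simp only: power_mult_distrib)
    also have "real D * (y * K * real D ^ 2) = \<rho>"
      by (simp add: \<rho>_def power3_eq_cube power2_eq_square)
    finally show "real e * (y * K * real D ^ 2) ^ e \<le> \<rho> ^ e" .
  qed
  also have "\<dots> \<le> 2 * \<rho>"
  proof -
    have eq: "(\<Sum>e\<in>{1..D}. \<rho> ^ e) = \<rho> * (\<Sum>e<D. \<rho> ^ e)"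
      by (simp add: sum.atLeast1_atMost_eq sum_distrib_left)
    have "(\<Sum>e<D. \<rho> ^ e) \<le> (\<Sum>e. \<rho> ^ e)"
      using \<rho>0 by (intro sum_le_suminf summable_geometric) auto
    also have "\<dots> = 1 / (1 - \<rho>)"
      using \<rho>0 by (intro suminf_geometric) auto
    also have "\<dots> \<le> 2"
      using \<rho>0 by (simp add: field_simps)
    finally have "\<rho> * (\<Sum>e<D. \<rho> ^ e) \<le> \<rho> * 2"
      by (rule mult_left_mono) (rule \<rho>0)
    with eq show ?thesis by linarith
  qed
  finally show ?thesis by (simp add: \<rho>_def)
qed

section \<open>Signal moments of the binary model\<close>

lemma finite_edges [simp]: "finite (edges n)"
  by (rule finite_subset[of _ "{1..n} \<times> {1..n}"]) (auto simp: edges_def)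

lemma verts_edges_subset: "\<alpha> \<subseteq> edges n \<Longrightarrow> verts \<alpha> \<subseteq> {1..n}"
  by (force simp: verts_def edges_def)

locale binary_community =
  fixes n :: nat and k q s :: real and M :: nat and x :: "nat \<Rightarrow> real"
  assumes ok: "binary_model_ok n k q s M x"
begin

lemma params: "0 < k" "k \<le> real n" "0 \<le> q" "0 \<le> s" "1 \<le> M" "(\<Sum>l=1..M. x l) = 1"
  and x_pos: "l \<in> {1..M} \<Longrightarrow> 0 < x l"
  and prob_le_1: "l \<in> {1..M} \<Longrightarrow> q + s / x l \<le> 1"
  using ok by (auto simp: binary_model_ok_def)

lemma n_pos: "0 < n"
  using params by (cases n) auto

definition labels :: "(nat \<Rightarrow> nat option) pmf" where
  "labels = Pi_pmf {1..n} None (\<lambda>_. label_pmf n k M x)"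

definition graph :: "(nat \<Rightarrow> nat option) \<Rightarrow> (nat \<times> nat \<Rightarrow> bool) pmf" where
  "graph \<sigma> =
     Pi_pmf (edges n) False (\<lambda>(i, j). bernoulli_pmf (edge_prob q s x (\<sigma> i) (\<sigma> j)))"

definition signal :: "(nat \<Rightarrow> nat option) \<Rightarrow> nat \<times> nat \<Rightarrow> real" where
  "signal \<sigma> e = edge_prob q s x (\<sigma> (fst e)) (\<sigma> (snd e)) - q"

definition moment :: "(nat \<times> nat) set \<Rightarrow> real" where
  "moment \<alpha> = measure_pmf.expectation labels (\<lambda>\<sigma>. \<Prod>e\<in>\<alpha>. signal \<sigma> e)"

lemma set_label_pmf: "set_pmf (label_pmf n k M x) \<subseteq> insert None (Some ` {1..M})"
proof
  fix c assume "c \<in> set_pmf (label_pmf n k M x)"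
  then have "label_prob n k M x c \<noteq> 0"
    by (simp add: set_pmf_iff pmf_label_pmf[OF ok])
  then show "c \<in> insert None (Some ` {1..M})"
    by (cases c) (auto simp: label_prob_def split: if_splits)
qed

lemma finite_label_pmf [simp]: "finite (set_pmf (label_pmf n k M x))"
  by (rule finite_subset[OF set_label_pmf]) auto

lemma finite_labels [simp]: "finite (set_pmf labels)"
  unfolding labels_def by (intro finite_set_Pi_pmf) auto

lemma finite_graph [simp]: "finite (set_pmf (graph \<sigma>))"
  unfolding graph_def by (intro finite_set_Pi_pmf) auto

lemma label_range:
  assumes "\<sigma> \<in> set_pmf labels" "\<sigma> i = Some l"
  shows "l \<in> {1..M}"
proof -
  have "\<sigma> i \<in> insert None (set_pmf (label_pmf n k M x))"
    using assms(1) by (auto simp: labels_def set_Pi_pmf PiE_dflt_def)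
  then show ?thesis
    using set_label_pmf assms(2) by auto
qed

lemma signal_eq:
  "signal \<sigma> e = (case \<sigma> (fst e) of None \<Rightarrow> 0
     | Some l \<Rightarrow> if \<sigma> (snd e) = Some l then s / x l else 0)"
  by (auto simp: signal_def edge_prob_def split: option.splits)

lemma signal_nonneg: "\<sigma> \<in> set_pmf labels \<Longrightarrow> 0 \<le> signal \<sigma> e"
  using params x_pos label_range
  by (auto simp: signal_eq less_imp_le split: option.split intro!: divide_nonneg_pos)

lemma signal_le:
  assumes "\<sigma> \<in> set_pmf labels" "\<And>l. l \<in> {1..M} \<Longrightarrow> s / x l \<le> b" "0 \<le> b"
  shows "signal \<sigma> e \<le> b"
  using assms label_range by (auto simp: signal_eq split: option.splits)

lemma q_le_1: "q \<le> 1"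
proof -
  have "1 \<in> {1..M}" using params by simp
  then have "q + s / x 1 \<le> 1" "0 \<le> s / x 1"
    using prob_le_1 x_pos params by (auto intro!: divide_nonneg_pos)
  then show ?thesis by simp
qed

lemma signal_le': "\<sigma> \<in> set_pmf labels \<Longrightarrow> q + signal \<sigma> e \<le> 1"
  using signal_le[of \<sigma> "1 - q" e] prob_le_1 q_le_1 by (simp add: algebra_simps)

lemma binary_model_eq:
  "binary_model n k q s M x = bind_pmf labels (\<lambda>\<sigma>. map_pmf adj_matrix (graph \<sigma>))"
  by (simp add: binary_model_def labels_def graph_def)

lemma expectation_binary_model:
  fixes f :: "(nat \<times> nat \<Rightarrow> real) \<Rightarrow> real"
  shows "measure_pmf.expectation (binary_model n k q s M x) f =
    measure_pmf.expectation labels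
      (\<lambda>\<sigma>. measure_pmf.expectation (graph \<sigma>) (\<lambda>W. f (adj_matrix W)))"
  by (simp add: binary_model_eq expectation_bind_pmf_finite)

lemma finite_binary_model [simp]: "finite (set_pmf (binary_model n k q s M x))"
  by (simp add: binary_model_eq)

text \<open>Given the labels, the edges are independent Bernoulli variables with parameter
  \<open>q + signal \<sigma> e\<close>. The factors are padded with 1 outside \<open>A\<close>
  because the product law ranges over all of \<open>edges n\<close>.\<close>

lemma expectation_graph_prod:
  fixes h :: "nat \<times> nat \<Rightarrow> bool \<Rightarrow> real"
  assumes "\<sigma> \<in> set_pmf labels" "A \<subseteq> edges n"
  shows "measure_pmf.expectation (graph \<sigma>) (\<lambda>W. \<Prod>e\<in>A. h e (W e)) =
    (\<Prod>e\<in>A. (q + signal \<sigma> e) * h e True + (1 - (q + signal \<sigma> e)) * h e False)"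
proof -
  let ?h = "\<lambda>e b. if e \<in> A then h e b else 1"
  have restr: "(\<Prod>e\<in>A. g e) = (\<Prod>e\<in>edges n. if e \<in> A then g e else 1)" for g :: "_ \<Rightarrow> real"
    using assms(2) by (intro prod.mono_neutral_cong_left) auto
  have "measure_pmf.expectation (graph \<sigma>) (\<lambda>W. \<Prod>e\<in>A. h e (W e)) =
      measure_pmf.expectation (graph \<sigma>) (\<lambda>W. \<Prod>e\<in>edges n. ?h e (W e))"
    by (simp add: restr)
  also have "\<dots> = (\<Prod>e\<in>edges n. measure_pmf.expectation
      (case e of (i, j) \<Rightarrow> bernoulli_pmf (edge_prob q s x (\<sigma> i) (\<sigma> j))) (?h e))"
    unfolding graph_def by (intro expectation_Pi_pmf_prod_finite) auto
  also have "\<dots> = (\<Prod>e\<in>edges n. if e \<in> A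
      then (q + signal \<sigma> e) * h e True + (1 - (q + signal \<sigma> e)) * h e False else 1)"
  proof (rule prod.cong[OF refl])
    fix e :: "nat \<times> nat"
    have p: "edge_prob q s x (\<sigma> (fst e)) (\<sigma> (snd e)) = q + signal \<sigma> e"
      by (simp add: signal_def)
    have "0 \<le> q + signal \<sigma> e" "q + signal \<sigma> e \<le> 1"
      using signal_nonneg[OF assms(1)] signal_le'[OF assms(1)] params by (auto intro: add_nonneg_nonneg)
    then show "measure_pmf.expectation
        (case e of (i, j) \<Rightarrow> bernoulli_pmf (edge_prob q s x (\<sigma> i) (\<sigma> j))) (?h e) =
      (if e \<in> A then (q + signal \<sigma> e) * h e True + (1 - (q + signal \<sigma> e)) * h e False else 1)"
      by (cases "e \<in> A") (simp_all add: p case_prod_unfold)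
  qed
  also have "\<dots> = (\<Prod>e\<in>A. (q + signal \<sigma> e) * h e True + (1 - (q + signal \<sigma> e)) * h e False)"
    by (simp add: restr)
  finally show ?thesis .
qed

section \<open>Label expectations and moments of edge sets\<close>

lemma expectation_labels_prod:
  fixes g :: "nat option \<Rightarrow> real"
  assumes "U \<subseteq> {1..n}"
  shows "measure_pmf.expectation labels (\<lambda>\<sigma>. \<Prod>v\<in>U. g (\<sigma> v)) =
    measure_pmf.expectation (label_pmf n k M x) g ^ card U"
proof -
  have "(\<Prod>v\<in>U. g (\<sigma> v)) = (\<Prod>v\<in>{1..n}. if v \<in> U then g (\<sigma> v) else 1)" for \<sigma>
    using assms by (intro prod.mono_neutral_cong_left) auto
  then have "measure_pmf.expectation labels (\<lambda>\<sigma>. \<Prod>v\<in>U. g (\<sigma> v)) =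
      measure_pmf.expectation labels (\<lambda>\<sigma>. \<Prod>v\<in>{1..n}. if v \<in> U then g (\<sigma> v) else 1)"
    by (simp only:)
  also have "\<dots> = (\<Prod>v\<in>{1..n}. measure_pmf.expectation (label_pmf n k M x)
      (\<lambda>c. if v \<in> U then g c else 1))"
    unfolding labels_def by (intro expectation_Pi_pmf_prod_finite) auto
  also have "\<dots> = (\<Prod>v\<in>U. measure_pmf.expectation (label_pmf n k M x) g)"
    using assms by (intro prod.mono_neutral_cong_right) auto
  finally show ?thesis by simp
qed

lemma expectation_label_pmf_eq:
  assumes "l \<in> {1..M}"
  shows "measure_pmf.expectation (label_pmf n k M x) (\<lambda>c. of_bool (c = Some l)) = x l * (k / n)"
proof -
  have "measure_pmf.expectation (label_pmf n k M x) (\<lambda>c. of_bool (c = Some l)) =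
      (\<Sum>c\<in>insert None (Some ` {1..M}). of_bool (c = Some l) * pmf (label_pmf n k M x) c)"
    using set_label_pmf by (intro integral_measure_pmf_real) auto
  also have "\<dots> = (\<Sum>c\<in>{Some l}. of_bool (c = Some l) * pmf (label_pmf n k M x) c)"
    using assms by (intro sum.mono_neutral_right) auto
  also have "\<dots> = x l * (k / n)"
    using assms by (simp add: pmf_label_pmf[OF ok] label_prob_def)
  finally show ?thesis .
qed

lemma expectation_label_pmf_Some:
  "measure_pmf.expectation (label_pmf n k M x) (\<lambda>c. of_bool (c \<noteq> None)) = k / n"
proof -
  have "measure_pmf.expectation (label_pmf n k M x) (\<lambda>c. of_bool (c \<noteq> None)) =
      (\<Sum>c\<in>Some ` {1..M}. of_bool (c \<noteq> None) * pmf (label_pmf n k M x) c)"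
    using set_label_pmf by (intro integral_measure_pmf_real) auto
  also have "\<dots> = (\<Sum>l=1..M. x l * (k / n))"
    by (subst sum.reindex) (auto intro!: sum.cong simp: pmf_label_pmf[OF ok] label_prob_def)
  also have "\<dots> = k / n"
    by (simp only: sum_distrib_right[symmetric] params mult_1)
  finally show ?thesis .
qed

text \<open>A nonzero product means that the two ends of every edge share a community. The class of
  one label is then a cut that no edge crosses, so connectivity spreads this label to all vertices.
  At most one summand on the right is nonzero.\<close>

lemma prod_signal_conn:
  assumes "conn \<alpha>" "\<alpha> \<noteq> {}" "finite \<alpha>" "\<sigma> \<in> set_pmf labels"
  shows "(\<Prod>e\<in>\<alpha>. signal \<sigma> e) =
    (\<Sum>l=1..M. (s / x l) ^ card \<alpha> * (\<Prod>v\<in>verts \<alpha>. of_bool (\<sigma> v = Some l)))"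
proof -
  have ind: "(\<Prod>v\<in>verts \<alpha>. of_bool (\<sigma> v = Some l)) = (of_bool (\<forall>v\<in>verts \<alpha>. \<sigma> v = Some l) :: real)" for l
    using assms(3) by (auto simp: prod_zero_iff)
  have ends: "fst e \<in> verts \<alpha>" "snd e \<in> verts \<alpha>" if "e \<in> \<alpha>" for e
    using that by (auto simp: verts_def)
  obtain e\<^sub>0 where e0: "e\<^sub>0 \<in> \<alpha>"
    using assms(2) by blast
  show ?thesis
  proof (cases "\<exists>l\<^sub>0\<in>{1..M}. \<forall>v\<in>verts \<alpha>. \<sigma> v = Some l\<^sub>0")
    case True
    then obtain l\<^sub>0 where l0: "l\<^sub>0 \<in> {1..M}" "\<And>v. v \<in> verts \<alpha> \<Longrightarrow> \<sigma> v = Some l\<^sub>0"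
      by blast
    have "(\<Prod>e\<in>\<alpha>. signal \<sigma> e) = (s / x l\<^sub>0) ^ card \<alpha>"
      using ends l0(2) by (simp add: signal_eq)
    also have "\<dots> = (\<Sum>l=1..M. if l = l\<^sub>0 then (s / x l\<^sub>0) ^ card \<alpha> else 0)"
      using l0(1) by simp
    also have "\<dots> = (\<Sum>l=1..M. (s / x l) ^ card \<alpha> * (\<Prod>v\<in>verts \<alpha>. of_bool (\<sigma> v = Some l)))"
      unfolding ind using l0(2) ends(1)[OF e0] by (intro sum.cong) auto
    finally show ?thesis .
  next
    case False
    have "\<exists>e\<in>\<alpha>. signal \<sigma> e = 0"
    proof (rule ccontr)
      assume neg: "\<not> ?thesis"
      have nz: "\<exists>l. \<sigma> (fst e) = Some l \<and> \<sigma> (snd e) = Some l" if "e \<in> \<alpha>" for e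
      proof -
        have "signal \<sigma> e \<noteq> 0" using neg that by blast
        then show ?thesis by (auto simp: signal_eq split: option.splits if_splits)
      qed
      obtain l where l: "\<sigma> (fst e\<^sub>0) = Some l"
        using nz[OF e0] by blast
      have "\<forall>(i, j)\<in>\<alpha>. i \<in> {v. \<sigma> v = Some l} \<longleftrightarrow> j \<in> {v. \<sigma> v = Some l}"
        using nz by fastforce
      then have "verts \<alpha> \<subseteq> {v. \<sigma> v = Some l} \<or> verts \<alpha> \<inter> {v. \<sigma> v = Some l} = {}"
        using assms(1) unfolding conn_def by blast
      then have "\<forall>v\<in>verts \<alpha>. \<sigma> v = Some l"
        using l ends(1)[OF e0] by blast
      then show False
        using False label_range[OF assms(4) l] by blast
    qed
    then have "(\<Prod>e\<in>\<alpha>. signal \<sigma> e) = 0"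
      using assms(3) by (simp add: prod_zero_iff)
    also have "\<dots> = (\<Sum>l=1..M. (s / x l) ^ card \<alpha> * (\<Prod>v\<in>verts \<alpha>. of_bool (\<sigma> v = Some l)))"
      unfolding ind using False by (intro sum.neutral[symmetric]) auto
    finally show ?thesis .
  qed
qed

text \<open>Each vertex contributes x_l k/n and each edge s/x_l. The quotient of powers stands for
  x_l to the integer exponent |V| - |\<alpha>|, which is negative once the set carries more than one
  independent cycle.\<close>

lemma moment_conn:
  assumes "conn \<alpha>" "\<alpha> \<noteq> {}" "\<alpha> \<subseteq> edges n"
  shows "moment \<alpha> =
    (k / n) ^ card (verts \<alpha>) * s ^ card \<alpha> * (\<Sum>l=1..M. x l ^ card (verts \<alpha>) / x l ^ card \<alpha>)"
proof -
  have fin: "finite \<alpha>"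
    using assms(3) by (rule finite_subset) simp
  have "moment \<alpha> = measure_pmf.expectation labels
      (\<lambda>\<sigma>. \<Sum>l=1..M. (s / x l) ^ card \<alpha> * (\<Prod>v\<in>verts \<alpha>. of_bool (\<sigma> v = Some l)))"
    unfolding moment_def using assms fin by (intro expectation_cong_pmf prod_signal_conn)
  also have "\<dots> = (\<Sum>l=1..M. (s / x l) ^ card \<alpha> *
      measure_pmf.expectation labels (\<lambda>\<sigma>. \<Prod>v\<in>verts \<alpha>. of_bool (\<sigma> v = Some l)))"
    by (subst expectation_sum_finite) auto
  also have "\<dots> = (\<Sum>l=1..M. (s / x l) ^ card \<alpha> * (x l * (k / n)) ^ card (verts \<alpha>))"
    using verts_edges_subset[OF assms(3)]
    by (intro sum.cong refl) (simp add: expectation_labels_prod[where g = "\<lambda>c. of_bool (c = Some _)"]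
        expectation_label_pmf_eq)
  also have "\<dots> = (k / n) ^ card (verts \<alpha>) * s ^ card \<alpha> *
      (\<Sum>l=1..M. x l ^ card (verts \<alpha>) / x l ^ card \<alpha>)"
    unfolding sum_distrib_left by (intro sum.cong refl) (simp add: power_mult_distrib power_divide mult_ac)
  finally show ?thesis .
qed

lemma moment_tree:
  assumes "conn \<alpha>" "\<alpha> \<noteq> {}" "\<alpha> \<subseteq> edges n" "card (verts \<alpha>) = card \<alpha> + 1"
  shows "moment \<alpha> = (k / n) ^ (card \<alpha> + 1) * s ^ card \<alpha>"
proof -
  have "(\<Sum>l=1..M. x l ^ card (verts \<alpha>) / x l ^ card \<alpha>) = (\<Sum>l=1..M. x l)"
    using x_pos by (intro sum.cong refl) (fastforce simp: assms(4))
  then show ?thesis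
    using params by (simp add: moment_conn[OF assms(1-3)] assms(4))
qed

lemma moment_unicyclic:
  assumes "conn \<alpha>" "\<alpha> \<noteq> {}" "\<alpha> \<subseteq> edges n" "card (verts \<alpha>) = card \<alpha>"
  shows "moment \<alpha> = (k / n) ^ card \<alpha> * s ^ card \<alpha> * M"
proof -
  have "(\<Sum>l=1..M. x l ^ card (verts \<alpha>) / x l ^ card \<alpha>) = (\<Sum>l=1..M. 1)"
    using x_pos by (intro sum.cong refl) (fastforce simp: assms(4))
  then show ?thesis
    by (simp add: moment_conn[OF assms(1-3)] assms(4))
qed

text \<open>Two independent cycles make the exponent of the proportions equal to -1. The unions of
  two triangles that share an edge or a vertex are of this kind.\<close>

lemma moment_bicyclic_le:
  fixes r :: real
  assumes "conn \<alpha>" "\<alpha> \<noteq> {}" "\<alpha> \<subseteq> edges n" "card \<alpha> = card (verts \<alpha>) + 1"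
    and "\<And>l. l \<in> {1..M} \<Longrightarrow> 1 / x l \<le> r"
  shows "moment \<alpha> \<le> (k / n) ^ card (verts \<alpha>) * s ^ (card (verts \<alpha>) + 1) * (M * r)"
proof -
  have "(\<Sum>l=1..M. x l ^ card (verts \<alpha>) / x l ^ card \<alpha>) \<le> (\<Sum>l=1..M. r)"
  proof (rule sum_mono)
    fix l assume l: "l \<in> {1..M}"
    have "x l ^ card (verts \<alpha>) / x l ^ card \<alpha> = 1 / x l"
      using x_pos[OF l] by (simp add: assms(4))
    then show "x l ^ card (verts \<alpha>) / x l ^ card \<alpha> \<le> r"
      using assms(5)[OF l] by simp
  qed
  then have "(k / n) ^ card (verts \<alpha>) * s ^ card \<alpha> *
      (\<Sum>l=1..M. x l ^ card (verts \<alpha>) / x l ^ card \<alpha>) \<le>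
      (k / n) ^ card (verts \<alpha>) * s ^ card \<alpha> * (\<Sum>l=1..M. r)"
    using params by (intro mult_left_mono) auto
  then show ?thesis
    by (simp add: moment_conn[OF assms(1-3)] assms(4))
qed

lemma moment_nonneg: "0 \<le> moment \<alpha>"
  unfolding moment_def
  by (intro integral_nonneg_AE) (auto simp: AE_measure_pmf_iff signal_nonneg intro!: prod_nonneg)

lemma moment_empty [simp]: "moment {} = 1"
  by (simp add: moment_def)

text \<open>A cruder bound for arbitrary edge sets, in the product shape that
  \<open>abs_deconv_le\<close> asks for: every signal is at most \<open>b\<close>, and the product
  vanishes unless each touched vertex lies in some community, which happens independently with
  probability k/n.\<close>

lemma moment_le:
  assumes "\<alpha> \<subseteq> edges n" "\<And>l. l \<in> {1..M} \<Longrightarrow> s / x l \<le> b" "0 \<le> b"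
  shows "moment \<alpha> \<le> (k / n) ^ card (verts \<alpha>) * b ^ card \<alpha>"
proof -
  have fin: "finite \<alpha>"
    using assms(1) by (rule finite_subset) simp
  have "moment \<alpha> \<le> measure_pmf.expectation labels
      (\<lambda>\<sigma>. b ^ card \<alpha> * (\<Prod>v\<in>verts \<alpha>. of_bool (\<sigma> v \<noteq> None)))"
    unfolding moment_def
  proof (rule expectation_mono_finite)
    fix \<sigma> assume \<sigma>: "\<sigma> \<in> set_pmf labels"
    show "(\<Prod>e\<in>\<alpha>. signal \<sigma> e) \<le> b ^ card \<alpha> * (\<Prod>v\<in>verts \<alpha>. of_bool (\<sigma> v \<noteq> None))"
    proof (cases "\<forall>v\<in>verts \<alpha>. \<sigma> v \<noteq> None")
      case True
      have "(\<Prod>e\<in>\<alpha>. signal \<sigma> e) \<le> (\<Prod>e\<in>\<alpha>. b)"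
        using signal_nonneg[OF \<sigma>] signal_le[OF \<sigma> assms(2,3)] by (intro prod_mono) auto
      then show ?thesis using True by simp
    next
      case False
      then obtain e where e: "e \<in> \<alpha>" "\<sigma> (fst e) = None \<or> \<sigma> (snd e) = None"
        by (auto simp: verts_def)
      then have "signal \<sigma> e = 0"
        by (auto simp: signal_eq split: option.splits)
      then have "(\<Prod>e\<in>\<alpha>. signal \<sigma> e) = 0"
        using e fin by (auto simp: prod_zero_iff)
      then show ?thesis
        using assms(3) by (simp add: prod_nonneg)
    qed
  qed simp
  also have "\<dots> = b ^ card \<alpha> * (k / n) ^ card (verts \<alpha>)"
    using expectation_labels_prod[OF verts_edges_subset[OF assms(1)], of "\<lambda>c. of_bool (c \<noteq> None)"]
    by (simp only: expectation_label_pmf_Some integral_mult_right_zero)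
  finally show ?thesis by (simp add: mult_ac)
qed

text \<open>Each product of signals reads only the labels of its own vertices, and the labels are
  independent.\<close>

lemma moment_Un:
  assumes "\<alpha> \<subseteq> edges n" "\<beta> \<subseteq> edges n" "verts \<alpha> \<inter> verts \<beta> = {}"
  shows "moment (\<alpha> \<union> \<beta>) = moment \<alpha> * moment \<beta>"
proof -
  have fin: "finite \<alpha>" "finite \<beta>"
    by (rule finite_subset[OF assms(1)], simp, rule finite_subset[OF assms(2)], simp)
  have disj: "\<alpha> \<inter> \<beta> = {}"
    using assms(3) by (auto simp: verts_def)
  have loc: "(\<Prod>e\<in>\<gamma>. signal \<sigma> e) = (\<Prod>e\<in>\<gamma>. signal \<sigma>' e)"
    if "\<And>v. v \<in> verts \<gamma> \<Longrightarrow> \<sigma> v = \<sigma>' v" for \<gamma> \<sigma> \<sigma>'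
    using that by (intro prod.cong) (auto simp: signal_def verts_def)
  have "moment (\<alpha> \<union> \<beta>) =
      measure_pmf.expectation labels (\<lambda>\<sigma>. (\<Prod>e\<in>\<alpha>. signal \<sigma> e) * (\<Prod>e\<in>\<beta>. signal \<sigma> e))"
    using fin disj by (simp add: moment_def prod.union_disjoint)
  also have "\<dots> = moment \<alpha> * moment \<beta>"
    unfolding moment_def labels_def
    by (rule expectation_Pi_pmf_indep[where U = "verts \<alpha>" and V = "verts \<beta>"])
       (use assms verts_edges_subset in \<open>auto intro: loc\<close>)
  finally show ?thesis .
qed

end

section \<open>The low-degree bound\<close>

definition low_degree_sets :: "nat \<Rightarrow> nat \<Rightarrow> (nat \<times> nat) set set" where
  "low_degree_sets n D = {\<alpha>. \<alpha> \<subseteq> edges n \<and> card \<alpha> \<le> D}"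

lemma finite_low_degree_sets [simp]: "finite (low_degree_sets n D)"
  by (rule finite_subset[of _ "Pow (edges n)"]) (auto simp: low_degree_sets_def)

lemma low_degree_setsD:
  assumes "\<alpha> \<in> low_degree_sets n D"
  shows "finite \<alpha>" "\<alpha> \<subseteq> edges n" "card \<alpha> \<le> D"
  using assms finite_subset[OF _ finite_edges] by (auto simp: low_degree_sets_def)

lemma low_degree_sets_mono:
  assumes "\<alpha> \<in> low_degree_sets n D" "\<beta> \<subseteq> \<alpha>"
  shows "\<beta> \<in> low_degree_sets n D"
proof -
  have "card \<beta> \<le> card \<alpha>"
    using assms low_degree_setsD(1) by (intro card_mono) auto
  then show ?thesis
    using assms by (auto simp: low_degree_sets_def)
qed

lemma Pow_eq_low_degree_sets:
  assumes "\<alpha> \<in> low_degree_sets n D"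
  shows "Pow \<alpha> = {\<beta>\<in>low_degree_sets n D. \<beta> \<subseteq> \<alpha>}"
  using low_degree_sets_mono[OF assms] by auto

lemma sum_Pow_eq_low_degree_sets:
  fixes f :: "(nat \<times> nat) set \<Rightarrow> real"
  assumes "\<alpha> \<in> low_degree_sets n D"
  shows "(\<Sum>\<beta>\<in>Pow \<alpha>. f \<beta>) = (\<Sum>\<beta>\<in>low_degree_sets n D. if \<beta> \<subseteq> \<alpha> then f \<beta> else 0)"
  unfolding Pow_eq_low_degree_sets[OF assms] by (rule sum.inter_filter) simp

text \<open>Centring at \<open>q\<close>, not at the mean of an edge, makes the expectation of a
  monomial given the labels equal to the product of its signals.\<close>

definition centred_poly ::
    "nat \<Rightarrow> nat \<Rightarrow> real \<Rightarrow> ((nat \<times> nat) set \<Rightarrow> real) \<Rightarrow> (nat \<times> nat \<Rightarrow> bool) \<Rightarrow> real" where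
  "centred_poly n D q c W = (\<Sum>\<alpha>\<in>low_degree_sets n D. c \<alpha> * (\<Prod>e\<in>\<alpha>. of_bool (W e) - q))"

text \<open>On symmetric 0/1 matrices with zero diagonal a monomial either vanishes or is the
  indicator that all edges of some set \<open>A\<close> are present: exponents collapse and mirrored
  entries coincide. Writing each entry as (entry - q) + q and expanding produces only subsets of
  \<open>A\<close>, so the degree does not grow.\<close>

lemma adj_matrix_monomial:
  assumes e: "e \<in> exponents ({1..n} \<times> {1..n}) D"
  shows "\<exists>c. \<forall>W. (\<Prod>v\<in>{1..n} \<times> {1..n}. adj_matrix W v ^ e v) = centred_poly n D q c W"
proof -
  let ?V = "{1..n} \<times> {1..n}"
  define U where "U = {v\<in>?V. 0 < e v}"
  define \<psi> :: "nat \<times> nat \<Rightarrow> nat \<times> nat" where "\<psi> = (\<lambda>(i, j). (min i j, max i j))"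
  have finU: "finite U"
    by (simp add: U_def)
  show ?thesis
  proof (cases "\<exists>v\<in>U. fst v = snd v")
    case True
    then obtain v where v: "v \<in> ?V" "0 < e v" "fst v = snd v"
      by (auto simp: U_def)
    have "adj_matrix W v ^ e v = 0" for W
      using v by (cases v) (simp add: adj_matrix_def)
    then have "(\<Prod>v\<in>?V. adj_matrix W v ^ e v) = 0" for W
      using v(1) by (intro prod_zero) auto
    then have "\<forall>W. (\<Prod>v\<in>?V. adj_matrix W v ^ e v) = centred_poly n D q (\<lambda>_. 0) W"
      by (simp add: centred_poly_def)
    then show ?thesis by blast
  next
    case False
    define A where "A = \<psi> ` U"
    \<comment> \<open>Every entry that occurs has exponent at least 1, and mirroring can only merge
      entries, so \<open>A\<close> has at most \<open>D\<close> edges.\<close>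
    have "card U = (\<Sum>v\<in>U. 1)"
      by simp
    also have "\<dots> \<le> (\<Sum>v\<in>U. e v)"
      by (intro sum_mono) (simp add: U_def Suc_le_eq)
    also have "\<dots> \<le> (\<Sum>v\<in>?V. e v)"
      by (intro sum_mono2) (auto simp: U_def)
    also have "\<dots> \<le> D"
      using e by (simp add: exponents_def)
    finally have "card A \<le> D"
      unfolding A_def using card_image_le[OF finU, of \<psi>] by simp
    moreover have "A \<subseteq> edges n"
    proof
      fix a assume "a \<in> A"
      then obtain v where v: "v \<in> U" "a = \<psi> v"
        by (auto simp: A_def)
      then have "fst v \<noteq> snd v" "fst v \<in> {1..n}" "snd v \<in> {1..n}"
        using False by (auto simp: U_def)
      then show "a \<in> edges n"
        unfolding v by (cases v) (auto simp: \<psi>_def edges_def)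
    qed
    ultimately have A: "A \<in> low_degree_sets n D"
      by (simp add: low_degree_sets_def)
    then have finA: "finite A"
      by (rule low_degree_setsD)
    have entry: "adj_matrix W v = of_bool (W (\<psi> v))" if "v \<in> U" for W v
      using that False by (cases v) (auto simp: adj_matrix_def \<psi>_def min_def max_def)
    have "(\<Prod>v\<in>?V. adj_matrix W v ^ e v) =
        centred_poly n D q (\<lambda>\<alpha>. if \<alpha> \<subseteq> A then q ^ card (A - \<alpha>) else 0) W" for W
    proof -
      have "(\<Prod>v\<in>?V. adj_matrix W v ^ e v) = (\<Prod>v\<in>U. adj_matrix W v ^ e v)"
        by (intro prod.mono_neutral_right) (auto simp: U_def)
      also have "\<dots> = (\<Prod>v\<in>U. of_bool (W (\<psi> v)))"
        using entry by (intro prod.cong refl) (auto simp: U_def)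
      also have "\<dots> = of_bool (\<forall>v\<in>U. W (\<psi> v))"
        using finU by (auto simp: prod_zero_iff)
      also have "\<dots> = of_bool (\<forall>a\<in>A. W a)"
        by (simp add: A_def)
      also have "\<dots> = (\<Prod>a\<in>A. of_bool (W a))"
        using finA by (auto simp: prod_zero_iff)
      also have "\<dots> = (\<Prod>a\<in>A. (of_bool (W a) - q) + q)"
        by simp
      also have "\<dots> = (\<Sum>\<alpha>\<in>Pow A. (\<Prod>a\<in>\<alpha>. of_bool (W a) - q) * (\<Prod>a\<in>A - \<alpha>. q))"
        by (rule prod_add[OF finA])
      also have "\<dots> = (\<Sum>\<alpha>\<in>low_degree_sets n D.
          if \<alpha> \<subseteq> A then (\<Prod>a\<in>\<alpha>. of_bool (W a) - q) * (\<Prod>a\<in>A - \<alpha>. q) else 0)"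
        by (rule sum_Pow_eq_low_degree_sets[OF A])
      also have "\<dots> = centred_poly n D q (\<lambda>\<alpha>. if \<alpha> \<subseteq> A then q ^ card (A - \<alpha>) else 0) W"
        unfolding centred_poly_def by (intro sum.cong refl) simp
      finally show ?thesis .
    qed
    then show ?thesis by blast
  qed
qed

lemma polynomial_eq_centred_poly:
  assumes "polynomial_of_degree_le ({1..n} \<times> {1..n}) D f"
  obtains c where "\<And>W. f (adj_matrix W) = centred_poly n D q c W"
proof -
  let ?V = "{1..n} \<times> {1..n}"
  obtain a where a: "\<And>Y. f Y = (\<Sum>e\<in>exponents ?V D. a e * (\<Prod>v\<in>?V. Y v ^ e v))"
    using assms by (auto simp: polynomial_of_degree_le_def)
  have "\<forall>e\<in>exponents ?V D. \<exists>c. \<forall>W. (\<Prod>v\<in>?V. adj_matrix W v ^ e v) = centred_poly n D q c W"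
    using adj_matrix_monomial by blast
  then obtain c where c: "\<And>e W. e \<in> exponents ?V D \<Longrightarrow>
      (\<Prod>v\<in>?V. adj_matrix W v ^ e v) = centred_poly n D q (c e) W"
    by metis
  have "f (adj_matrix W) = centred_poly n D q (\<lambda>\<alpha>. \<Sum>e\<in>exponents ?V D. a e * c e \<alpha>) W" for W
  proof -
    have "f (adj_matrix W) = (\<Sum>e\<in>exponents ?V D. a e * centred_poly n D q (c e) W)"
      unfolding a by (intro sum.cong refl) (simp only: c)
    also have "\<dots> = (\<Sum>e\<in>exponents ?V D. \<Sum>\<alpha>\<in>low_degree_sets n D.
        a e * c e \<alpha> * (\<Prod>e\<in>\<alpha>. of_bool (W e) - q))"
      by (simp add: centred_poly_def sum_distrib_left mult.assoc)
    also have "\<dots> = centred_poly n D q (\<lambda>\<alpha>. \<Sum>e\<in>exponents ?V D. a e * c e \<alpha>) W"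
      unfolding centred_poly_def by (subst sum.swap) (simp add: sum_distrib_right)
    finally show ?thesis .
  qed
  then show thesis by (rule that)
qed

lemma centred_poly_shift:
  "centred_poly n D q c W - t = centred_poly n D q (c({} := c {} - t)) W"
proof -
  have mem: "{} \<in> low_degree_sets n D"
    by (simp add: low_degree_sets_def)
  show ?thesis
    unfolding centred_poly_def
    by (subst (1 2) sum.remove[OF _ mem]) (auto intro!: sum.cong)
qed

section \<open>Orthogonal expansion conditionally on the labels\<close>

context binary_community
begin

text \<open>Splitting each \<open>W e - q\<close> into noise plus signal, this is the label average
  of the coefficient of the noise product over \<beta>. At \<beta> = {} it is the mean of the
  polynomial.\<close>

definition shifted_moment :: "nat \<Rightarrow> ((nat \<times> nat) set \<Rightarrow> real) \<Rightarrow> (nat \<times> nat) set \<Rightarrow> real" where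
  "shifted_moment D c \<beta> =
     (\<Sum>\<alpha>\<in>low_degree_sets n D. if \<beta> \<subseteq> \<alpha> then c \<alpha> * moment (\<alpha> - \<beta>) else 0)"

text \<open>An edge in just one of the two sets contributes a centred factor, which kills the
  expectation; a common edge contributes its Bernoulli variance.\<close>

lemma expectation_graph_noise_mult:
  assumes "\<sigma> \<in> set_pmf labels" "\<beta> \<subseteq> edges n" "\<gamma> \<subseteq> edges n"
  defines "z \<equiv> \<lambda>e b. of_bool b - (q + signal \<sigma> e)"
  shows "measure_pmf.expectation (graph \<sigma>) (\<lambda>W. (\<Prod>e\<in>\<beta>. z e (W e)) * (\<Prod>e\<in>\<gamma>. z e (W e))) =
    (if \<beta> = \<gamma> then \<Prod>e\<in>\<beta>. (q + signal \<sigma> e) * (1 - (q + signal \<sigma> e)) else 0)"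
proof -
  have fin: "finite (\<beta> \<union> \<gamma>)"
    by (rule finite_subset[of _ "edges n"]) (use assms in auto)
  define h where "h e b = (if e \<in> \<beta> then z e b else 1) * (if e \<in> \<gamma> then z e b else 1)" for e b
  have "(\<Prod>e\<in>\<beta>. z e (W e)) * (\<Prod>e\<in>\<gamma>. z e (W e)) = (\<Prod>e\<in>\<beta> \<union> \<gamma>. h e (W e))" for W
  proof -
    have "(\<Prod>e\<in>\<beta>. z e (W e)) = (\<Prod>e\<in>\<beta> \<union> \<gamma>. if e \<in> \<beta> then z e (W e) else 1)"
      using fin by (intro prod.mono_neutral_cong_left) auto
    moreover have "(\<Prod>e\<in>\<gamma>. z e (W e)) = (\<Prod>e\<in>\<beta> \<union> \<gamma>. if e \<in> \<gamma> then z e (W e) else 1)"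
      using fin by (intro prod.mono_neutral_cong_left) auto
    ultimately show ?thesis
      by (simp add: h_def prod.distrib)
  qed
  then have eq: "measure_pmf.expectation (graph \<sigma>) (\<lambda>W. (\<Prod>e\<in>\<beta>. z e (W e)) * (\<Prod>e\<in>\<gamma>. z e (W e))) =
      (\<Prod>e\<in>\<beta> \<union> \<gamma>. (q + signal \<sigma> e) * h e True + (1 - (q + signal \<sigma> e)) * h e False)"
    using assms by (simp add: expectation_graph_prod)
  show ?thesis
  proof (cases "\<beta> = \<gamma>")
    case True
    then show ?thesis
      unfolding eq by (auto intro!: prod.cong simp: h_def z_def algebra_simps)
  next
    case False
    then obtain e where "e \<in> \<beta> \<union> \<gamma>" "e \<notin> \<beta> \<inter> \<gamma>" by blast
    then have "(q + signal \<sigma> e) * h e True + (1 - (q + signal \<sigma> e)) * h e False = 0"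
      by (auto simp: h_def z_def algebra_simps)
    then show ?thesis
      unfolding eq using fin False \<open>e \<in> \<beta> \<union> \<gamma>\<close> by (auto intro!: prod_zero)
  qed
qed

text \<open>
  Conditionally on the labels, \<open>W e - q\<close> is the signal plus centred independent noise. Expanding in
  the noise gives an orthogonal decomposition, and Jensen's inequality then removes the labels.
\<close>

lemma second_moment_centred_poly_ge:
  assumes v: "0 \<le> v"
    "\<And>\<sigma> e. \<sigma> \<in> set_pmf labels \<Longrightarrow> v \<le> (q + signal \<sigma> e) * (1 - (q + signal \<sigma> e))"
  shows "(\<Sum>\<beta>\<in>low_degree_sets n D. v ^ card \<beta> * (shifted_moment D c \<beta>)\<^sup>2) \<le>
    measure_pmf.expectation labels
      (\<lambda>\<sigma>. measure_pmf.expectation (graph \<sigma>) (\<lambda>W. (centred_poly n D q c W)\<^sup>2))"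
proof -
  let ?S = "low_degree_sets n D"
  \<comment> \<open>For fixed labels this is the coefficient of the noise product over \<beta>; its
    average over the labels is \<open>shifted_moment D c \<beta>\<close>.\<close>
  define g where
    "g \<beta> \<sigma> = (\<Sum>\<alpha>\<in>?S. if \<beta> \<subseteq> \<alpha> then c \<alpha> * (\<Prod>e\<in>\<alpha> - \<beta>. signal \<sigma> e) else 0)" for \<beta> \<sigma>
  have cond: "(\<Sum>\<beta>\<in>?S. v ^ card \<beta> * (g \<beta> \<sigma>)\<^sup>2) \<le>
      measure_pmf.expectation (graph \<sigma>) (\<lambda>W. (centred_poly n D q c W)\<^sup>2)"
    if \<sigma>: "\<sigma> \<in> set_pmf labels" for \<sigma>
  proof -
    define z where "z e b = of_bool b - (q + signal \<sigma> e)" for e b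
    have expand: "centred_poly n D q c W = (\<Sum>\<beta>\<in>?S. g \<beta> \<sigma> * (\<Prod>e\<in>\<beta>. z e (W e)))" for W
    proof -
      have "(\<Prod>e\<in>\<alpha>. of_bool (W e) - q) =
          (\<Sum>\<beta>\<in>?S. if \<beta> \<subseteq> \<alpha> then (\<Prod>e\<in>\<beta>. z e (W e)) * (\<Prod>e\<in>\<alpha> - \<beta>. signal \<sigma> e) else 0)"
        if \<alpha>: "\<alpha> \<in> ?S" for \<alpha>
      proof -
        have "(\<Prod>e\<in>\<alpha>. of_bool (W e) - q) = (\<Prod>e\<in>\<alpha>. z e (W e) + signal \<sigma> e)"
          by (simp add: z_def)
        also have "\<dots> = (\<Sum>\<beta>\<in>Pow \<alpha>. (\<Prod>e\<in>\<beta>. z e (W e)) * (\<Prod>e\<in>\<alpha> - \<beta>. signal \<sigma> e))"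
          by (rule prod_add) (rule low_degree_setsD[OF \<alpha>])
        finally show ?thesis
          by (simp only: sum_Pow_eq_low_degree_sets[OF \<alpha>])
      qed
      then have "centred_poly n D q c W = (\<Sum>\<alpha>\<in>?S. c \<alpha> *
          (\<Sum>\<beta>\<in>?S. if \<beta> \<subseteq> \<alpha> then (\<Prod>e\<in>\<beta>. z e (W e)) * (\<Prod>e\<in>\<alpha> - \<beta>. signal \<sigma> e) else 0))"
        by (simp add: centred_poly_def)
      also have "\<dots> = (\<Sum>\<alpha>\<in>?S. \<Sum>\<beta>\<in>?S. (if \<beta> \<subseteq> \<alpha> then c \<alpha> * (\<Prod>e\<in>\<alpha> - \<beta>. signal \<sigma> e) else 0) *
          (\<Prod>e\<in>\<beta>. z e (W e)))"
        unfolding sum_distrib_left by (intro sum.cong refl) auto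
      also have "\<dots> = (\<Sum>\<beta>\<in>?S. g \<beta> \<sigma> * (\<Prod>e\<in>\<beta>. z e (W e)))"
        by (subst sum.swap) (simp add: g_def sum_distrib_right)
      finally show ?thesis .
    qed
    have "measure_pmf.expectation (graph \<sigma>) (\<lambda>W. (centred_poly n D q c W)\<^sup>2) =
        measure_pmf.expectation (graph \<sigma>) (\<lambda>W. \<Sum>\<beta>\<in>?S. \<Sum>\<gamma>\<in>?S.
          (g \<beta> \<sigma> * g \<gamma> \<sigma>) * ((\<Prod>e\<in>\<beta>. z e (W e)) * (\<Prod>e\<in>\<gamma>. z e (W e))))"
      by (simp add: expand power2_eq_square sum_product mult_ac)
    also have "\<dots> = (\<Sum>\<beta>\<in>?S. \<Sum>\<gamma>\<in>?S. (g \<beta> \<sigma> * g \<gamma> \<sigma>) *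
        measure_pmf.expectation (graph \<sigma>) (\<lambda>W. (\<Prod>e\<in>\<beta>. z e (W e)) * (\<Prod>e\<in>\<gamma>. z e (W e))))"
      by (simp add: expectation_sum_finite)
    also have "\<dots> = (\<Sum>\<beta>\<in>?S. \<Sum>\<gamma>\<in>?S. if \<beta> = \<gamma> then
        (g \<beta> \<sigma>)\<^sup>2 * (\<Prod>e\<in>\<beta>. (q + signal \<sigma> e) * (1 - (q + signal \<sigma> e))) else 0)"
    proof (intro sum.cong refl)
      fix \<beta> \<gamma> assume "\<beta> \<in> ?S" "\<gamma> \<in> ?S"
      then have "measure_pmf.expectation (graph \<sigma>) (\<lambda>W. (\<Prod>e\<in>\<beta>. z e (W e)) * (\<Prod>e\<in>\<gamma>. z e (W e))) =
          (if \<beta> = \<gamma> then \<Prod>e\<in>\<beta>. (q + signal \<sigma> e) * (1 - (q + signal \<sigma> e)) else 0)"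
        unfolding z_def using \<sigma> low_degree_setsD by (intro expectation_graph_noise_mult) auto
      then show "(g \<beta> \<sigma> * g \<gamma> \<sigma>) *
        measure_pmf.expectation (graph \<sigma>) (\<lambda>W. (\<Prod>e\<in>\<beta>. z e (W e)) * (\<Prod>e\<in>\<gamma>. z e (W e))) =
        (if \<beta> = \<gamma> then
        (g \<beta> \<sigma>)\<^sup>2 * (\<Prod>e\<in>\<beta>. (q + signal \<sigma> e) * (1 - (q + signal \<sigma> e))) else 0)"
        by (simp add: power2_eq_square)
    qed
    also have "\<dots> = (\<Sum>\<beta>\<in>?S. (g \<beta> \<sigma>)\<^sup>2 * (\<Prod>e\<in>\<beta>. (q + signal \<sigma> e) * (1 - (q + signal \<sigma> e))))"
      by simp
    also have "\<dots> \<ge> (\<Sum>\<beta>\<in>?S. (g \<beta> \<sigma>)\<^sup>2 * (\<Prod>e\<in>\<beta>. v))"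
      using v \<sigma> by (intro sum_mono mult_left_mono prod_mono) auto
    finally show ?thesis
      by (simp add: mult_ac)
  qed
  have "(\<Sum>\<beta>\<in>?S. v ^ card \<beta> * (shifted_moment D c \<beta>)\<^sup>2) =
      (\<Sum>\<beta>\<in>?S. v ^ card \<beta> * (measure_pmf.expectation labels (g \<beta>))\<^sup>2)"
  proof (intro sum.cong refl)
    fix \<beta>
    have "shifted_moment D c \<beta> = (\<Sum>\<alpha>\<in>?S. measure_pmf.expectation labels
        (\<lambda>\<sigma>. if \<beta> \<subseteq> \<alpha> then c \<alpha> * (\<Prod>e\<in>\<alpha> - \<beta>. signal \<sigma> e) else 0))"
      unfolding shifted_moment_def moment_def by (intro sum.cong refl) simp
    also have "\<dots> = measure_pmf.expectation labels (g \<beta>)"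
      unfolding g_def by (rule expectation_sum_finite[symmetric]) simp
    finally show "v ^ card \<beta> * (shifted_moment D c \<beta>)\<^sup>2 =
        v ^ card \<beta> * (measure_pmf.expectation labels (g \<beta>))\<^sup>2"
      by simp
  qed
  also have "\<dots> \<le> (\<Sum>\<beta>\<in>?S. v ^ card \<beta> * measure_pmf.expectation labels (\<lambda>\<sigma>. (g \<beta> \<sigma>)\<^sup>2))"
    using v(1) by (intro sum_mono mult_left_mono expectation_square_ge) auto
  also have "\<dots> = measure_pmf.expectation labels (\<lambda>\<sigma>. \<Sum>\<beta>\<in>?S. v ^ card \<beta> * (g \<beta> \<sigma>)\<^sup>2)"
    by (simp add: expectation_sum_finite)
  also have "\<dots> \<le> measure_pmf.expectation labels
      (\<lambda>\<sigma>. measure_pmf.expectation (graph \<sigma>) (\<lambda>W. (centred_poly n D q c W)\<^sup>2))"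
    using cond by (intro expectation_mono_finite) auto
  finally show ?thesis .
qed

lemma expectation_graph_monomial:
  assumes "\<sigma> \<in> set_pmf labels" "\<alpha> \<subseteq> edges n"
  shows "measure_pmf.expectation (graph \<sigma>) (\<lambda>W. \<Prod>e\<in>\<alpha>. of_bool (W e) - q) =
    (\<Prod>e\<in>\<alpha>. signal \<sigma> e)"
proof -
  have "(q + signal \<sigma> e) * (of_bool True - q) + (1 - (q + signal \<sigma> e)) * (of_bool False - q) =
      signal \<sigma> e" for e
    by (simp add: algebra_simps)
  then show ?thesis
    by (simp only: expectation_graph_prod[OF assms, of "\<lambda>e b. of_bool b - q"])
qed

lemma expectation_centred_poly:
  "measure_pmf.expectation labels
     (\<lambda>\<sigma>. measure_pmf.expectation (graph \<sigma>) (centred_poly n D q c)) =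
   (\<Sum>\<alpha>\<in>low_degree_sets n D. c \<alpha> * moment \<alpha>)"
proof -
  have "measure_pmf.expectation labels
      (\<lambda>\<sigma>. measure_pmf.expectation (graph \<sigma>) (centred_poly n D q c)) =
      measure_pmf.expectation labels
        (\<lambda>\<sigma>. \<Sum>\<alpha>\<in>low_degree_sets n D. c \<alpha> * (\<Prod>e\<in>\<alpha>. signal \<sigma> e))"
    by (intro expectation_cong_pmf)
       (auto simp: centred_poly_def[abs_def] expectation_sum_finite expectation_graph_monomial
         low_degree_setsD intro!: sum.cong)
  then show ?thesis
    by (simp add: expectation_sum_finite moment_def)
qed

end

section \<open>Comparison of two models through the weights\<close>

locale two_binary_communities =
  P: binary_community n k q s M x + Q: binary_community n k q s M' x'
  for n :: nat and k q s :: real and M :: nat and x :: "nat \<Rightarrow> real" and M' :: nat and x' :: "nat \<Rightarrow> real"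
begin

abbreviation weight :: "(nat \<times> nat) set \<Rightarrow> real" where
  "weight \<equiv> deconv Q.moment P.moment"

text \<open>This expresses the mean under the second model in the very quantities whose squares
  bound the second moment under the first: insert the convolution identity for
  \<open>Q.moment\<close> and swap the sums.\<close>

lemma expectation_Q_centred_poly:
  "(\<Sum>\<alpha>\<in>low_degree_sets n D. c \<alpha> * Q.moment \<alpha>) =
   (\<Sum>\<beta>\<in>low_degree_sets n D. weight \<beta> * P.shifted_moment D c \<beta>)"
proof -
  let ?S = "low_degree_sets n D"
  have "(\<Sum>\<alpha>\<in>?S. c \<alpha> * Q.moment \<alpha>) = (\<Sum>\<alpha>\<in>?S. c \<alpha> *
      (\<Sum>\<beta>\<in>?S. if \<beta> \<subseteq> \<alpha> then weight \<beta> * P.moment (\<alpha> - \<beta>) else 0))"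
    by (intro sum.cong refl)
       (simp add: sum_Pow_eq_low_degree_sets[symmetric] sum_deconv low_degree_setsD(1))
  also have "\<dots> = (\<Sum>\<alpha>\<in>?S. \<Sum>\<beta>\<in>?S.
      weight \<beta> * (if \<beta> \<subseteq> \<alpha> then c \<alpha> * P.moment (\<alpha> - \<beta>) else 0))"
    unfolding sum_distrib_left by (intro sum.cong refl) auto
  also have "\<dots> = (\<Sum>\<beta>\<in>?S. weight \<beta> * P.shifted_moment D c \<beta>)"
    by (subst sum.swap) (simp add: P.shifted_moment_def sum_distrib_left)
  finally show ?thesis .
qed

text \<open>Tree moments depend only on n, k and s, which both models share.\<close>

lemma weight_eq_0:
  assumes "\<beta> \<subseteq> edges n" "card \<beta> < card (verts \<beta>)"
  shows "weight \<beta> = 0"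
proof (rule deconv_eq_0[where \<alpha>\<^sub>0 = "edges n"])
  fix \<gamma> assume \<gamma>: "\<gamma> \<subseteq> edges n" "\<gamma> \<noteq> {}" "conn \<gamma>" "card (verts \<gamma>) = card \<gamma> + 1"
  then show "Q.moment \<gamma> = P.moment \<gamma>"
    by (simp add: P.moment_tree Q.moment_tree)
next
  show "finite \<beta>"
    using assms(1) by (rule finite_subset) simp
qed (use assms P.moment_Un Q.moment_Un in auto)

text \<open>In \<rho>, the 16 and two powers of D come from the squared weights, (4D)^2 per edge;
  the other three powers come from \<open>sum_edge_sets_le\<close>. The factor 1/v per edge
  compensates for the factor v per edge in the second-moment bound, and \<open>b\<close> bounds the
  signals of both models.\<close>

lemma low_degree_gap_le:
  fixes b v :: real
  assumes f: "polynomial_of_degree_le ({1..n} \<times> {1..n}) D f"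
    and v: "0 < v"
      "\<And>\<sigma> e. \<sigma> \<in> set_pmf P.labels \<Longrightarrow> v \<le> (q + P.signal \<sigma> e) * (1 - (q + P.signal \<sigma> e))"
    and b: "0 \<le> b" "\<And>l. l \<in> {1..M} \<Longrightarrow> s / x l \<le> b" "\<And>l. l \<in> {1..M'} \<Longrightarrow> s / x' l \<le> b"
    and \<rho>: "\<rho> = 16 * real D ^ 5 * b\<^sup>2 / v * max (k\<^sup>2 / n) 1" "\<rho> \<le> 1 / 2"
  defines "PP \<equiv> binary_model n k q s M x" and "QQ \<equiv> binary_model n k q s M' x'"
  shows "(measure_pmf.expectation PP f - measure_pmf.expectation QQ f)\<^sup>2 \<le>
    2 * \<rho> * measure_pmf.variance PP f"
proof -
  let ?S = "low_degree_sets n D" and ?a = "k / n"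
  define S' where "S' = ?S - {{}}"
  define \<mu> where "\<mu> = measure_pmf.expectation PP f"
  obtain c\<^sub>0 where c0: "\<And>W. f (adj_matrix W) = centred_poly n D q c\<^sub>0 W"
    using polynomial_eq_centred_poly[OF f] by blast
  define c where "c = c\<^sub>0({} := c\<^sub>0 {} - \<mu>)"
  have c: "f (adj_matrix W) - \<mu> = centred_poly n D q c W" for W
    unfolding c0 c_def by (rule centred_poly_shift)
  have mem: "{} \<in> ?S"
    by (simp add: low_degree_sets_def)
  define G where "G = P.shifted_moment D c"
  have finPP: "finite (set_pmf PP)" "finite (set_pmf QQ)"
    by (simp_all add: PP_def QQ_def)
  \<comment> \<open>The empty set has weight 1, which is not small. Centring \<open>f\<close> at its
    mean under \<open>PP\<close> makes \<open>G {}\<close> zero and so removes this term.\<close>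
  have EP: "measure_pmf.expectation PP (\<lambda>Y. f Y - \<mu>) = G {}"
    unfolding PP_def P.expectation_binary_model c P.expectation_centred_poly
    by (simp add: G_def P.shifted_moment_def)
  have EP0: "measure_pmf.expectation PP (\<lambda>Y. f Y - \<mu>) = 0"
    using finPP by (simp add: \<mu>_def integrable_measure_pmf_finite)
  have "measure_pmf.expectation QQ f - \<mu> = measure_pmf.expectation QQ (\<lambda>Y. f Y - \<mu>)"
    using finPP by (simp add: integrable_measure_pmf_finite)
  also have "\<dots> = (\<Sum>\<beta>\<in>?S. weight \<beta> * G \<beta>)"
    unfolding QQ_def Q.expectation_binary_model c Q.expectation_centred_poly
    by (simp add: G_def expectation_Q_centred_poly)
  also have "\<dots> = weight {} * G {} + (\<Sum>\<beta>\<in>S'. weight \<beta> * G \<beta>)"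
    unfolding S'_def by (rule sum.remove) (simp_all add: mem)
  finally have gap: "measure_pmf.expectation QQ f - \<mu> = (\<Sum>\<beta>\<in>S'. weight \<beta> * G \<beta>)"
    using EP EP0 by simp
  have Var: "(\<Sum>\<beta>\<in>?S. v ^ card \<beta> * (G \<beta>)\<^sup>2) \<le> measure_pmf.variance PP f"
    using P.second_moment_centred_poly_ge[of v D c] v
    unfolding \<mu>_def[symmetric] by (simp add: PP_def P.expectation_binary_model c G_def)
  define y where "y = (4 * real D)\<^sup>2 * b\<^sup>2 / v"
  have y: "0 \<le> y"
    using v by (simp add: y_def)
  have \<rho>eq: "\<rho> = y * max (k\<^sup>2 / n) 1 * real D ^ 3"
    unfolding \<rho> y_def by (simp add: power_mult_distrib power_add[symmetric] eval_nat_numeral)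
  have n: "0 < real n" "0 \<le> ?a" "?a \<le> 1"
    using P.n_pos P.params by (auto simp: field_simps)
  let ?T = "{\<beta>. \<beta> \<subseteq> {1..n} \<times> {1..n} \<and> 1 \<le> card \<beta> \<and> card \<beta> \<le> D \<and> card (verts \<beta>) \<le> card \<beta>}"
  have finT: "finite ?T"
    by (rule finite_subset[of _ "Pow ({1..n} \<times> {1..n})"]) auto
  have w: "(weight \<beta>)\<^sup>2 / v ^ card \<beta> \<le> y ^ card \<beta> * ?a ^ (2 * card (verts \<beta>))" if "\<beta> \<in> S'" for \<beta>
  proof -
    have \<beta>: "finite \<beta>" "\<beta> \<subseteq> edges n" "card \<beta> \<le> D"
      using that low_degree_setsD[of \<beta> n D] by (auto simp: S'_def)
    have "\<bar>weight \<beta>\<bar> \<le> (4 * real D) ^ card \<beta> * (?a ^ card (verts \<beta>) * b ^ card \<beta>)"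
      using \<beta> n b P.moment_le[of _ b] Q.moment_le[of _ b] P.moment_nonneg Q.moment_nonneg
      by (intro abs_deconv_le[where \<alpha>\<^sub>0 = "edges n"]) auto
    then have "(weight \<beta>)\<^sup>2 \<le> ((4 * real D) ^ card \<beta> * (?a ^ card (verts \<beta>) * b ^ card \<beta>))\<^sup>2"
      by (rule power2_le_iff_abs_le[THEN iffD2, rotated]) (use n b in auto)
    also have "\<dots> = ((4 * real D)\<^sup>2 * b\<^sup>2) ^ card \<beta> * ?a ^ (2 * card (verts \<beta>))"
      by (subst power_mult) (simp only: power_mult_distrib power_mult[symmetric] mult_ac)
    finally have "(weight \<beta>)\<^sup>2 / v ^ card \<beta> \<le>
        ((4 * real D)\<^sup>2 * b\<^sup>2) ^ card \<beta> * ?a ^ (2 * card (verts \<beta>)) / v ^ card \<beta>"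
      by (rule divide_right_mono) (use v in simp)
    then show ?thesis
      by (simp only: y_def power_divide[of "_ * _" v] times_divide_eq_left)
  qed
  \<comment> \<open>Sets with more vertices than edges have weight 0, so the sum reduces to the
    family that \<open>sum_edge_sets_le\<close> counts.\<close>
  have "(\<Sum>\<beta>\<in>S'. (weight \<beta>)\<^sup>2 / v ^ card \<beta>) = (\<Sum>\<beta>\<in>S' \<inter> ?T. (weight \<beta>)\<^sup>2 / v ^ card \<beta>)"
  proof (rule sum.mono_neutral_right)
    show "\<forall>\<beta>\<in>S' - S' \<inter> ?T. (weight \<beta>)\<^sup>2 / v ^ card \<beta> = 0"
    proof
      fix \<beta> assume \<beta>: "\<beta> \<in> S' - S' \<inter> ?T"
      then have p: "finite \<beta>" "\<beta> \<subseteq> edges n" "card \<beta> \<le> D" "\<beta> \<noteq> {}"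
        using low_degree_setsD[of \<beta> n D] by (auto simp: S'_def)
      then have "\<beta> \<subseteq> {1..n} \<times> {1..n}" "1 \<le> card \<beta>"
        by (force simp: edges_def, simp add: Suc_le_eq card_gt_0_iff)
      then have "card \<beta> < card (verts \<beta>)"
        using \<beta> p by auto
      then show "(weight \<beta>)\<^sup>2 / v ^ card \<beta> = 0"
        using weight_eq_0[OF p(2)] by simp
    qed
  qed (auto simp: S'_def)
  also have "\<dots> \<le> (\<Sum>\<beta>\<in>S' \<inter> ?T. y ^ card \<beta> * ?a ^ (2 * card (verts \<beta>)))"
    using w by (intro sum_mono) auto
  also have "\<dots> \<le> (\<Sum>\<beta>\<in>?T. y ^ card \<beta> * ?a ^ (2 * card (verts \<beta>)))"
    using finT y n by (intro sum_mono2) auto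
  also have "\<dots> \<le> 2 * (y * max (k\<^sup>2 / n) 1 * real D ^ 3)"
    using y n \<rho>(2) unfolding \<rho>eq
    by (intro sum_edge_sets_le) (auto simp: power2_eq_square field_simps)
  finally have W: "(\<Sum>\<beta>\<in>S'. (weight \<beta>)\<^sup>2 / v ^ card \<beta>) \<le> 2 * \<rho>"
    by (simp only: \<rho>eq)
  \<comment> \<open>The square root of \<open>v ^ card \<beta>\<close> is moved across so that,
    after Cauchy-Schwarz, the second factor consists of the terms in \<open>Var\<close>.\<close>
  have "(\<Sum>\<beta>\<in>S'. weight \<beta> * G \<beta>) =
      (\<Sum>\<beta>\<in>S'. (weight \<beta> / sqrt (v ^ card \<beta>)) * (sqrt (v ^ card \<beta>) * G \<beta>))"
    using v by (intro sum.cong refl) simp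
  then have "(measure_pmf.expectation QQ f - \<mu>)\<^sup>2 \<le>
      (\<Sum>\<beta>\<in>S'. (weight \<beta> / sqrt (v ^ card \<beta>))\<^sup>2) * (\<Sum>\<beta>\<in>S'. (sqrt (v ^ card \<beta>) * G \<beta>)\<^sup>2)"
    unfolding gap by (simp only: Cauchy_Schwarz_ineq_sum)
  also have "\<dots> = (\<Sum>\<beta>\<in>S'. (weight \<beta>)\<^sup>2 / v ^ card \<beta>) * (\<Sum>\<beta>\<in>S'. v ^ card \<beta> * (G \<beta>)\<^sup>2)"
    using v by (simp add: power_divide power_mult_distrib)
  also have "\<dots> \<le> (2 * \<rho>) * measure_pmf.variance PP f"
  proof (rule mult_mono)
    have "(\<Sum>\<beta>\<in>S'. v ^ card \<beta> * (G \<beta>)\<^sup>2) \<le> (\<Sum>\<beta>\<in>?S. v ^ card \<beta> * (G \<beta>)\<^sup>2)"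
      using v by (intro sum_mono2) (auto simp: S'_def)
    with Var show "(\<Sum>\<beta>\<in>S'. v ^ card \<beta> * (G \<beta>)\<^sup>2) \<le> measure_pmf.variance PP f"
      by linarith
  qed (use W v y in \<open>auto simp: \<rho>eq intro!: sum_nonneg mult_nonneg_nonneg\<close>)
  finally show ?thesis
    unfolding \<mu>_def by (simp add: power2_commute)
qed

end

section \<open>The signed triangle count\<close>

definition edge :: "nat \<Rightarrow> nat \<Rightarrow> nat \<times> nat" where
  "edge i j = (min i j, max i j)"

definition clique :: "nat set \<Rightarrow> (nat \<times> nat) set" where
  "clique T = {(i, j). i \<in> T \<and> j \<in> T \<and> i < j}"

definition triples :: "nat \<Rightarrow> nat set set" where
  "triples n = {T. T \<subseteq> {1..n} \<and> card T = 3}"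

lemma edge_eq_iff [simp]: "edge a b = edge c d \<longleftrightarrow> a = c \<and> b = d \<or> a = d \<and> b = c"
  by (auto simp: edge_def min_def max_def)

lemma edge_in_edges: "a \<noteq> b \<Longrightarrow> a \<in> {1..n} \<Longrightarrow> b \<in> {1..n} \<Longrightarrow> edge a b \<in> edges n"
  by (auto simp: edge_def edges_def)

lemma verts_insert_edge [simp]: "verts (insert (edge a b) \<alpha>) = insert a (insert b (verts \<alpha>))"
  by (auto simp: verts_insert edge_def min_def max_def)

lemma conn_edge: "conn {edge a b}"
  by (cases "a \<le> b") (auto simp: conn_def verts_insert edge_def)

text \<open>Explicit edge lists are proved connected by repeating this rule from the last edge to
  the first. Each listed edge must therefore have its first argument among the vertices of the later
  ones, which dictates the order and orientation in the lists below.\<close>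

lemma conn_insert_edge:
  assumes "conn \<alpha>" "a \<in> verts \<alpha>"
  shows "conn (insert (edge a b) \<alpha>)"
  unfolding conn_def
proof (intro allI impI)
  fix S assume S: "\<forall>(i, j)\<in>insert (edge a b) \<alpha>. i \<in> S \<longleftrightarrow> j \<in> S"
  then have "a \<in> S \<longleftrightarrow> b \<in> S"
    by (cases "a \<le> b") (auto simp: edge_def)
  moreover have "\<forall>(i, j)\<in>\<alpha>. i \<in> S \<longleftrightarrow> j \<in> S"
    using S by simp
  then have "verts \<alpha> \<subseteq> S \<or> verts \<alpha> \<inter> S = {}"
    using assms(1)[unfolded conn_def, rule_format, of S] by simp
  ultimately show "verts (insert (edge a b) \<alpha>) \<subseteq> S \<or> verts (insert (edge a b) \<alpha>) \<inter> S = {}"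
    using assms(2) by auto
qed

lemma clique_Int: "clique (T \<inter> U) = clique T \<inter> clique U"
  by (auto simp: clique_def)

lemma clique_subset_edges: "T \<subseteq> {1..n} \<Longrightarrow> clique T \<subseteq> edges n"
  by (auto simp: clique_def edges_def)

lemma verts_clique_subset: "verts (clique T) \<subseteq> T"
  by (auto simp: verts_def clique_def)

lemma clique_2: "a \<noteq> b \<Longrightarrow> clique {a, b} = {edge a b}"
  by (auto simp: clique_def edge_def min_def max_def)

lemma clique_3:
  "a \<noteq> b \<Longrightarrow> a \<noteq> c \<Longrightarrow> b \<noteq> c \<Longrightarrow> clique {a, b, c} = {edge a b, edge a c, edge b c}"
  by (auto simp: clique_def edge_def min_def max_def)

lemma finite_triples [simp]: "finite (triples n)"
  by (rule finite_subset[of _ "Pow {1..n}"]) (auto simp: triples_def)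

lemma card_triples: "card (triples n) = n choose 3"
  using n_subsets[of "{1..n}" 3] by (simp add: triples_def)

lemma triplesD:
  assumes "T \<in> triples n"
  shows "T \<subseteq> {1..n}" "card T = 3" "finite T"
  using assms by (auto simp: triples_def intro: card_ge_0_finite)

lemma clique_triple_subset: "T \<in> triples n \<Longrightarrow> clique T \<subseteq> edges n"
  by (intro clique_subset_edges triplesD)

text \<open>Choose the union in at most n^m ways; both triples are subsets of it, which leaves at
  most 2^m * 2^m pairs.\<close>

lemma card_triple_pairs_le:
  "card {z \<in> triples n \<times> triples n. card (fst z \<union> snd z) = m} \<le> 4 ^ m * n ^ m"
proof -
  let ?U = "{U. U \<subseteq> {1..n} \<and> card U = m}"
  have fin: "finite ?U" by simp
  have finU: "finite U" if "U \<in> ?U" for U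
    using that by (auto intro: finite_subset)
  have "{z \<in> triples n \<times> triples n. card (fst z \<union> snd z) = m} \<subseteq> (\<Union>U\<in>?U. Pow U \<times> Pow U)"
  proof
    fix z assume z: "z \<in> {z \<in> triples n \<times> triples n. card (fst z \<union> snd z) = m}"
    then have "fst z \<union> snd z \<in> ?U"
      by (auto simp: triples_def)
    moreover have "z \<in> Pow (fst z \<union> snd z) \<times> Pow (fst z \<union> snd z)"
      by (cases z) auto
    ultimately show "z \<in> (\<Union>U\<in>?U. Pow U \<times> Pow U)"
      by blast
  qed
  moreover have "finite (\<Union>U\<in>?U. Pow U \<times> Pow U)"
    using finU by (intro finite_UN_I[OF fin] finite_cartesian_product) (simp_all only: finite_Pow_iff)
  ultimately have "card {z \<in> triples n \<times> triples n. card (fst z \<union> snd z) = m} \<le>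
      card (\<Union>U\<in>?U. Pow U \<times> Pow U)"
    by (rule card_mono[rotated])
  also have "\<dots> \<le> (\<Sum>U\<in>?U. card (Pow U \<times> Pow U))"
    by (rule card_UN_le[OF fin])
  also have "\<dots> = (\<Sum>U\<in>?U. 4 ^ m)"
  proof (intro sum.cong refl)
    fix U assume "U \<in> ?U"
    then have "card (Pow U \<times> Pow U) = 2 ^ m * 2 ^ m"
      using finU[of U] by (simp add: card_cartesian_product card_Pow)
    also have "\<dots> = (2 * 2) ^ m"
      by (rule power_mult_distrib[symmetric])
    finally show "card (Pow U \<times> Pow U) = 4 ^ m"
      by simp
  qed
  also have "\<dots> = (n choose m) * 4 ^ m"
    using n_subsets[of "{1..n}" m] by simp
  also have "\<dots> \<le> 4 ^ m * n ^ m"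
    using binomial_le_power[of n m] by simp
  finally show ?thesis .
qed

lemma sum_Pow_insert:
  fixes f :: "'e set \<Rightarrow> real"
  assumes "e \<notin> \<alpha>"
  shows "(\<Sum>\<gamma>\<in>Pow (insert e \<alpha>). f \<gamma>) = (\<Sum>\<gamma>\<in>Pow \<alpha>. f \<gamma>) + (\<Sum>\<gamma>\<in>Pow \<alpha>. f (insert e \<gamma>))"
proof -
  have "(\<Sum>\<gamma>\<in>Pow ({e} \<union> \<alpha>). f \<gamma>) = (\<Sum>\<gamma>\<in>Pow {e}. \<Sum>\<delta>\<in>Pow \<alpha>. f (\<gamma> \<union> \<delta>))"
    by (rule sum_Pow_Un_disjoint) (use assms in simp)
  then show ?thesis
    by (simp add: Pow_insert)
qed

section \<open>The triangle count as a polynomial of degree 3\<close>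

definition triangle_stat :: "nat \<Rightarrow> real \<Rightarrow> (nat \<times> nat \<Rightarrow> real) \<Rightarrow> real" where
  "triangle_stat n q Y = (\<Sum>T\<in>triples n. \<Prod>e\<in>clique T. Y e - q)"

lemma polynomial_of_degree_le_sum:
  assumes "\<And>i. i \<in> I \<Longrightarrow> polynomial_of_degree_le V d (f i)"
  shows "polynomial_of_degree_le V d (\<lambda>Y. \<Sum>i\<in>I. f i Y)"
proof -
  have "\<forall>i\<in>I. \<exists>c. \<forall>Y. f i Y = (\<Sum>e\<in>exponents V d. c e * (\<Prod>v\<in>V. Y v ^ e v))"
    using assms by (simp add: polynomial_of_degree_le_def)
  then obtain c where
    c: "\<And>i Y. i \<in> I \<Longrightarrow> f i Y = (\<Sum>e\<in>exponents V d. c i e * (\<Prod>v\<in>V. Y v ^ e v))"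
    by metis
  have "(\<Sum>i\<in>I. f i Y) = (\<Sum>e\<in>exponents V d. (\<Sum>i\<in>I. c i e) * (\<Prod>v\<in>V. Y v ^ e v))" for Y
  proof -
    have "(\<Sum>i\<in>I. f i Y) = (\<Sum>i\<in>I. \<Sum>e\<in>exponents V d. c i e * (\<Prod>v\<in>V. Y v ^ e v))"
      by (intro sum.cong refl c)
    also have "\<dots> = (\<Sum>e\<in>exponents V d. (\<Sum>i\<in>I. c i e) * (\<Prod>v\<in>V. Y v ^ e v))"
      by (subst sum.swap) (simp add: sum_distrib_right)
    finally show ?thesis .
  qed
  then show ?thesis
    unfolding polynomial_of_degree_le_def by (intro exI[of _ "\<lambda>e. \<Sum>i\<in>I. c i e"]) simp
qed

lemma polynomial_of_degree_le_monomial: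
  assumes "finite V" "B \<subseteq> V" "card B \<le> d"
  shows "polynomial_of_degree_le V d (\<lambda>Y. (\<Prod>v\<in>B. Y v) * a)"
proof -
  define e where "e v = (if v \<in> B then 1 else 0 :: nat)" for v
  have "(\<Sum>v\<in>V. e v) = card B"
    using assms by (simp add: e_def sum.If_cases Int_absorb1)
  then have e: "e \<in> exponents V d"
    using assms by (auto simp: exponents_def e_def)
  have mono: "(\<Prod>v\<in>V. Y v ^ e v) = (\<Prod>v\<in>B. Y v)" for Y :: "_ \<Rightarrow> real"
    using assms by (intro prod.mono_neutral_cong_right) (auto simp: e_def)
  have "(\<Prod>v\<in>B. Y v) * a =
      (\<Sum>e'\<in>exponents V d. (if e' = e then a else 0) * (\<Prod>v\<in>V. Y v ^ e' v))" for Y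
  proof -
    have "(\<Sum>e'\<in>exponents V d. (if e' = e then a else 0) * (\<Prod>v\<in>V. Y v ^ e' v)) =
        (\<Sum>e'\<in>exponents V d. if e' = e then a * (\<Prod>v\<in>V. Y v ^ e v) else 0)"
      by (intro sum.cong) auto
    also have "\<dots> = (\<Prod>v\<in>B. Y v) * a"
      using e assms(1) by (simp add: finite_exponents mono)
    finally show ?thesis by simp
  qed
  then show ?thesis
    unfolding polynomial_of_degree_le_def by (intro exI[of _ "\<lambda>e'. if e' = e then a else 0"]) simp
qed

lemma polynomial_of_degree_le_prod_diff:
  assumes "finite V" "A \<subseteq> V" "card A \<le> d"
  shows "polynomial_of_degree_le V d (\<lambda>Y. \<Prod>v\<in>A. Y v - t)"
proof -
  have fin: "finite A"
    using assms by (auto dest: finite_subset)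
  have "(\<Prod>v\<in>A. Y v - t) = (\<Sum>B\<in>Pow A. (\<Prod>v\<in>B. Y v) * (\<Prod>v\<in>A - B. - t))" for Y
    using prod_add[OF fin, of Y "\<lambda>_. - t"] by simp
  moreover have "polynomial_of_degree_le V d
      (\<lambda>Y. \<Sum>B\<in>Pow A. (\<Prod>v\<in>B. Y v) * (\<Prod>v\<in>A - B. - t))"
  proof (rule polynomial_of_degree_le_sum)
    fix B assume "B \<in> Pow A"
    then have "B \<subseteq> V" "card B \<le> d"
      using assms card_mono[OF fin, of B] by auto
    then show "polynomial_of_degree_le V d (\<lambda>Y. (\<Prod>v\<in>B. Y v) * (\<Prod>v\<in>A - B. - t))"
      using assms(1) by (intro polynomial_of_degree_le_monomial)
  qed
  ultimately show ?thesis by simp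
qed

lemma card_clique_3:
  assumes "card T = 3"
  shows "card (clique T) = 3"
proof -
  obtain a b c where "T = {a, b, c}" "a \<noteq> b" "a \<noteq> c" "b \<noteq> c"
    using assms by (auto simp: card_3_iff)
  then show ?thesis
    by (auto simp: clique_3)
qed

lemma polynomial_triangle_stat:
  "polynomial_of_degree_le ({1..n} \<times> {1..n}) 3 (triangle_stat n q)"
  unfolding triangle_stat_def[abs_def]
proof (intro polynomial_of_degree_le_sum polynomial_of_degree_le_prod_diff)
  fix T assume "T \<in> triples n"
  then show "clique T \<subseteq> {1..n} \<times> {1..n}" "card (clique T) \<le> 3"
    using card_clique_3[of T] by (auto simp: triples_def clique_def)
qed simp

lemma triangle_stat_adj_matrix:
  "triangle_stat n q (adj_matrix W) = (\<Sum>T\<in>triples n. \<Prod>e\<in>clique T. of_bool (W e) - q)"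
proof -
  have "adj_matrix W e = of_bool (W e)" if "e \<in> clique T" for e T
    using that by (cases e) (simp add: clique_def adj_matrix_def)
  then show ?thesis
    by (simp add: triangle_stat_def)
qed

section \<open>Pairs of triangles and the variance of the count\<close>

context binary_community
begin

lemma moment_triangle:
  assumes "T \<in> triples n"
  shows "moment (clique T) = (k / n) ^ 3 * s ^ 3 * M"
proof -
  obtain a b c where T: "T = {a, b, c}" "a \<noteq> b" "a \<noteq> c" "b \<noteq> c"
    using triplesD(2)[OF assms] by (auto simp: card_3_iff)
  have eq: "clique T = {edge b c, edge a b, edge a c}"
    using T by (auto simp: clique_3)
  have "conn (clique T)"
    unfolding eq by (rule conn_insert_edge, rule conn_insert_edge, rule conn_edge) auto
  moreover have "card (verts (clique T)) = 3" "clique T \<noteq> {}"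
    using T(2-4) unfolding eq by (simp_all add: card_insert_if)
  moreover have "card (clique T) = 3"
    by (rule card_clique_3) (rule triplesD[OF assms])
  ultimately show ?thesis
    using moment_unicyclic[of "clique T"] clique_triple_subset[OF assms] by simp
qed

definition pair_moment :: "(nat \<times> nat) set \<Rightarrow> (nat \<times> nat) set \<Rightarrow> real" where
  "pair_moment \<alpha> \<beta> = measure_pmf.expectation labels (\<lambda>\<sigma>. measure_pmf.expectation (graph \<sigma>)
     (\<lambda>W. (\<Prod>e\<in>\<alpha>. of_bool (W e) - q) * (\<Prod>e\<in>\<beta>. of_bool (W e) - q)))"

text \<open>Given the labels, an edge in just one set contributes its signal X. A common edge
  contributes the second moment of W - q, which is q + X - q^2 - 2qX and hence at most q + X.
  Expanding the product of these sums over the common edges yields \<gamma>, the edges where the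
  signal is chosen.\<close>

lemma pair_moment_le:
  assumes "\<alpha> \<subseteq> edges n" "\<beta> \<subseteq> edges n"
  shows "pair_moment \<alpha> \<beta> \<le>
    (\<Sum>\<gamma>\<in>Pow (\<alpha> \<inter> \<beta>). q ^ card (\<alpha> \<inter> \<beta> - \<gamma>) * moment (\<gamma> \<union> (\<alpha> - \<beta>) \<union> (\<beta> - \<alpha>)))"
proof -
  have fin: "finite \<alpha>" "finite \<beta>"
    using assms finite_subset[OF _ finite_edges] by auto
  let ?\<Delta> = "(\<alpha> - \<beta>) \<union> (\<beta> - \<alpha>)"
  have "pair_moment \<alpha> \<beta> \<le> measure_pmf.expectation labels (\<lambda>\<sigma>. \<Sum>\<gamma>\<in>Pow (\<alpha> \<inter> \<beta>).
      q ^ card (\<alpha> \<inter> \<beta> - \<gamma>) * (\<Prod>e\<in>\<gamma> \<union> (\<alpha> - \<beta>) \<union> (\<beta> - \<alpha>). signal \<sigma> e))"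
    unfolding pair_moment_def
  proof (rule expectation_mono_finite)
    fix \<sigma> assume \<sigma>: "\<sigma> \<in> set_pmf labels"
    define h where "h e b = (if e \<in> \<alpha> \<inter> \<beta> then (of_bool b - q)\<^sup>2 else of_bool b - q)" for e b
    have split: "(\<Prod>e\<in>\<alpha>. g e) * (\<Prod>e\<in>\<beta>. g e) = (\<Prod>e\<in>\<alpha> \<inter> \<beta>. (g e)\<^sup>2) * (\<Prod>e\<in>?\<Delta>. g e)"
      for g :: "nat \<times> nat \<Rightarrow> real"
    proof -
      have "(\<Prod>e\<in>\<alpha>. g e) = (\<Prod>e\<in>\<alpha> \<inter> \<beta>. g e) * (\<Prod>e\<in>\<alpha> - \<beta>. g e)"
        using fin by (subst prod.union_disjoint[symmetric]) (auto intro!: prod.cong)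
      moreover have "(\<Prod>e\<in>\<beta>. g e) = (\<Prod>e\<in>\<alpha> \<inter> \<beta>. g e) * (\<Prod>e\<in>\<beta> - \<alpha>. g e)"
        using fin by (subst prod.union_disjoint[symmetric]) (auto intro!: prod.cong)
      moreover have "(\<Prod>e\<in>?\<Delta>. g e) = (\<Prod>e\<in>\<alpha> - \<beta>. g e) * (\<Prod>e\<in>\<beta> - \<alpha>. g e)"
        using fin by (intro prod.union_disjoint) auto
      ultimately show ?thesis
        by (simp add: power2_eq_square prod.distrib mult_ac)
    qed
    have Un: "\<alpha> \<union> \<beta> = (\<alpha> \<inter> \<beta>) \<union> ?\<Delta>" by blast
    have prodh: "(\<Prod>e\<in>\<alpha>. of_bool (W e) - q) * (\<Prod>e\<in>\<beta>. of_bool (W e) - q) =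
        (\<Prod>e\<in>\<alpha> \<union> \<beta>. h e (W e))" for W
      unfolding split Un using fin
      by (subst prod.union_disjoint) (auto simp: h_def intro!: prod.cong arg_cong2[of _ _ _ _ "(*)"])
    let ?E = "\<lambda>e. (q + signal \<sigma> e) * h e True + (1 - (q + signal \<sigma> e)) * h e False"
    have "measure_pmf.expectation (graph \<sigma>)
        (\<lambda>W. (\<Prod>e\<in>\<alpha>. of_bool (W e) - q) * (\<Prod>e\<in>\<beta>. of_bool (W e) - q)) = (\<Prod>e\<in>\<alpha> \<union> \<beta>. ?E e)"
      unfolding prodh using \<sigma> assms by (intro expectation_graph_prod) auto
    also have "\<dots> = (\<Prod>e\<in>\<alpha> \<inter> \<beta>. ?E e) * (\<Prod>e\<in>?\<Delta>. ?E e)"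
      unfolding Un using fin by (intro prod.union_disjoint) auto
    also have "(\<Prod>e\<in>?\<Delta>. ?E e) = (\<Prod>e\<in>?\<Delta>. signal \<sigma> e)"
      by (intro prod.cong refl) (auto simp: h_def algebra_simps)
    also have "(\<Prod>e\<in>\<alpha> \<inter> \<beta>. ?E e) * (\<Prod>e\<in>?\<Delta>. signal \<sigma> e) \<le>
        (\<Prod>e\<in>\<alpha> \<inter> \<beta>. signal \<sigma> e + q) * (\<Prod>e\<in>?\<Delta>. signal \<sigma> e)"
    proof (intro mult_right_mono prod_mono conjI)
      fix e assume e: "e \<in> \<alpha> \<inter> \<beta>"
      have b: "0 \<le> signal \<sigma> e" "q + signal \<sigma> e \<le> 1" "0 \<le> q" "q \<le> 1"
        using signal_nonneg[OF \<sigma>] signal_le'[OF \<sigma>] params q_le_1 by auto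
      show "0 \<le> ?E e"
        using b e by (simp add: h_def)
      have "?E e = (signal \<sigma> e + q) - (q * q + 2 * (q * signal \<sigma> e))"
        using e by (simp add: h_def power2_eq_square algebra_simps)
      also have "\<dots> \<le> signal \<sigma> e + q"
        using mult_nonneg_nonneg[OF b(3) b(3)] mult_nonneg_nonneg[OF b(3) b(1)] by linarith
      finally show "?E e \<le> signal \<sigma> e + q" .
    qed (simp add: prod_nonneg signal_nonneg[OF \<sigma>])
    also have "(\<Prod>e\<in>\<alpha> \<inter> \<beta>. signal \<sigma> e + q) =
        (\<Sum>\<gamma>\<in>Pow (\<alpha> \<inter> \<beta>). (\<Prod>e\<in>\<gamma>. signal \<sigma> e) * (\<Prod>e\<in>\<alpha> \<inter> \<beta> - \<gamma>. q))"
      using fin by (intro prod_add) simp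
    also have "\<dots> * (\<Prod>e\<in>?\<Delta>. signal \<sigma> e) = (\<Sum>\<gamma>\<in>Pow (\<alpha> \<inter> \<beta>).
        q ^ card (\<alpha> \<inter> \<beta> - \<gamma>) * (\<Prod>e\<in>\<gamma> \<union> (\<alpha> - \<beta>) \<union> (\<beta> - \<alpha>). signal \<sigma> e))"
      unfolding sum_distrib_right
    proof (intro sum.cong refl)
      fix \<gamma> assume \<gamma>: "\<gamma> \<in> Pow (\<alpha> \<inter> \<beta>)"
      have "(\<Prod>e\<in>\<gamma> \<union> ?\<Delta>. signal \<sigma> e) = (\<Prod>e\<in>\<gamma>. signal \<sigma> e) * (\<Prod>e\<in>?\<Delta>. signal \<sigma> e)"
        using \<gamma> fin finite_subset[of \<gamma> \<alpha>] by (intro prod.union_disjoint) auto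
      then show "(\<Prod>e\<in>\<gamma>. signal \<sigma> e) * (\<Prod>e\<in>\<alpha> \<inter> \<beta> - \<gamma>. q) * (\<Prod>e\<in>?\<Delta>. signal \<sigma> e) =
          q ^ card (\<alpha> \<inter> \<beta> - \<gamma>) * (\<Prod>e\<in>\<gamma> \<union> (\<alpha> - \<beta>) \<union> (\<beta> - \<alpha>). signal \<sigma> e)"
        by (simp add: Un_assoc mult_ac)
    qed
    finally show "measure_pmf.expectation (graph \<sigma>)
        (\<lambda>W. (\<Prod>e\<in>\<alpha>. of_bool (W e) - q) * (\<Prod>e\<in>\<beta>. of_bool (W e) - q)) \<le>
        (\<Sum>\<gamma>\<in>Pow (\<alpha> \<inter> \<beta>).
          q ^ card (\<alpha> \<inter> \<beta> - \<gamma>) * (\<Prod>e\<in>\<gamma> \<union> (\<alpha> - \<beta>) \<union> (\<beta> - \<alpha>). signal \<sigma> e))" .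
  qed simp
  then show ?thesis
    by (simp add: expectation_sum_finite moment_def)
qed

text \<open>The terms come from the subsets of the triangle: the empty set, three single edges,
  three paths with two edges, and the triangle. Edges and paths are trees, so only the last term
  involves M.\<close>

lemma pair_moment_same:
  assumes "T \<in> triples n"
  shows "pair_moment (clique T) (clique T) \<le>
    q ^ 3 + 3 * q\<^sup>2 * (k / n)\<^sup>2 * s + 3 * q * (k / n) ^ 3 * s\<^sup>2 + (k / n) ^ 3 * s ^ 3 * M"
proof -
  obtain a b c where T: "T = {a, b, c}" "a \<noteq> b" "a \<noteq> c" "b \<noteq> c"
    using triplesD(2)[OF assms] by (auto simp: card_3_iff)
  have V: "a \<in> {1..n}" "b \<in> {1..n}" "c \<in> {1..n}"
    using triplesD(1)[OF assms] T by auto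
  have eq: "clique T = {edge a b, edge a c, edge b c}"
    using T by (simp add: clique_3)
  have one: "moment {edge u v} = (k / n)\<^sup>2 * s" if "u \<noteq> v" "u \<in> {1..n}" "v \<in> {1..n}" for u v
    using that moment_tree[of "{edge u v}"] conn_edge edge_in_edges[of u v n]
    by (simp add: numeral_eq_Suc)
  have two: "moment {edge u v, edge u w} = (k / n) ^ 3 * s\<^sup>2"
    if "u \<noteq> v" "u \<noteq> w" "v \<noteq> w" "u \<in> {1..n}" "v \<in> {1..n}" "w \<in> {1..n}" for u v w
  proof -
    have conn: "conn {edge u v, edge u w}"
      by (rule conn_insert_edge, rule conn_edge) auto
    have sub: "{edge u v, edge u w} \<subseteq> edges n"
      using that by (auto intro!: edge_in_edges)
    have cards: "card (verts {edge u v, edge u w}) = 3" "card {edge u v, edge u w} = 2"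
      using that by (simp_all add: card_insert_if)
    show ?thesis
      using moment_tree[OF conn _ sub, unfolded cards] by simp
  qed
  have comm: "edge u v = edge v u" for u v by auto
  have m2: "moment {edge a b, edge a c} = (k / n) ^ 3 * s\<^sup>2"
      "moment {edge a b, edge b c} = (k / n) ^ 3 * s\<^sup>2"
      "moment {edge a c, edge b c} = (k / n) ^ 3 * s\<^sup>2"
    using two[of a b c] two[of b a c] two[of c a b] T V
    by (simp_all add: comm[of b a] comm[of c a] comm[of c b])
  have m3: "moment {edge a b, edge a c, edge b c} = (k / n) ^ 3 * s ^ 3 * M"
    using moment_triangle[OF assms] by (simp only: eq)
  have sub: "clique T \<subseteq> edges n"
    using assms by (rule clique_triple_subset)
  have "pair_moment (clique T) (clique T) \<le>
      (\<Sum>\<gamma>\<in>Pow (clique T). q ^ card (clique T - \<gamma>) * moment \<gamma>)"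
    using pair_moment_le[OF sub sub] by simp
  also have "\<dots> = q ^ 3 + 3 * q\<^sup>2 * (k / n)\<^sup>2 * s + 3 * q * (k / n) ^ 3 * s\<^sup>2 + (k / n) ^ 3 * s ^ 3 * M"
    unfolding eq using T V one[of a b] one[of a c] one[of b c]
    by (simp add: sum_Pow_insert insert_Diff_if m2 m3 power2_eq_square power3_eq_cube algebra_simps)
  finally show ?thesis .
qed

text \<open>The symmetric difference is a 4-cycle, with as many edges as vertices; including the
  common edge adds a chord and with it a second independent cycle.\<close>

lemma pair_moment_common_edge:
  fixes r :: real
  assumes T: "T \<in> triples n" "T' \<in> triples n" "card (T \<inter> T') = 2"
    and r: "\<And>l. l \<in> {1..M} \<Longrightarrow> 1 / x l \<le> r"
  shows "pair_moment (clique T) (clique T') \<le>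
    q * ((k / n) ^ 4 * s ^ 4 * M) + (k / n) ^ 4 * s ^ 5 * (M * r)"
proof -
  obtain a b where ab: "T \<inter> T' = {a, b}" "a \<noteq> b"
    using T(3) by (auto simp: card_2_iff)
  have "card (T - T') = 1" "card (T' - T) = 1"
    using card_Diff_subset_Int[of T T'] card_Diff_subset_Int[of T' T] T triplesD[of T n] triplesD[of T' n]
    by (simp_all add: Int_commute)
  then obtain c d where cd: "T - T' = {c}" "T' - T = {d}"
    by (auto simp: card_1_singleton_iff)
  have eqT: "T = {a, b, c}" "T' = {a, b, d}"
    using ab cd by blast+
  have ne: "a \<noteq> b" "a \<noteq> c" "b \<noteq> c" "a \<noteq> d" "b \<noteq> d" "c \<noteq> d"
    using ab cd by blast+
  have V: "a \<in> {1..n}" "b \<in> {1..n}" "c \<in> {1..n}" "d \<in> {1..n}"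
    using triplesD(1)[OF T(1)] triplesD(1)[OF T(2)] eqT by auto
  have I: "clique T \<inter> clique T' = {edge a b}"
    using ne by (simp add: clique_Int[symmetric] ab(1) clique_2)
  let ?\<Delta> = "{edge a c, edge b c, edge b d, edge a d}"
  have \<Delta>: "(clique T - clique T') \<union> (clique T' - clique T) = ?\<Delta>"
    using ne unfolding eqT by (auto simp: clique_3)
  have sub: "?\<Delta> \<subseteq> edges n" "insert (edge a b) ?\<Delta> \<subseteq> edges n"
    using ne V by (auto intro!: edge_in_edges)
  have connD: "conn ?\<Delta>"
  proof -
    have "conn {edge d b, edge a d}"
      by (rule conn_insert_edge, rule conn_edge) auto
    then have "conn {edge b c, edge d b, edge a d}"
      by (rule conn_insert_edge) auto
    then have "conn {edge a c, edge b c, edge d b, edge a d}"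
      by (rule conn_insert_edge) auto
    moreover have "edge d b = edge b d" by auto
    ultimately show ?thesis by (simp only:)
  qed
  have conn5: "conn (insert (edge a b) ?\<Delta>)"
    using connD by (rule conn_insert_edge) auto
  have cards: "card (verts ?\<Delta>) = 4" "card ?\<Delta> = 4"
      "card (verts (insert (edge a b) ?\<Delta>)) = 4" "card (insert (edge a b) ?\<Delta>) = 5"
    using ne by (simp_all add: card_insert_if)
  have m4: "moment ?\<Delta> = (k / n) ^ 4 * s ^ 4 * M"
    using moment_unicyclic[OF connD _ sub(1), unfolded cards] by simp
  have m5: "moment (insert (edge a b) ?\<Delta>) \<le> (k / n) ^ 4 * s ^ 5 * (M * r)"
    using moment_bicyclic_le[OF conn5 _ sub(2) _ r, unfolded cards] by simp
  have "pair_moment (clique T) (clique T') \<le> (\<Sum>\<gamma>\<in>Pow {edge a b}.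
      q ^ card ({edge a b} - \<gamma>) * moment (\<gamma> \<union> ?\<Delta>))"
    using pair_moment_le[of "clique T" "clique T'"] clique_triple_subset T
    by (simp only: I \<Delta> Un_assoc)
  also have "\<dots> = q * moment ?\<Delta> + moment (insert (edge a b) ?\<Delta>)"
    by (simp add: sum_Pow_insert insert_commute del: edge_eq_iff)
  finally show ?thesis
    using m4 m5 by simp
qed

text \<open>Triangles that meet in one vertex share no edge, so only the empty \<gamma> occurs.
  Their union is the bowtie with 5 vertices and 6 edges.\<close>

lemma pair_moment_common_vertex:
  fixes r :: real
  assumes T: "T \<in> triples n" "T' \<in> triples n" "card (T \<inter> T') = 1"
    and r: "\<And>l. l \<in> {1..M} \<Longrightarrow> 1 / x l \<le> r"
  shows "pair_moment (clique T) (clique T') \<le> (k / n) ^ 5 * s ^ 6 * (M * r)"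
proof -
  obtain a where a: "T \<inter> T' = {a}"
    using T(3) by (auto simp: card_1_singleton_iff)
  have "card (T - T') = 2" "card (T' - T) = 2"
    using card_Diff_subset_Int[of T T'] card_Diff_subset_Int[of T' T] T triplesD[of T n] triplesD[of T' n]
    by (simp_all add: Int_commute)
  then obtain b c d e where bc: "T - T' = {b, c}" "b \<noteq> c" and de: "T' - T = {d, e}" "d \<noteq> e"
    by (auto simp: card_2_iff)
  have eqT: "T = {a, b, c}" "T' = {a, d, e}"
    using a bc de by blast+
  have ne: "a \<noteq> b" "a \<noteq> c" "a \<noteq> d" "a \<noteq> e" "b \<noteq> d" "b \<noteq> e" "c \<noteq> d" "c \<noteq> e"
    using a bc de by blast+
  have V: "a \<in> {1..n}" "b \<in> {1..n}" "c \<in> {1..n}" "d \<in> {1..n}" "e \<in> {1..n}"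
    using triplesD(1)[OF T(1)] triplesD(1)[OF T(2)] eqT by auto
  have I: "clique T \<inter> clique T' = {}"
    by (simp add: clique_Int[symmetric] a) (simp add: clique_def)
  let ?\<Delta> = "{edge b c, edge d e, edge a b, edge a c, edge a d, edge a e}"
  have \<Delta>: "(clique T - clique T') \<union> (clique T' - clique T) = ?\<Delta>"
    using ne bc(2) de(2) unfolding eqT by (auto simp: clique_3)
  have sub: "?\<Delta> \<subseteq> edges n"
    using ne bc(2) de(2) V by (auto intro!: edge_in_edges)
  have connD: "conn ?\<Delta>"
    by (rule conn_insert_edge, rule conn_insert_edge, rule conn_insert_edge, rule conn_insert_edge,
        rule conn_insert_edge, rule conn_edge) auto
  have cards: "card (verts ?\<Delta>) = 5" "card ?\<Delta> = 6"
    using ne bc(2) de(2) by (simp_all add: card_insert_if)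
  have "moment ?\<Delta> \<le> (k / n) ^ 5 * s ^ 6 * (M * r)"
    using moment_bicyclic_le[OF connD _ sub _ r, unfolded cards] by simp
  moreover have "pair_moment (clique T) (clique T') \<le> moment ?\<Delta>"
    using pair_moment_le[of "clique T" "clique T'"] clique_triple_subset T
    by (simp add: I \<Delta> Un_assoc)
  ultimately show ?thesis by simp
qed

text \<open>The signals of disjoint triangles are independent. Such pairs, of order n^6 in number,
  therefore add nothing positive to the variance.\<close>

lemma pair_moment_disjoint:
  assumes T: "T \<in> triples n" "T' \<in> triples n" "T \<inter> T' = {}"
  shows "pair_moment (clique T) (clique T') \<le> moment (clique T) * moment (clique T')"
proof -
  have I: "clique T \<inter> clique T' = {}"
    by (simp add: clique_Int[symmetric] T(3)) (simp add: clique_def)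
  then have \<Delta>: "(clique T - clique T') \<union> (clique T' - clique T) = clique T \<union> clique T'"
    by blast
  have sub: "clique T \<subseteq> edges n" "clique T' \<subseteq> edges n"
    using clique_triple_subset T by auto
  have "pair_moment (clique T) (clique T') \<le> moment (clique T \<union> clique T')"
    using pair_moment_le[OF sub] by (simp add: I \<Delta> Un_assoc)
  also have "\<dots> = moment (clique T) * moment (clique T')"
    using sub verts_clique_subset[of T] verts_clique_subset[of T'] T(3) by (intro moment_Un) auto
  finally show ?thesis .
qed

lemma expectation_triangle_stat:
  "measure_pmf.expectation (binary_model n k q s M x) (triangle_stat n q) =
    (n choose 3) * ((k / n) ^ 3 * s ^ 3 * M)"
proof -
  have "measure_pmf.expectation (binary_model n k q s M x) (triangle_stat n q) =
      measure_pmf.expectation labels (\<lambda>\<sigma>. \<Sum>T\<in>triples n. \<Prod>e\<in>clique T. signal \<sigma> e)"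
    unfolding expectation_binary_model triangle_stat_adj_matrix
    by (intro expectation_cong_pmf)
       (auto simp: expectation_sum_finite expectation_graph_monomial clique_triple_subset
         intro!: sum.cong)
  also have "\<dots> = (\<Sum>T\<in>triples n. moment (clique T))"
    by (simp add: expectation_sum_finite moment_def)
  also have "\<dots> = (\<Sum>T\<in>triples n. (k / n) ^ 3 * s ^ 3 * M)"
    by (intro sum.cong refl moment_triangle)
  finally show ?thesis
    by (simp add: card_triples)
qed

text \<open>Pairs of triangles are grouped by the size m of their union. There are at most 4^m n^m
  of them, and \<open>1024\<close> is 4^5, the largest case that counts. The powers of n then cancel
  against those of k/n; \<open>r\<close> enters only through triangles that share an edge or a
  single vertex.\<close>

lemma variance_triangle_stat_le:
  fixes r :: real
  assumes r: "\<And>l. l \<in> {1..M} \<Longrightarrow> 1 / x l \<le> r"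
  shows "measure_pmf.variance (binary_model n k q s M x) (triangle_stat n q) \<le>
    1024 * (real n ^ 3 * q ^ 3 + 3 * real n * q\<^sup>2 * k\<^sup>2 * s + 3 * q * k ^ 3 * s\<^sup>2 + k ^ 3 * s ^ 3 * M
      + q * k ^ 4 * s ^ 4 * M + k ^ 4 * s ^ 5 * (M * r) + k ^ 5 * s ^ 6 * (M * r))"
proof -
  let ?P = "binary_model n k q s M x" and ?E = "\<lambda>f. measure_pmf.expectation labels f"
  let ?\<tau> = "triples n" and ?a = "k / n"
  have n: "0 < real n"
    using n_pos by simp
  have "1 \<in> {1..M}"
    using params by simp
  from r[OF this] x_pos[OF this] have r0: "0 \<le> r"
    by (meson less_imp_le order_trans zero_le_divide_1_iff)
  \<comment> \<open>\<open>A m\<close> bounds the covariance of two triangles whose union has m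
    vertices; the default value 0 covers m = 6, the disjoint case.\<close>
  define A where "A m =
     (if m = 3 then q ^ 3 + 3 * q\<^sup>2 * ?a\<^sup>2 * s + 3 * q * ?a ^ 3 * s\<^sup>2 + ?a ^ 3 * s ^ 3 * M
      else if m = 4 then q * (?a ^ 4 * s ^ 4 * M) + ?a ^ 4 * s ^ 5 * (M * r)
      else if m = 5 then ?a ^ 5 * s ^ 6 * (M * r) else 0)" for m :: nat
  have A0: "0 \<le> A m" for m
    using params r0 by (auto simp: A_def intro!: add_nonneg_nonneg mult_nonneg_nonneg)
  have cov: "pair_moment (clique (fst z)) (clique (snd z)) -
      moment (clique (fst z)) * moment (clique (snd z)) \<le> A (card (fst z \<union> snd z))"
    if z: "z \<in> ?\<tau> \<times> ?\<tau>" for z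
  proof -
    obtain T T' where zz: "z = (T, T')" and T: "T \<in> ?\<tau>" "T' \<in> ?\<tau>"
      using z by (cases z) auto
    have mm: "0 \<le> moment (clique T) * moment (clique T')"
      by (simp add: moment_nonneg)
    then have le: "pair_moment (clique T) (clique T') \<le> B \<Longrightarrow>
        pair_moment (clique T) (clique T') - moment (clique T) * moment (clique T') \<le> B" for B
      by linarith
    have fin: "finite T" "finite T'" and c3: "card T = 3" "card T' = 3"
      using triplesD T by auto
    have card: "card (T \<union> T') + card (T \<inter> T') = 6"
      using card_Un_Int[OF fin] c3 by simp
    have "card (T \<inter> T') \<le> 3"
      using card_mono[of T "T \<inter> T'"] fin c3 by simp
    then consider "card (T \<inter> T') = 0" | "card (T \<inter> T') = 1" | "card (T \<inter> T') = 2" | "card (T \<inter> T') = 3"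
      by linarith
    then show ?thesis
    proof cases
      case 1
      then have "T \<inter> T' = {}" using fin by simp
      then have "pair_moment (clique T) (clique T') \<le> moment (clique T) * moment (clique T')"
        by (rule pair_moment_disjoint[OF T])
      then show ?thesis
        using A0[of "card (T \<union> T')"] by (simp add: zz)
    next
      case 2
      then have "card (T \<union> T') = 5" using card by simp
      then show ?thesis
        using pair_moment_common_vertex[OF T 2 r] mm by (simp add: zz A_def)
    next
      case 3
      then have "card (T \<union> T') = 4" using card by simp
      then show ?thesis
        using pair_moment_common_edge[OF T 3 r] mm by (simp add: zz A_def)
    next
      case 4
      have "T \<inter> T' = T"
        by (rule card_subset_eq) (use 4 fin c3 in auto)
      moreover have "T \<inter> T' = T'"
        by (rule card_subset_eq) (use 4 fin c3 in auto)
      ultimately have "T' = T" by simp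
      then show ?thesis
        using le[of "A 3"] pair_moment_same[OF T(1)] c3 by (simp add: zz A_def)
    qed
  qed
  have int: "integrable (measure_pmf ?P) f" for f :: "_ \<Rightarrow> real"
    by (rule integrable_measure_pmf_finite) simp
  have "measure_pmf.expectation ?P (\<lambda>Y. (triangle_stat n q Y)\<^sup>2) =
      (\<Sum>T\<in>?\<tau>. \<Sum>T'\<in>?\<tau>. pair_moment (clique T) (clique T'))"
    unfolding expectation_binary_model triangle_stat_adj_matrix
    by (simp add: power2_eq_square sum_product expectation_sum_finite pair_moment_def)
  moreover have "measure_pmf.expectation ?P (triangle_stat n q) = (\<Sum>T\<in>?\<tau>. moment (clique T))"
    by (simp add: expectation_triangle_stat moment_triangle card_triples)
  moreover have "measure_pmf.variance ?P (triangle_stat n q) =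
      measure_pmf.expectation ?P (\<lambda>Y. (triangle_stat n q Y)\<^sup>2) -
      (measure_pmf.expectation ?P (triangle_stat n q))\<^sup>2"
    by (intro measure_pmf.variance_eq int)
  ultimately have "measure_pmf.variance ?P (triangle_stat n q) =
      (\<Sum>T\<in>?\<tau>. \<Sum>T'\<in>?\<tau>. pair_moment (clique T) (clique T') - moment (clique T) * moment (clique T'))"
    by (simp only: power2_eq_square sum_product sum_subtractf)
  also have "\<dots> = (\<Sum>z\<in>?\<tau> \<times> ?\<tau>. pair_moment (clique (fst z)) (clique (snd z)) -
      moment (clique (fst z)) * moment (clique (snd z)))"
    by (simp add: sum.cartesian_product case_prod_unfold)
  also have "\<dots> \<le> (\<Sum>z\<in>?\<tau> \<times> ?\<tau>. A (card (fst z \<union> snd z)))"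
    by (rule sum_mono) (rule cov)
  also have "\<dots> = (\<Sum>z\<in>?\<tau> \<times> ?\<tau>. \<Sum>m\<in>{3, 4, 5}. if card (fst z \<union> snd z) = m then A m else 0)"
    by (intro sum.cong refl) (auto simp: A_def)
  also have "\<dots> = (\<Sum>m\<in>{3, 4, 5}. \<Sum>z\<in>?\<tau> \<times> ?\<tau>. if card (fst z \<union> snd z) = m then A m else 0)"
    by (rule sum.swap)
  also have "\<dots> = (\<Sum>m\<in>{3, 4, 5}. card {z \<in> ?\<tau> \<times> ?\<tau>. card (fst z \<union> snd z) = m} * A m)"
    by (intro sum.cong refl) (simp add: sum.inter_filter[symmetric])
  also have "\<dots> \<le> (\<Sum>m\<in>{3, 4, 5}. 1024 * real n ^ m * A m)"
  proof (intro sum_mono mult_right_mono A0)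
    fix m :: nat assume m: "m \<in> {3, 4, 5}"
    have "real (card {z \<in> ?\<tau> \<times> ?\<tau>. card (fst z \<union> snd z) = m}) \<le> real (4 ^ m * n ^ m)"
      by (simp only: of_nat_le_iff card_triple_pairs_le)
    also have "\<dots> \<le> 1024 * real n ^ m"
      using m by auto
    finally show "real (card {z \<in> ?\<tau> \<times> ?\<tau>. card (fst z \<union> snd z) = m}) \<le> 1024 * real n ^ m" .
  qed
  also have "\<dots> = 1024 * (real n ^ 3 * A 3 + real n ^ 4 * A 4 + real n ^ 5 * A 5)"
    by simp
  also have "real n ^ 3 * A 3 =
      real n ^ 3 * q ^ 3 + 3 * real n * q\<^sup>2 * k\<^sup>2 * s + 3 * q * k ^ 3 * s\<^sup>2 + k ^ 3 * s ^ 3 * M"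
    using n by (simp add: A_def power_divide field_simps eval_nat_numeral)
  also have "real n ^ 4 * A 4 = q * k ^ 4 * s ^ 4 * M + k ^ 4 * s ^ 5 * (M * r)"
    using n by (simp add: A_def power_divide field_simps)
  also have "real n ^ 5 * A 5 = k ^ 5 * s ^ 6 * (M * r)"
    using n by (simp add: A_def power_divide)
  finally show ?thesis
    by (simp add: algebra_simps)
qed

end

section \<open>Separation\<close>

text \<open>The numerical core. Here t is the gap |M - M'|, H bounds both community numbers, and
  \<open>u\<close>, \<open>w\<close> are t^(2/3) and H^(1/3), given by their cubes to keep to
  natural powers. With z = s k the squared signal is z^6 t^2 = u^3 z^6, and each noise term is shown
  to be smaller by a factor L. Five terms with multiplicities 1, 3, 3, 1, 1 give the 9; the two
  terms with H/C give 2/C.\<close>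

lemma triangle_noise_le:
  fixes n k q s t u H w C L :: real
  assumes pos: "1 \<le> n" "0 < k" "k \<le> n" "0 < q" "0 \<le> s" "1 \<le> t" "1 \<le> H" "1 \<le> L" "0 < C"
    and u: "0 < u" "u ^ 3 = t\<^sup>2" and w: "0 < w" "w ^ 3 = H"
    and a: "L * (q * n) \<le> u * (s * k)\<^sup>2" and b: "L * w \<le> s * k" and d: "L * H\<^sup>2 \<le> t\<^sup>2 * k"
  shows "n ^ 3 * q ^ 3 + 3 * n * q\<^sup>2 * k\<^sup>2 * s + 3 * q * k ^ 3 * s\<^sup>2 + k ^ 3 * s ^ 3 * H
      + q * k ^ 4 * s ^ 4 * H + k ^ 4 * s ^ 5 * (H * (H / C)) + k ^ 5 * s ^ 6 * (H * (H / C))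
    \<le> (9 + 2 / C) / L * ((s * k) ^ 6 * t\<^sup>2)"
proof -
  define z where "z = s * k"
  define g where "g = z ^ 6 * t\<^sup>2"
  define y where "y = u * z\<^sup>2 / L"
  have w1: "1 \<le> w"
  proof (rule ccontr)
    assume "\<not> 1 \<le> w"
    then have "w ^ 3 < 1 ^ 3" using w by (intro power_strict_mono) auto
    then show False using w pos by simp
  qed
  have u1: "1 \<le> u"
  proof (rule ccontr)
    assume "\<not> 1 \<le> u"
    then have "u ^ 3 < 1 ^ 3" using u by (intro power_strict_mono) auto
    moreover have "1 \<le> t\<^sup>2"
      using pos by (intro one_le_power)
    ultimately show False using u by simp
  qed
  have z1: "1 \<le> z"
    using b mult_mono[of 1 L 1 w] pos w1 by (simp add: z_def)
  have y: "q * n \<le> y" "0 \<le> y" "0 \<le> q * n"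
    using a pos u by (simp_all add: y_def z_def field_simps)
  have g: "g = u ^ 3 * z ^ 6" "0 \<le> g"
    using z1 by (simp_all add: g_def u mult_ac)
  have kn: "k / n \<le> 1" "0 \<le> k / n"
    using pos by simp_all
  \<comment> \<open>Since u, z and L are at least 1, every monomial with exponents within these
    ranges is dominated by u^3 z^6 / L.\<close>
  have mono: "u ^ i * z ^ j / L ^ l \<le> g / L" if "i \<le> 3" "j \<le> 6" "1 \<le> l" for i j l
  proof (rule frac_le)
    show "u ^ i * z ^ j \<le> g"
      unfolding g using that u1 z1 by (intro mult_mono power_increasing) auto
    show "L \<le> L ^ l"
      using self_le_power[of L l] that pos by auto
  qed (use g pos in auto)
  have "n ^ 3 * q ^ 3 = (q * n) ^ 3"
    by (simp add: power_mult_distrib)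
  also have "\<dots> \<le> y ^ 3"
    using y by (intro power_mono) auto
  also have "\<dots> = u ^ 3 * z ^ 6 / L ^ 3"
    by (simp add: y_def power_divide power_mult_distrib flip: power_mult)
  also have "\<dots> \<le> g / L"
    by (rule mono) auto
  finally have 1: "n ^ 3 * q ^ 3 \<le> g / L" .
  \<comment> \<open>A factor k/n <= 1 is split off, so that every q is paired with an n and the
    bound on q n applies.\<close>
  have "n * q\<^sup>2 * k\<^sup>2 * s = (q * n)\<^sup>2 * (k / n) * z"
    using pos by (simp add: z_def field_simps power2_eq_square)
  also have "\<dots> \<le> y\<^sup>2 * 1 * z"
    using y kn z1 by (intro mult_mono power_mono) auto
  also have "\<dots> = u ^ 2 * z ^ 5 / L ^ 2"
    by (simp add: y_def power_divide power_mult_distrib eval_nat_numeral)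
  also have "\<dots> \<le> g / L"
    by (rule mono) auto
  finally have 2: "n * q\<^sup>2 * k\<^sup>2 * s \<le> g / L" .
  have "q * k ^ 3 * s\<^sup>2 = (q * n) * (k / n) * z\<^sup>2"
    using pos by (simp add: z_def field_simps eval_nat_numeral)
  also have "\<dots> \<le> y * 1 * z\<^sup>2"
    using y kn z1 by (intro mult_mono) auto
  also have "\<dots> = u ^ 1 * z ^ 4 / L ^ 1"
    by (simp add: y_def eval_nat_numeral)
  also have "\<dots> \<le> g / L"
    by (rule mono) auto
  finally have 3: "q * k ^ 3 * s\<^sup>2 \<le> g / L" .
  \<comment> \<open>The fluctuation of single planted triangles: the condition on \<open>w\<close>
    bounds it by z^6 / L^3.\<close>
  have "k ^ 3 * s ^ 3 * H = z ^ 3 * w ^ 3"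
    by (simp add: z_def w power_mult_distrib mult_ac)
  also have "\<dots> \<le> z ^ 3 * (z / L) ^ 3"
    using b pos w z1 by (intro mult_left_mono power_mono) (auto simp: z_def field_simps)
  also have "\<dots> = u ^ 0 * z ^ 6 / L ^ 3"
    by (simp add: power_divide flip: power_add)
  also have "\<dots> \<le> g / L"
    by (rule mono) auto
  finally have 4: "k ^ 3 * s ^ 3 * H \<le> g / L" .
  \<comment> \<open>In the term q k^4 s^4 H the factor q needs an n, which leaves H/n. The condition
    on t gives H^2 <= t^2 k <= u^4 n <= (u^2 n)^2.\<close>
  have H: "H / n \<le> u\<^sup>2"
  proof -
    have "H\<^sup>2 \<le> L * H\<^sup>2"
      using pos by simp
    also have "\<dots> \<le> t\<^sup>2 * k" by (rule d)
    also have "\<dots> \<le> (u ^ 3 * u) * n"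
      using u1 pos u by (intro mult_mono) auto
    finally have "H\<^sup>2 \<le> (u ^ 3 * u) * n" .
    have u4: "u ^ 3 * u = (u\<^sup>2)\<^sup>2"
      by (simp add: eval_nat_numeral)
    have n1: "H\<^sup>2 \<le> (u\<^sup>2)\<^sup>2 * n"
      using \<open>H\<^sup>2 \<le> (u ^ 3 * u) * n\<close> u4 by simp
    show ?thesis
    proof -
      have "n \<le> n\<^sup>2"
        using pos by (simp add: self_le_power)
      then have "(u\<^sup>2)\<^sup>2 * n \<le> (u\<^sup>2)\<^sup>2 * n\<^sup>2"
        by (intro mult_left_mono) auto
      with n1 have "H\<^sup>2 \<le> (u\<^sup>2 * n)\<^sup>2"
        by (simp add: power_mult_distrib)
      then have "H \<le> u\<^sup>2 * n"
        by (rule power2_le_imp_le) (use pos in auto)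
      then show ?thesis
        using pos by (simp add: field_simps)
    qed
  qed
  have "q * k ^ 4 * s ^ 4 * H = (q * n) * z ^ 4 * (H / n)"
    using pos by (simp add: z_def field_simps)
  also have "\<dots> \<le> y * z ^ 4 * u\<^sup>2"
    by (intro mult_mono mult_nonneg_nonneg y(1,2) H) (use pos z1 in auto)
  also have "\<dots> = u ^ 3 * z ^ 6 / L ^ 1"
    by (simp add: y_def eval_nat_numeral)
  also have "\<dots> \<le> g / L"
    by (rule mono) auto
  finally have 5: "q * k ^ 4 * s ^ 4 * H \<le> g / L" .
  \<comment> \<open>The terms with 1/x_l, at most H/C, carry H^2; the condition on t trades H^2 / k
    for t^2 / L.\<close>
  have Hk: "H * H / k \<le> t\<^sup>2 / L"
    using d pos by (simp add: field_simps power2_eq_square)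
  have Hz: "z ^ j * (H * H / k) / C \<le> g / L / C" if "j \<le> 6" for j
  proof -
    have "z ^ j * (H * H / k) \<le> z ^ 6 * (t\<^sup>2 / L)"
      using Hk that z1 pos by (intro mult_mono power_increasing) auto
    then have "z ^ j * (H * H / k) / C \<le> z ^ 6 * (t\<^sup>2 / L) / C"
      by (rule divide_right_mono) (use pos in simp)
    then show ?thesis
      by (simp only: g_def times_divide_eq_right)
  qed
  have "k ^ 4 * s ^ 5 * (H * (H / C)) = z ^ 5 * (H * H / k) / C"
    using pos by (simp add: z_def field_simps eval_nat_numeral)
  also have "\<dots> \<le> g / L / C" by (rule Hz) simp
  finally have 6: "k ^ 4 * s ^ 5 * (H * (H / C)) \<le> g / L / C" .
  have "k ^ 5 * s ^ 6 * (H * (H / C)) = z ^ 6 * (H * H / k) / C"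
    using pos by (simp add: z_def field_simps eval_nat_numeral)
  also have "\<dots> \<le> g / L / C" by (rule Hz) simp
  finally have 7: "k ^ 5 * s ^ 6 * (H * (H / C)) \<le> g / L / C" .
  have "(9 + 2 / C) / L * ((s * k) ^ 6 * t\<^sup>2) = 9 * (g / L) + 2 * (g / L / C)"
    using pos by (simp add: g_def z_def field_simps)
  moreover have "3 * n * q\<^sup>2 * k\<^sup>2 * s = 3 * (n * q\<^sup>2 * k\<^sup>2 * s)"
      "3 * q * k ^ 3 * s\<^sup>2 = 3 * (q * k ^ 3 * s\<^sup>2)"
    by simp_all
  ultimately show ?thesis
    using 1 2 3 4 5 6 7 by linarith
qed


lemma proportion_ge:
  assumes "binary_model_ok n k q s M x" "C \<le> real M * Min (x ` {1..M})" "l \<in> {1..M}"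
  shows "C \<le> real M * x l"
proof -
  have "Min (x ` {1..M}) \<le> x l"
    using assms(3) by (intro Min_le) auto
  then have "real M * Min (x ` {1..M}) \<le> real M * x l"
    by (intro mult_left_mono) auto
  then show ?thesis
    using assms(2) by linarith
qed

text \<open>For t = |M - M'| the square on the right is the squared difference of the two means. The
  constant is 746496 = 1024 * 27^2, where 27 comes from n choose 3 >= (n/3)^3 for n >= 3.\<close>

lemma (in binary_community) variance_triangle_stat_le_gap:
  fixes t u H w C L :: real
  assumes C: "0 < C" "\<And>l. l \<in> {1..M} \<Longrightarrow> C \<le> real M * x l"
    and pos: "0 < q" "1 \<le> t" "M \<le> H" "1 \<le> L"
    and u: "0 < u" "u ^ 3 = t\<^sup>2" and w: "0 < w" "w ^ 3 = H"
    and lim: "L * (q * n) \<le> u * (s * k)\<^sup>2" "L * w \<le> s * k" "L * H\<^sup>2 \<le> t\<^sup>2 * k"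
    and n: "3 \<le> n"
  shows "measure_pmf.variance (binary_model n k q s M x) (triangle_stat n q) \<le>
    746496 * (9 + 2 / C) / L * ((n choose 3) * ((k / n) ^ 3 * s ^ 3 * t))\<^sup>2"
proof -
  have M: "1 \<le> real M"
    using params by simp
  have r: "1 / x l \<le> H / C" if "l \<in> {1..M}" for l
  proof -
    have "C \<le> H * x l"
      using C(2)[OF that] pos(3) x_pos[OF that] mult_right_mono[of "real M" H "x l"] by linarith
    then show ?thesis
      using C(1) x_pos[OF that] by (simp add: field_simps)
  qed
  have H: "1 \<le> H" using M pos by linarith
  have MH: "real M * (H / C) \<le> H * (H / C)"
    using pos C H by (intro mult_right_mono) auto
  have "measure_pmf.variance (binary_model n k q s M x) (triangle_stat n q) \<le>
      1024 * (real n ^ 3 * q ^ 3 + 3 * real n * q\<^sup>2 * k\<^sup>2 * s + 3 * q * k ^ 3 * s\<^sup>2 + k ^ 3 * s ^ 3 * M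
      + q * k ^ 4 * s ^ 4 * M + k ^ 4 * s ^ 5 * (M * (H / C)) + k ^ 5 * s ^ 6 * (M * (H / C)))"
    by (rule variance_triangle_stat_le) (rule r)
  also have "\<dots> \<le> 1024 * (real n ^ 3 * q ^ 3 + 3 * real n * q\<^sup>2 * k\<^sup>2 * s + 3 * q * k ^ 3 * s\<^sup>2
      + k ^ 3 * s ^ 3 * H + q * k ^ 4 * s ^ 4 * H
      + k ^ 4 * s ^ 5 * (H * (H / C)) + k ^ 5 * s ^ 6 * (H * (H / C)))"
    by (intro mult_left_mono add_mono order_refl MH pos(3)) (use params in auto)
  also have "\<dots> \<le> 1024 * ((9 + 2 / C) / L * ((s * k) ^ 6 * t\<^sup>2))"
  proof (rule mult_left_mono)
    show "real n ^ 3 * q ^ 3 + 3 * real n * q\<^sup>2 * k\<^sup>2 * s + 3 * q * k ^ 3 * s\<^sup>2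
        + k ^ 3 * s ^ 3 * H + q * k ^ 4 * s ^ 4 * H
        + k ^ 4 * s ^ 5 * (H * (H / C)) + k ^ 5 * s ^ 6 * (H * (H / C))
      \<le> (9 + 2 / C) / L * ((s * k) ^ 6 * t\<^sup>2)"
      by (rule triangle_noise_le[where n = "real n" and u = u and w = w])
         (use n params pos u w lim C H in simp_all)
  qed simp
  also have "(s * k) ^ 6 * t\<^sup>2 = 729 * ((s * k) ^ 3 * t / 27)\<^sup>2"
    by (simp add: power_divide power_mult_distrib flip: power_mult)
  also have "1024 * ((9 + 2 / C) / L * (729 * ((s * k) ^ 3 * t / 27)\<^sup>2)) =
      746496 * (9 + 2 / C) / L * ((s * k) ^ 3 * t / 27)\<^sup>2"
    by (simp only: times_divide_eq_left times_divide_eq_right)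
  also have "\<dots> \<le> 746496 * (9 + 2 / C) / L * ((n choose 3) * ((k / n) ^ 3 * s ^ 3 * t))\<^sup>2"
  proof (intro mult_left_mono power_mono)
    have "(real n / 3) ^ 3 \<le> real (n choose 3)"
      using binomial_ge_n_over_k_pow_k[of 3 n, where 'a = real] n by simp
    then have "(real n / 3) ^ 3 * ((k / n) ^ 3 * s ^ 3 * t) \<le>
        real (n choose 3) * ((k / n) ^ 3 * s ^ 3 * t)"
      using params pos by (intro mult_right_mono) auto
    also have "(real n / 3) ^ 3 * ((k / n) ^ 3 * s ^ 3 * t) = (s * k) ^ 3 * t / 27"
      using n by (simp add: power_divide power_mult_distrib)
    finally show "(s * k) ^ 3 * t / 27 \<le> (n choose 3) * ((k / n) ^ 3 * s ^ 3 * t)" .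
  qed (use params pos C in auto)
  finally show ?thesis .
qed

theorem theorem2p5:
  fixes k q s :: "nat \<Rightarrow> real"
    and M M' :: "nat \<Rightarrow> nat"
    and x x' :: "nat \<Rightarrow> nat \<Rightarrow> real"
    and C \<tau>\<^sub>1 :: real
    and P Q :: "nat \<Rightarrow> (nat \<times> nat \<Rightarrow> real) pmf"
    and Mtilde Mhat :: "nat \<Rightarrow> real"
  defines "P \<equiv> \<lambda>n. binary_model n (k n) (q n) (s n) (M n) (x n)"
    and "Q \<equiv> \<lambda>n. binary_model n (k n) (q n) (s n) (M' n) (x' n)"
    and "Mtilde \<equiv> \<lambda>n. \<bar>real (M n) - real (M' n)\<bar>"
    and "Mhat \<equiv> \<lambda>n. real (max (M n) (M' n))"
  assumes P_ok: "\<And>n. n \<ge> 1 \<Longrightarrow> binary_model_ok n (k n) (q n) (s n) (M n) (x n)"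
    and Q_ok: "\<And>n. n \<ge> 1 \<Longrightarrow> binary_model_ok n (k n) (q n) (s n) (M' n) (x' n)"
    and q_pos: "\<And>n. n \<ge> 1 \<Longrightarrow> q n > 0"
    and C_pos: "C > 0"
    and x_min: "\<And>n. n \<ge> 1 \<Longrightarrow> real (M n) * Min (x n ` {1..M n}) \<ge> C"
    and x'_min: "\<And>n. n \<ge> 1 \<Longrightarrow> real (M' n) * Min (x' n ` {1..M' n}) \<ge> C"
    and tau: "\<tau>\<^sub>1 < 1"
    and q_s_le: "\<And>n. n \<ge> 1 \<Longrightarrow> q n + s n / Min (x n ` {1..M n}) \<le> \<tau>\<^sub>1"
  shows "(\<forall>D :: nat \<Rightarrow> nat.
            (\<lambda>n. real (D n) ^ 5 * Mhat n ^ 2 * (s n ^ 2 / q n) * max (k n ^ 2 / real n) 1)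
              \<in> o(\<lambda>_. 1) \<longrightarrow>
            \<not> (\<exists>f. degree_test D f \<and> weakly_separates P Q f))
       \<and> ((\<lambda>n. Mtilde n powr (2 / 3) * (s n ^ 2 / q n) * (k n ^ 2 / real n)) \<in> \<omega>(\<lambda>_. 1) \<and>
          (\<lambda>n. Mhat n powr (- 1 / 3) * s n * k n) \<in> \<omega>(\<lambda>_. 1) \<and>
          (\<lambda>n. Mtilde n ^ 2 * k n / Mhat n ^ 2) \<in> \<omega>(\<lambda>_. 1) \<longrightarrow>
          (\<exists>f. degree_test (\<lambda>_. 3) f \<and> strongly_separates P Q f))"
proof (intro conjI allI impI)
  have loc: "two_binary_communities n (k n) (q n) (s n) (M n) (x n) (M' n) (x' n)" if "n \<ge> 1" for n
    using P_ok[OF that] Q_ok[OF that]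
    by (simp add: two_binary_communities_def binary_community_def)
  have x_ge: "C \<le> real (M n) * x n l" if "n \<ge> 1" "l \<in> {1..M n}" for n l
    using proportion_ge[OF P_ok[OF that(1)] x_min[OF that(1)] that(2)] .
  have x'_ge: "C \<le> real (M' n) * x' n l" if "n \<ge> 1" "l \<in> {1..M' n}" for n l
    using proportion_ge[OF Q_ok[OF that(1)] x'_min[OF that(1)] that(2)] .
  have M_le: "real (M n) \<le> Mhat n" "real (M' n) \<le> Mhat n" for n
    by (simp_all add: Mhat_def)
  {
    fix D :: "nat \<Rightarrow> nat"
    let ?h = "\<lambda>n. real (D n) ^ 5 * Mhat n ^ 2 * (s n ^ 2 / q n) * max (k n ^ 2 / real n) 1"
    assume small: "?h \<in> o(\<lambda>_. 1)"
    \<comment> \<open>Chosen so that \<open>c * ?h n\<close> is the \<rho> of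
      \<open>low_degree_gap_le\<close> for the values of \<open>v\<close> and \<open>b\<close> set
      below.\<close>
    define c where "c = 16 / (C\<^sup>2 * (1 - \<tau>\<^sub>1))"
    have c: "0 < c"
      using C_pos tau by (simp add: c_def)
    have gap: "(test_gap (P n) (Q n) (f n))\<^sup>2 \<le>
        2 * (c * ?h n) * (test_std (P n) (Q n) (f n))\<^sup>2"
      if f: "degree_test D f" and n: "n \<ge> 1" and le: "c * ?h n \<le> 1 / 2" for f n
    proof -
      interpret two_binary_communities n "k n" "q n" "s n" "M n" "x n" "M' n" "x' n"
        by (rule loc[OF n])
      \<comment> \<open>Edge probabilities p under P satisfy \<open>q n \<le> p\<close> and
        \<open>p \<le> \<tau>\<^sub>1\<close>, so p (1 - p) is at least \<open>?v\<close>.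
        Proportions are at least C / Mhat, so signals are at most \<open>?b\<close> in both
        models.\<close>
      let ?v = "q n * (1 - \<tau>\<^sub>1)" and ?b = "s n * Mhat n / C"
      have q: "0 < q n" by (rule q_pos[OF n])
      have sx: "s n / y \<le> ?b" if "0 < y" "C \<le> m * y" "m \<le> Mhat n" for y m
      proof -
        have "C \<le> Mhat n * y"
          using that mult_right_mono[of m "Mhat n" y] by linarith
        then have "s n * C \<le> s n * (Mhat n * y)"
          using P.params by (intro mult_left_mono) auto
        then show ?thesis
          using that(1) C_pos by (simp add: field_simps)
      qed
      have st: "s n / x n l \<le> \<tau>\<^sub>1 - q n" if l: "l \<in> {1..M n}" for l
      proof -
        have "Min (x n ` {1..M n}) \<le> x n l" "0 < Min (x n ` {1..M n})"
          using l P.x_pos by (auto intro!: Min_le)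
        then have "s n / x n l \<le> s n / Min (x n ` {1..M n})"
          using P.params P.x_pos[OF l] by (intro divide_left_mono mult_pos_pos) auto
        then show ?thesis
          using q_s_le[OF n] by linarith
      qed
      have "1 \<in> {1..M n}"
        using P.params by simp
      then have \<tau>q: "0 \<le> \<tau>\<^sub>1 - q n"
        using st[of 1] P.params P.x_pos[of 1] by (meson divide_nonneg_pos order_trans)
      have v: "?v \<le> (q n + P.signal \<sigma> e) * (1 - (q n + P.signal \<sigma> e))"
        if "\<sigma> \<in> set_pmf P.labels" for \<sigma> e
      proof (rule mult_mono)
        show "q n \<le> q n + P.signal \<sigma> e"
          using P.signal_nonneg[OF that] by simp
        show "1 - \<tau>\<^sub>1 \<le> 1 - (q n + P.signal \<sigma> e)"
          using P.signal_le[OF that st \<tau>q, of e] by simp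
      qed (use q tau P.signal_nonneg[OF that, of e] in auto)
      have "(measure_pmf.expectation (P n) (f n) - measure_pmf.expectation (Q n) (f n))\<^sup>2 \<le>
          2 * (c * ?h n) * measure_pmf.variance (P n) (f n)"
        unfolding P_def Q_def
      proof (rule low_degree_gap_le[where D = "D n" and v = ?v and b = ?b])
        show "polynomial_of_degree_le ({1..n} \<times> {1..n}) (D n) (f n)"
          using f by (simp add: degree_test_def)
        show "0 < ?v" using q tau by simp
        show "0 \<le> ?b"
          using P.params C_pos by (simp add: Mhat_def)
        show "s n / x n l \<le> ?b" if "l \<in> {1..M n}" for l
          using sx[OF P.x_pos[OF that] x_ge[OF n that] M_le(1)] .
        show "s n / x' n l \<le> ?b" if "l \<in> {1..M' n}" for l
          using sx[OF Q.x_pos[OF that] x'_ge[OF n that] M_le(2)] .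
        show "c * ?h n = 16 * real (D n) ^ 5 * ?b\<^sup>2 / ?v * max ((k n)\<^sup>2 / n) 1"
          by (simp add: c_def power_divide power_mult_distrib mult_ac)
      qed (use v le in auto)
      also have "\<dots> \<le> 2 * (c * ?h n) * (test_std (P n) (Q n) (f n))\<^sup>2"
      proof (rule mult_left_mono)
        have "0 \<le> max (measure_pmf.variance (Q n) (f n)) (measure_pmf.variance (P n) (f n))"
          by (simp add: le_max_iff_disj)
        then show "measure_pmf.variance (P n) (f n) \<le> (test_std (P n) (Q n) (f n))\<^sup>2"
          by (simp add: test_std_def)
        show "0 \<le> 2 * (c * ?h n)"
          using c q by (intro mult_nonneg_nonneg) auto
      qed
      finally show ?thesis
        by (simp add: test_gap_def)
    qed
    show "\<not> (\<exists>f. degree_test D f \<and> weakly_separates P Q f)"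
    proof
      assume "\<exists>f. degree_test D f \<and> weakly_separates P Q f"
      then obtain f where f: "degree_test D f" "weakly_separates P Q f"
        by blast
      let ?std = "\<lambda>n. test_std (P n) (Q n) (f n)" and ?gap = "\<lambda>n. test_gap (P n) (Q n) (f n)"
      obtain B where B: "0 < B" "\<forall>\<^sub>F n in sequentially. norm (?std n) \<le> B * norm (?gap n)"
        using f(2) unfolding weakly_separates_def by (blast elim: landau_o.bigE)
      have ne: "\<forall>\<^sub>F n in sequentially.
          measure_pmf.expectation (P n) (f n) \<noteq> measure_pmf.expectation (Q n) (f n)"
        using f(2) by (simp add: weakly_separates_def)
      \<comment> \<open>The first entry of the minimum meets the smallness requirement of
        \<open>gap\<close>. The second gives gap^2 <= 2 (1 / (4 B^2)) B^2 gap^2 = gap^2 / 2,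
        impossible for a nonzero gap.\<close>
      define \<epsilon> where "\<epsilon> = min (1 / 2) (1 / (4 * B\<^sup>2)) / c"
      have "0 < \<epsilon>"
        using B(1) c by (simp add: \<epsilon>_def)
      then have "\<forall>\<^sub>F n in sequentially. norm (?h n) \<le> \<epsilon> * norm (1 :: real)"
        using small by (rule landau_o.smallD[rotated])
      with B(2) ne eventually_ge_at_top[of 1] have "\<forall>\<^sub>F n in sequentially. False"
      proof eventually_elim
        case (elim n)
        have "?h n \<le> norm (?h n)"
          unfolding real_norm_def by (rule abs_ge_self)
        also have "\<dots> \<le> \<epsilon> * norm (1 :: real)"
          by (rule elim(4))
        finally have h: "?h n \<le> \<epsilon>"
          by (simp only: norm_one mult_1_right)
        have "c * ?h n \<le> c * \<epsilon>"
          using h c by (intro mult_left_mono) auto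
        also have "c * \<epsilon> = min (1 / 2) (1 / (4 * B\<^sup>2))"
          using c by (simp add: \<epsilon>_def)
        finally have ch: "c * ?h n \<le> 1 / 2" "c * ?h n \<le> 1 / (4 * B\<^sup>2)"
          by simp_all
        have gap0: "0 < (?gap n)\<^sup>2"
          using elim(2) by (simp add: test_gap_def)
        have std: "(?std n)\<^sup>2 \<le> B\<^sup>2 * (?gap n)\<^sup>2"
        proof -
          have "(norm (?std n))\<^sup>2 \<le> (B * norm (?gap n))\<^sup>2"
            using elim(1) by (intro power_mono) auto
          then show ?thesis
            by (simp add: power_mult_distrib)
        qed
        have "(?gap n)\<^sup>2 \<le> 2 * (c * ?h n) * (?std n)\<^sup>2"
          by (rule gap[OF f(1) elim(3) ch(1)])
        also have "\<dots> \<le> 2 * (1 / (4 * B\<^sup>2)) * (B\<^sup>2 * (?gap n)\<^sup>2)"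
        proof (rule mult_mono)
          show "2 * (c * ?h n) \<le> 2 * (1 / (4 * B\<^sup>2))"
            using ch(2) by linarith
        qed (use std in auto)
        also have "\<dots> = (?gap n)\<^sup>2 / 2"
          using B(1) by simp
        finally show False
          using gap0 by simp
      qed
      then show False by simp
    qed
  }
  {
    assume "(\<lambda>n. Mtilde n powr (2 / 3) * (s n ^ 2 / q n) * (k n ^ 2 / real n)) \<in> \<omega>(\<lambda>_. 1) \<and>
      (\<lambda>n. Mhat n powr (- 1 / 3) * s n * k n) \<in> \<omega>(\<lambda>_. 1) \<and>
      (\<lambda>n. Mtilde n ^ 2 * k n / Mhat n ^ 2) \<in> \<omega>(\<lambda>_. 1)"
    then have lim: "(\<lambda>n. Mtilde n powr (2 / 3) * (s n ^ 2 / q n) * (k n ^ 2 / real n)) \<in> \<omega>(\<lambda>_. 1)"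
      "(\<lambda>n. Mhat n powr (- 1 / 3) * s n * k n) \<in> \<omega>(\<lambda>_. 1)"
      "(\<lambda>n. Mtilde n ^ 2 * k n / Mhat n ^ 2) \<in> \<omega>(\<lambda>_. 1)"
      by auto
    let ?f = "\<lambda>n. triangle_stat n (q n)"
    let ?std = "\<lambda>n. test_std (P n) (Q n) (?f n)" and ?gap = "\<lambda>n. test_gap (P n) (Q n) (?f n)"
    define K where "K = 746496 * (9 + 2 / C)"
    have K: "0 < K"
      using C_pos by (simp add: K_def add_pos_pos)
    \<comment> \<open>The three growth conditions enter only through an arbitrary threshold L that
      all three expressions eventually exceed; letting L grow gives strong separation.\<close>
    have main: "\<forall>\<^sub>F n in sequentially. (?std n)\<^sup>2 \<le> K / L * (?gap n)\<^sup>2 \<and> 0 < ?gap n"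
      if L: "1 \<le> L" for L :: real
    proof -
      have "0 < L" using L by simp
      from landau_omega.smallD[OF lim(1) this] landau_omega.smallD[OF lim(2) this]
        landau_omega.smallD[OF lim(3) this] eventually_ge_at_top[of 3]
      show ?thesis
      proof eventually_elim
        case (elim n)
        have n: "n \<ge> 1" using elim(4) by simp
        interpret two_binary_communities n "k n" "q n" "s n" "M n" "x n" "M' n" "x' n"
          by (rule loc[OF n])
        have q: "0 < q n" by (rule q_pos[OF n])
        let ?t = "Mtilde n" and ?H = "Mhat n"
        have H: "1 \<le> ?H"
          using P.params by (simp add: Mhat_def)
        \<comment> \<open>If the community numbers were equal, the third expression would be 0 and
          could not reach L. Being integers, they then differ by at least 1.\<close>
        have "?t \<noteq> 0"
          using elim(3) L by auto
        then have "M n \<noteq> M' n" by (auto simp: Mtilde_def)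
        then have t: "1 \<le> ?t" by (auto simp: Mtilde_def)
        \<comment> \<open>The real powers of the growth conditions, to be used only through
          \<open>u ^ 3 = ?t\<^sup>2\<close> and \<open>w ^ 3 = ?H\<close>.\<close>
        define u where "u = ?t powr (2 / 3)"
        define w where "w = ?H powr (1 / 3)"
        have u: "0 < u" "u ^ 3 = ?t\<^sup>2"
          using t powr_realpow[of "?t" 2] by (auto simp: u_def powr_power)
        have w: "0 < w" "w ^ 3 = ?H"
          using H by (auto simp: w_def powr_power)
        have "L \<le> u * ((s n)\<^sup>2 / q n) * ((k n)\<^sup>2 / n)"
          using elim(1) u q by (simp add: u_def abs_mult)
        then have l1: "L * (q n * n) \<le> u * (s n * k n)\<^sup>2"
          using q n by (simp add: field_simps power_mult_distrib)
        have "L \<le> s n * k n / w"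
          using elim(2) P.params H by (simp add: w_def abs_mult powr_minus_divide)
        then have l2: "L * w \<le> s n * k n"
          using w by (simp add: field_simps)
        have "L \<le> ?t\<^sup>2 * k n / ?H\<^sup>2"
          using elim(3) P.params by (simp add: abs_mult)
        then have l3: "L * ?H\<^sup>2 \<le> ?t\<^sup>2 * k n"
          using H by (simp add: field_simps)
        define G where "G = real (n choose 3) * ((k n / n) ^ 3 * (s n) ^ 3 * ?t)"
        have sk: "0 < s n * k n"
          using l2 L w by (smt (verit) mult_pos_pos)
        have "0 < s n"
          using sk P.params by (simp add: zero_less_mult_iff)
        then have G: "0 < G"
          using t elim(4) P.params n by (simp add: G_def)
        have "measure_pmf.expectation (P n) (?f n) - measure_pmf.expectation (Q n) (?f n) =
            real (n choose 3) * ((k n / n) ^ 3 * (s n) ^ 3 * (real (M n) - real (M' n)))"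
          unfolding P_def Q_def P.expectation_triangle_stat Q.expectation_triangle_stat
          by (simp only: right_diff_distrib)
        then have gap: "?gap n = G"
          using P.params by (simp add: test_gap_def G_def Mtilde_def abs_mult)
        have "measure_pmf.variance (P n) (?f n) \<le> K / L * G\<^sup>2"
          unfolding P_def G_def K_def
          by (rule P.variance_triangle_stat_le_gap[OF C_pos x_ge[OF n] q t M_le(1) L u w l1 l2 l3 elim(4)])
        moreover have "measure_pmf.variance (Q n) (?f n) \<le> K / L * G\<^sup>2"
          unfolding Q_def G_def K_def
          by (rule Q.variance_triangle_stat_le_gap[OF C_pos x'_ge[OF n] q t M_le(2) L u w l1 l2 l3 elim(4)])
        moreover have "0 \<le> max (measure_pmf.variance (Q n) (?f n)) (measure_pmf.variance (P n) (?f n))"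
          by (simp add: le_max_iff_disj)
        ultimately show ?case
          using G by (simp add: gap test_std_def)
      qed
    qed
    show "\<exists>f. degree_test (\<lambda>_. 3) f \<and> strongly_separates P Q f"
    proof (intro exI conjI)
      show "degree_test (\<lambda>_. 3) ?f"
        unfolding degree_test_def by (intro allI polynomial_triangle_stat)
      have "?std \<in> o(?gap)"
      proof (rule landau_o.smallI)
        fix c :: real assume c: "0 < c"
        \<comment> \<open>The second entry makes K / L at most c^2, which is the required factor c
          after taking square roots; the first meets the requirement of \<open>main\<close>.\<close>
        define L where "L = max 1 (K / c\<^sup>2)"
        have L: "1 \<le> L" "K / c\<^sup>2 \<le> L"
          by (simp_all add: L_def)
        then have KL: "K / L \<le> c\<^sup>2"
          using c by (simp add: field_simps)
        show "\<forall>\<^sub>F n in sequentially. norm (?std n) \<le> c * norm (?gap n)"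
          using main[OF L(1)]
        proof eventually_elim
          case (elim n)
          then have "(?std n)\<^sup>2 \<le> K / L * (?gap n)\<^sup>2" by simp
          also have "\<dots> \<le> c\<^sup>2 * (?gap n)\<^sup>2"
            by (intro mult_right_mono KL) simp
          also have "\<dots> = (c * norm (?gap n))\<^sup>2"
            by (simp add: power_mult_distrib)
          finally have "norm (?std n) \<le> \<bar>c * norm (?gap n)\<bar>"
            by (simp only: abs_le_square_iff real_norm_def)
          then show ?case
            using c by (simp add: abs_mult)
        qed
      qed
      moreover have "\<forall>\<^sub>F n in sequentially.
          measure_pmf.expectation (P n) (?f n) \<noteq> measure_pmf.expectation (Q n) (?f n)"
        using main[OF order_refl] by eventually_elim (auto simp: test_gap_def)
      ultimately show "strongly_separates P Q ?f"
        by (simp add: strongly_separates_def)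
    qed
  }
qed

end
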